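(* Let $d\ge2$, let $T_\ell$ be the $\ell$-th Gaussian eigenfunction on the unit sphere $\mathbb S^d$, and let $$D_\ell=\int_{\mathbb S^d}1(T_\ell(x)>0)\,dx-\int_{\mathbb S^d}1(T_\ell(x)<0)\,dx$$ be its Defect. Then, as $\ell\to+\infty$ along even integers, $$\mathrm{Var}(D_\ell)=\frac{C_d}{\ell^d}(1+o(1)),$$ where $C_d$ is a strictly positive constant depending on $d$, given by $$C_d=\frac4\pi\,\mu_d\,\mu_{d-1}\int_0^{+\infty}\psi^{d-1}\Bigl(\arcsin\bigl(b_d(\psi)\bigr)-b_d(\psi)\Bigr)\,d\psi,\qquad b_d(\psi)=2^{\frac d2-1}\left(\tfrac d2-1\right)!\;J_{\frac d2-1}(\psi)\,\psi^{-\left(\frac d2-1\right)}.$$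
   Context: $dx$ is the (unnormalized) surface measure on $\mathbb S^d\subset\mathbb R^{d+1}$ and $\mu_d=\frac{2\pi^{(d+1)/2}}{\Gamma((d+1)/2)}$ is the total mass of $\mathbb S^d$. $T_\ell$ is the centered Gaussian random field on $\mathbb S^d$ (with continuous paths) with covariance $\mathbb E[T_\ell(x)T_\ell(y)]=G_{\ell;d}(\cos d(x,y))$, where $d(x,y)$ is the geodesic distance and $G_{\ell;d}$ is the Gegenbauer polynomial normalized by $G_{\ell;d}(1)=1$, i.e. $G_{\ell;d}=P_\ell^{(\frac d2-1,\frac d2-1)}/\binom{\ell+\frac d2-1}{\ell}$ with $P_\ell^{(\alpha,\beta)}$ the Jacobi polynomials. $J_\nu$ is the Bessel function of the first kind of order $\nu$, and $(\frac d2-1)!=\Gamma(\frac d2)$. The integral is understood as an improper integral $\lim_{A\to\infty}\int_0^A$ when it does not converge absolutely. *)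

theory Defs
  imports "HOL-Probability.Probability" "HOL-Library.Landau_Symbols"
begin

text \<open>
  The unnormalized surface measure on the unit sphere of an \<open>n\<close>-dimensional Euclidean space, as
  the measure of polar coordinates: the measure of \<open>A\<close> is \<open>n\<close> times the Lebesgue measure of
  the cone \<open>{r x | 0 < r \<le> 1, x \<in> A}\<close>.
\<close>

definition surface_measure :: "'a::euclidean_space measure" where
  "surface_measure =
     scale_measure (of_nat DIM('a))
       (distr (restrict_space lborel (cball 0 1 - {0})) (restrict_space borel (sphere 0 1))
          (\<lambda>x. x /\<^sub>R norm x))"

definition sphere_mass :: "nat \<Rightarrow> real" where
  "sphere_mass d = 2 * pi powr ((real d + 1) / 2) / Gamma ((real d + 1) / 2)"

lemma space_surface_measure [simp]: "space surface_measure = sphere 0 1"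
  by (simp add: surface_measure_def space_scale_measure space_restrict_space)

lemma emeasure_surface_measure_sphere:
  assumes "DIM('a::euclidean_space) = d + 1"
  shows "emeasure (surface_measure :: 'a measure) (sphere 0 1) = sphere_mass d"
proof -
  have meas: "(\<lambda>x::'a. x /\<^sub>R norm x) \<in>
      restrict_space lborel (cball 0 1 - {0}) \<rightarrow>\<^sub>M restrict_space borel (sphere 0 1)"
    by (rule measurable_restrict_space2)
      (auto simp: space_restrict_space intro!: measurable_restrict_space1)
  have pre: "(\<lambda>x::'a. x /\<^sub>R norm x) -` sphere 0 1 \<inter> (cball 0 1 - {0}) = cball 0 1 - {0}"
    by auto
  have "emeasure (surface_measure :: 'a measure) (sphere 0 1) =
      of_nat DIM('a) * emeasure lborel (cball (0::'a) 1 - {0})"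
    by (simp add: surface_measure_def emeasure_distr meas sets_restrict_space_iff
        space_restrict_space pre emeasure_restrict_space)
  also have "emeasure lborel (cball (0::'a) 1 - {0}) = emeasure lborel (cball (0::'a) 1)"
    by (rule emeasure_Diff_null_set) auto
  also have "\<dots> = ennreal (unit_ball_vol (real (d + 1)))"
    using assms by (simp add: emeasure_cball)
  also have "of_nat DIM('a) * \<dots> = ennreal (real (d + 1) * unit_ball_vol (real (d + 1)))"
    by (subst ennreal_mult) (auto simp: assms ennreal_of_nat_eq_real_of_nat)
  also have "real (d + 1) * unit_ball_vol (real (d + 1)) = sphere_mass d"
  proof -
    define h where "h = (real d + 1) / 2"
    have h: "h > 0" "real (d + 1) = 2 * h"
      by (simp_all add: h_def)
    have "Gamma (h + 1) = h * Gamma h"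
      by (rule Gamma_plus1) (use h(1) in \<open>auto elim!: nonpos_Ints_cases\<close>)
    moreover have "Gamma h > 0"
      using h(1) by (rule Gamma_real_pos)
    ultimately show ?thesis
      using h(1) unfolding h(2) unit_ball_vol_def sphere_mass_def h_def [symmetric] by simp
  qed
  finally show ?thesis .
qed

definition geodesic_dist :: "'a::euclidean_space \<Rightarrow> 'a \<Rightarrow> real" where
  "geodesic_dist x y = arccos (x \<bullet> y)"

definition jacobi_poly :: "nat \<Rightarrow> real \<Rightarrow> real \<Rightarrow> real \<Rightarrow> real" where
  "jacobi_poly n \<alpha> \<beta> x =
     (\<Sum>s\<le>n. ((real n + \<alpha>) gchoose (n - s)) * ((real n + \<beta>) gchoose s) *
        ((x - 1) / 2) ^ s * ((x + 1) / 2) ^ (n - s))"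

definition gegenbauer :: "nat \<Rightarrow> nat \<Rightarrow> real \<Rightarrow> real" where
  "gegenbauer d l x =
     jacobi_poly l (real d / 2 - 1) (real d / 2 - 1) x / ((real l + real d / 2 - 1) gchoose l)"

lemma gegenbauer_at_1:
  assumes "d \<ge> 1"
  shows "gegenbauer d l 1 = 1"
proof -
  have "((real l + real d / 2 - 1) gchoose l) = pochhammer (real d / 2) l / fact l"
    by (simp add: gbinomial_pochhammer' algebra_simps)
  moreover have "pochhammer (real d / 2) l > 0"
    using assms by (intro pochhammer_pos) auto
  moreover have "jacobi_poly l (real d / 2 - 1) (real d / 2 - 1) 1 =
      ((real l + real d / 2 - 1) gchoose l)"
    unfolding jacobi_poly_def
    by (subst sum.remove[of _ 0]) (auto intro!: sum.neutral simp: algebra_simps)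
  ultimately show ?thesis
    by (simp add: gegenbauer_def)
qed

text \<open>
  The Bessel function of the first kind, for arguments \<open>x > 0\<close> only: since \<open>0 powr 0 = 0\<close>, the
  value at \<open>x = 0\<close> is not the usual one when \<open>\<nu> = 0\<close>. Below, this affects an integrand at the
  single point 0 only.
\<close>

definition bessel_J :: "real \<Rightarrow> real \<Rightarrow> real" where
  "bessel_J \<nu> x =
     (\<Sum>m. (-1) ^ m / (fact m * Gamma (real m + \<nu> + 1)) * (x / 2) powr (2 * real m + \<nu>))"

text \<open>Almost surely constant random variables count as (degenerate) Gaussian ones.\<close>

definition gaussian_rv :: "'w measure \<Rightarrow> ('w \<Rightarrow> real) \<Rightarrow> bool" where
  "gaussian_rv M X \<longleftrightarrow>
     X \<in> borel_measurable M \<and>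
     ((\<exists>m. AE \<omega> in M. X \<omega> = m) \<or>
      (\<exists>m \<sigma>. \<sigma> > 0 \<and> distributed M lborel X (\<lambda>x. ennreal (normal_density m \<sigma> x))))"

definition gaussian_field :: "'w measure \<Rightarrow> 'a set \<Rightarrow> ('a \<Rightarrow> 'w \<Rightarrow> real) \<Rightarrow> bool" where
  "gaussian_field M S T \<longleftrightarrow>
     (\<forall>F c. finite F \<and> F \<subseteq> S \<longrightarrow> gaussian_rv M (\<lambda>\<omega>. \<Sum>x\<in>F. c x * T x \<omega>))"

definition gaussian_eigenfunction ::
  "'w measure \<Rightarrow> nat \<Rightarrow> nat \<Rightarrow> ('a::euclidean_space \<Rightarrow> 'w \<Rightarrow> real) \<Rightarrow> bool" where
  "gaussian_eigenfunction M d l T \<longleftrightarrow>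
     prob_space M \<and>
     gaussian_field M (sphere 0 1) T \<and>
     (\<forall>\<omega>\<in>space M. continuous_on (sphere 0 1) (\<lambda>x. T x \<omega>)) \<and>
     (\<forall>x\<in>sphere 0 1. prob_space.expectation M (T x) = 0) \<and>
     (\<forall>x\<in>sphere 0 1. \<forall>y\<in>sphere 0 1.
        prob_space.expectation M (\<lambda>\<omega>. T x \<omega> * T y \<omega>) = gegenbauer d l (cos (geodesic_dist x y)))"

definition defect :: "('a::euclidean_space \<Rightarrow> 'w \<Rightarrow> real) \<Rightarrow> 'w \<Rightarrow> real" where
  "defect T \<omega> =
     (\<integral>x. indicator {y. T y \<omega> > 0} x \<partial>surface_measure) -
     (\<integral>x. indicator {y. T y \<omega> < 0} x \<partial>surface_measure)"

definition improper_integrable :: "(real \<Rightarrow> real) \<Rightarrow> bool" where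
  "improper_integrable f \<longleftrightarrow>
     (\<forall>A\<ge>0. f integrable_on {0..A}) \<and> (\<exists>I. ((\<lambda>A. integral {0..A} f) \<longlongrightarrow> I) at_top)"

definition improper_integral :: "(real \<Rightarrow> real) \<Rightarrow> real" where
  "improper_integral f = Lim at_top (\<lambda>A. integral {0..A} f)"

definition scaled_bessel :: "nat \<Rightarrow> real \<Rightarrow> real" where
  "scaled_bessel d \<psi> =
     2 powr (real d / 2 - 1) * Gamma (real d / 2) * bessel_J (real d / 2 - 1) \<psi> *
     \<psi> powr (- (real d / 2 - 1))"

definition defect_integrand :: "nat \<Rightarrow> real \<Rightarrow> real" where
  "defect_integrand d \<psi> = \<psi> ^ (d - 1) * (arcsin (scaled_bessel d \<psi>) - scaled_bessel d \<psi>)"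

definition defect_const :: "nat \<Rightarrow> real" where
  "defect_const d =
     4 / pi * sphere_mass d * sphere_mass (d - 1) * improper_integral (defect_integrand d)"

end

theory Submission
  imports Defs "HOL-Real_Asymp.Real_Asymp"
begin

text \<open>
  The signs of a centred Gaussian pair with unit variances and correlation \<open>\<rho>\<close> have correlation
  \<open>(2 / \<pi>) arcsin \<rho>\<close>. Hence the variance of the defect is a double integral of
  \<open>(2 / \<pi>) arcsin (G (x \<bullet> y))\<close>, and integrating over zones reduces it to
  \<open>\<integral> sin^(d-1) \<theta> (arcsin u - u) d\<theta>\<close> over \<open>[0, \<pi>/2]\<close>, where \<open>u \<theta> = G (cos \<theta>)\<close>; the linear term
  integrates to 0 because \<open>G\<close> is orthogonal to the constants.

  After the scaling \<open>\<theta> = \<psi> / l\<close> the integrand converges by the Mehler-Heine formula, and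
  dominated convergence applies on bounded intervals. The tails are small uniformly in \<open>l\<close>: with
  \<open>s = sin^(d-1)\<close>, the equation \<open>(s u')' = - \<lambda> s u\<close> and an energy estimate give
  \<open>|u| = O((l \<theta>)^(-(d-1)/2))\<close>, which handles all powers of \<open>u\<close> from the fifth on. The cubic term is not
  absolutely integrable for \<open>d \<le> 3\<close>, but \<open>s u^3\<close> is the derivative of an expression in \<open>u\<close> and
  \<open>u'\<close> up to an error that is. These bounds survive the limit, so nothing about the
  Bessel function is needed beyond its power series.

  For the positivity of the constant, the Taylor coefficients of arcsin are positive and all powers
  of the covariance kernel have nonnegative integral, so the constant dominates a multiple of the
  integral of \<open>\<psi>^(d-1) b(\<psi>)^(2k+1)\<close> for each \<open>k\<close>. For large \<open>k\<close> the latter is dominated by a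
  neighbourhood of 0, where \<open>b\<close> is close to 1.
\<close>

section \<open>Gegenbauer polynomials and the Mehler-Heine limit\<close>

text \<open>The obstacle is the interchange of \<open>l\<close> to infinity with an improper
  integral. The amplitude of \<open>b\<close> is of order \<open>\<psi>\<close> to the power
  -(d-1)/2, so against the weight \<open>\<psi> ^ (d - 1)\<close> the cubic term has that same
  order, and for \<open>d\<close> equal to 2 or 3 only oscillation makes it converge. No dominating
  function exists on the half-line. What is needed is a tail bound that depends on the lower
  end-point alone and holds for every degree and every upper end-point, which is why decay is
  derived at finite degree from the differential equation, a damped oscillator. The constant is not
  visibly positive either: \<open>arcsin b - b\<close> has the sign of \<open>b\<close>, which keeps
  changing. The information comes from finite even degrees, where \<open>G\<close> is a covariance,
  and is carried over by the limit. Evenness of \<open>l\<close> makes \<open>u\<close> symmetric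
  about \<open>pi / 2\<close>, so only the half on which the cotangent is nonnegative, and friction
  really dissipates energy, has to be analysed.\<close>

lemma jacobi_poly_expansion:
  "jacobi_poly n \<alpha> \<beta> x =
    (\<Sum>k\<le>n. ((real n + \<alpha>) gchoose (n - k)) * ((real n + real k + \<alpha> + \<beta>) gchoose k) * ((x - 1) / 2) ^ k)"
proof -
  define t where "t = (x - 1) / 2"
  define h where "h s j = ((real n + \<alpha>) gchoose (n - s)) * ((real n + \<beta>) gchoose s) * t ^ s *
        (real (n - s choose j) * t ^ j)" for s j
  have t1: "(x + 1) / 2 = t + 1" by (simp add: t_def field_simps)
  have "jacobi_poly n \<alpha> \<beta> x = (\<Sum>s\<le>n. \<Sum>j\<le>n - s. h s j)"
    unfolding jacobi_poly_def t_def [symmetric] t1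
    by (intro sum.cong refl) (simp add: binomial_ring h_def sum_distrib_left mult_ac)
  also have "\<dots> = (\<Sum>(s, j)\<in>Sigma {..n} (\<lambda>s. {..n - s}). h s j)"
    by (rule sum.Sigma) auto
  also have "Sigma {..n} (\<lambda>s. {..n - s}) = {(s, j). s + j \<le> n}"
    by auto
  also have "(\<Sum>(s, j)\<in>{(s, j). s + j \<le> n}. h s j) = (\<Sum>k\<le>n. \<Sum>s\<le>k. h s (k - s))"
    by (rule sum.triangle_reindex_eq)
  also have "\<dots> = (\<Sum>k\<le>n. ((real n + \<alpha>) gchoose (n - k)) * ((real n + real k + \<alpha> + \<beta>) gchoose k) * t ^ k)"
  proof (intro sum.cong refl)
    fix k assume "k \<in> {..n}"
    hence k: "k \<le> n" by simp
    \<comment> \<open>Trinomial revision makes \<open>(real n + \<alpha>) gchoose (n - k)\<close> a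
      common factor of all terms. What is left is a Vandermonde convolution with upper arguments
      \<open>real n + \<beta>\<close> and \<open>real k + \<alpha>\<close>.\<close>
    have "(\<Sum>s\<le>k. h s (k - s)) =
      (\<Sum>s\<le>k. (((real n + \<beta>) gchoose s) * ((real k + \<alpha>) gchoose (k - s))) * (((real n + \<alpha>) gchoose (n - k)) * t ^ k))"
    proof (intro sum.cong refl)
      fix s assume "s \<in> {..k}"
      hence s: "s \<le> k" by simp
      have "((real n + \<alpha>) gchoose (n - s)) * real (n - s choose (k - s)) =
          ((real n + \<alpha>) gchoose (n - s)) * (real (n - s) gchoose (n - k))"
        using k s by (subst binomial_symmetric) (auto simp: binomial_gbinomial)
      also have "\<dots> = ((real n + \<alpha>) gchoose (n - k)) * ((real n + \<alpha> - real (n - k)) gchoose (n - s - (n - k)))"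
        using k s by (intro gbinomial_trinomial_revision) auto
      also have "real n + \<alpha> - real (n - k) = real k + \<alpha>" using k by simp
      also have "n - s - (n - k) = k - s" using k s by simp
      finally have *: "((real n + \<alpha>) gchoose (n - s)) * real (n - s choose (k - s)) =
        ((real n + \<alpha>) gchoose (n - k)) * ((real k + \<alpha>) gchoose (k - s))" .
      have tk: "t ^ k = t ^ s * t ^ (k - s)" using s by (simp flip: power_add)
      have "h s (k - s) = (((real n + \<alpha>) gchoose (n - s)) * real (n - s choose (k - s))) *
         ((real n + \<beta>) gchoose s) * t ^ k"
        unfolding h_def tk by (simp add: mult_ac)
      also note *
      finally show "h s (k - s) = (((real n + \<beta>) gchoose s) * ((real k + \<alpha>) gchoose (k - s))) * (((real n + \<alpha>) gchoose (n - k)) * t ^ k)"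
        by (simp add: mult_ac)
    qed
    also have "\<dots> = ((real n + \<beta> + (real k + \<alpha>)) gchoose k) * (((real n + \<alpha>) gchoose (n - k)) * t ^ k)"
      using gbinomial_Vandermonde [of "real n + \<beta>" "real k + \<alpha>" k]
      by (simp only: sum_distrib_right [symmetric] atMost_atLeast0)
    also have "real n + \<beta> + (real k + \<alpha>) = real n + real k + \<alpha> + \<beta>" by simp
    finally show "(\<Sum>s\<le>k. h s (k - s)) = ((real n + \<alpha>) gchoose (n - k)) * ((real n + real k + \<alpha> + \<beta>) gchoose k) * t ^ k"
      by (simp only: mult_ac)
  qed
  finally show ?thesis by (simp add: t_def)
qed

text \<open>These are the coefficients of the hypergeometric function 2F1(-l, l+d-1; d/2; (1-x)/2),
  with the signs absorbed by expanding in \<open>(x - 1) / 2\<close>. The product vanishes by itself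
  for \<open>k > l\<close>, and it can be bounded and passed to the limit factor by factor.\<close>

definition geg_coeff :: "nat \<Rightarrow> nat \<Rightarrow> nat \<Rightarrow> real" where
  "geg_coeff d l k = (\<Prod>j<k. (real l - real j) * (real l + real d - 1 + real j) / ((real d / 2 + real j) * (real j + 1)))"

lemma geg_coeff_0 [simp]: "geg_coeff d l 0 = 1"
  by (simp add: geg_coeff_def)

lemma geg_coeff_Suc:
  "geg_coeff d l (Suc k) = geg_coeff d l k *
     ((real l - real k) * (real l + real d - 1 + real k) / ((real d / 2 + real k) * (real k + 1)))"
  by (simp add: geg_coeff_def)

text \<open>Passing from \<open>k\<close> to \<open>k + 1\<close> multiplies the first binomial by
  (l-k)/(d/2+k) and the second by (l+k+d-1)/(k+1). Together these are the new factor of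
  \<open>geg_coeff\<close>.\<close>

lemma geg_coeff_gchoose:
  assumes "d \<ge> 1" "k \<le> l"
  shows "((real l + (real d / 2 - 1)) gchoose (l - k)) * ((real l + real k + (real d / 2 - 1) + (real d / 2 - 1)) gchoose k) =
     geg_coeff d l k * ((real l + real d / 2 - 1) gchoose l)"
  using assms(2)
proof (induction k)
  case 0
  thus ?case by (simp add: algebra_simps)
next
  case (Suc k)
  define a where "a = real l + (real d / 2 - 1)"
  define b where "b = real l + real k + (real d / 2 - 1) + (real d / 2 - 1)"
  define m where "m = l - Suc k"
  have lk: "l - k = Suc m" using Suc.prems by (simp add: m_def)
  have rm: "real m = real l - real k - 1" using Suc.prems by (simp add: m_def)
  have 1: "(a gchoose Suc m) * (real l - real k) = (a gchoose m) * (real d / 2 + real k)"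
    using gbinomial_mult_1' [of a m] rm by (simp add: a_def algebra_simps)
  have 2: "((b + 1) gchoose Suc k) * (real k + 1) = (b + 1) * (b gchoose k)"
    using Suc_times_gbinomial [of k b] by (simp add: algebra_simps)
  have IH: "(a gchoose Suc m) * (b gchoose k) = geg_coeff d l k * ((real l + real d / 2 - 1) gchoose l)"
    using Suc by (simp add: a_def b_def lk)
  have pos: "real d / 2 + real k > 0" "real k + 1 > 0" using assms(1) by auto
  have "(a gchoose m) * ((b + 1) gchoose Suc k) * ((real d / 2 + real k) * (real k + 1)) =
      ((a gchoose m) * (real d / 2 + real k)) * (((b + 1) gchoose Suc k) * (real k + 1))"
    by (simp only: mult_ac)
  also have "\<dots> = ((a gchoose Suc m) * (b gchoose k)) * ((real l - real k) * (b + 1))"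
    unfolding 1 [symmetric] 2 by (simp only: mult_ac)
  also have "\<dots> = (a gchoose Suc m) * (b gchoose k) * ((real l - real k) * (real l + real d - 1 + real k))"
    by (simp add: b_def)
  finally have *: "(a gchoose m) * ((b + 1) gchoose Suc k) * ((real d / 2 + real k) * (real k + 1)) =
       (a gchoose Suc m) * (b gchoose k) * ((real l - real k) * (real l + real d - 1 + real k))" .
  have "(a gchoose m) * ((b + 1) gchoose Suc k) =
     geg_coeff d l (Suc k) * ((real l + real d / 2 - 1) gchoose l)"
  proof -
    have "x = c * (y / p) * g" if "x * p = c * g * y" "p \<noteq> 0" for x y c g p :: real
      using that by (simp add: field_simps)
    thus ?thesis using * pos unfolding IH geg_coeff_Suc by auto
  qed
  thus ?case by (simp add: a_def b_def m_def algebra_simps)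
qed

definition geg_poly :: "nat \<Rightarrow> nat \<Rightarrow> real poly" where
  "geg_poly d l = (\<Sum>k\<le>l. monom (geg_coeff d l k) k)"

lemma gegenbauer_eq_sum:
  assumes "d \<ge> 1"
  shows "gegenbauer d l x = (\<Sum>k\<le>l. geg_coeff d l k * ((x - 1) / 2) ^ k)"
proof -
  have "((real l + real d / 2 - 1) gchoose l) = pochhammer (real d / 2) l / fact l"
    by (simp add: gbinomial_pochhammer' algebra_simps)
  moreover have "pochhammer (real d / 2) l > 0"
    using assms by (intro pochhammer_pos) auto
  ultimately have nz: "((real l + real d / 2 - 1) gchoose l) \<noteq> 0" by simp
  have "jacobi_poly l (real d / 2 - 1) (real d / 2 - 1) x =
    (\<Sum>k\<le>l. geg_coeff d l k * ((x - 1) / 2) ^ k) * ((real l + real d / 2 - 1) gchoose l)"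
    unfolding jacobi_poly_expansion sum_distrib_right
  proof (intro sum.cong refl)
    fix k assume "k \<in> {..l}"
    hence "k \<le> l" by simp
    show "(real l + (real d / 2 - 1) gchoose (l - k)) *
         (real l + real k + (real d / 2 - 1) + (real d / 2 - 1) gchoose k) * ((x - 1) / 2) ^ k =
       geg_coeff d l k * ((x - 1) / 2) ^ k * (real l + real d / 2 - 1 gchoose l)"
      unfolding geg_coeff_gchoose [OF assms \<open>k \<le> l\<close>] by (simp only: mult_ac)
  qed
  thus ?thesis using nz by (simp add: gegenbauer_def)
qed

lemma gegenbauer_eq_poly:
  assumes "d \<ge> 1"
  shows "gegenbauer d l x = poly (geg_poly d l) ((x - 1) / 2)"
  by (simp add: gegenbauer_eq_sum [OF assms] geg_poly_def poly_sum poly_monom)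

lemma coeff_geg_poly: "coeff (geg_poly d l) k = geg_coeff d l k"
proof (cases "k \<le> l")
  case True
  thus ?thesis by (simp add: geg_poly_def coeff_sum)
next
  case False
  hence "geg_coeff d l k = 0"
    unfolding geg_coeff_def by (intro prod_zero) (auto intro!: bexI [of _ l])
  with False show ?thesis by (auto simp: geg_poly_def coeff_sum intro!: sum.neutral)
qed

text \<open>This is the hypergeometric equation in the variable t = (x-1)/2. Its coefficient of
  degree \<open>k\<close> is exactly the two-term recursion \<open>rec\<close>.\<close>

lemma geg_poly_ode:
  assumes "d \<ge> 1"
  shows "[:0, 1, 1:] * pderiv (pderiv (geg_poly d l)) + [:real d / 2, real d:] * pderiv (geg_poly d l) =
     smult (real l * (real l + real d - 1)) (geg_poly d l)"
proof (rule poly_eqI)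
  fix k
  define c where "c = geg_coeff d l"
  define h where "h = real d / 2"
  have hd: "real d = 2 * h" by (simp add: h_def)
  have pos: "h + real k > 0" "real k + 1 > 0" using assms by (auto simp: h_def)
  have rec: "c (Suc k) * ((h + real k) * (real k + 1)) = c k * ((real l - real k) * (real l + 2 * h - 1 + real k))"
    using pos by (simp add: c_def geg_coeff_Suc hd)
  show "coeff ([:0, 1, 1:] * pderiv (pderiv (geg_poly d l)) + [:real d / 2, real d:] * pderiv (geg_poly d l)) k =
     coeff (smult (real l * (real l + real d - 1)) (geg_poly d l)) k"
  \<comment> \<open>The cases only evaluate the index shifts caused by multiplication with t and
    t^2.\<close>
  proof (cases k)
    case 0
    thus ?thesis using rec
      by (simp add: coeff_pderiv coeff_geg_poly c_def [symmetric] coeff_pCons algebra_simps hd)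
  next
    case (Suc m)
    show ?thesis
    proof (cases m)
      case 0
      with Suc rec show ?thesis
        by (simp add: coeff_pderiv coeff_geg_poly c_def [symmetric] coeff_pCons algebra_simps hd numeral_2_eq_2)
    next
      case (Suc j)
      with \<open>k = Suc m\<close> rec show ?thesis
        by (simp add: coeff_pderiv coeff_geg_poly c_def [symmetric] coeff_pCons algebra_simps hd)
    qed
  qed
qed

text \<open>Negating \<open>x\<close> exchanges the two bases up to sign, and reversing the
  summation exchanges the two binomials because both parameters agree. The signs multiply to
  (-1)^l.\<close>

lemma gegenbauer_minus:
  assumes "even l"
  shows "gegenbauer d l (- x) = gegenbauer d l x"
proof -
  have "jacobi_poly l a a (- x) = jacobi_poly l a a x" for a
  proof -
    define g where "g s = ((real l + a) gchoose (l - s)) * ((real l + a) gchoose s) *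
        ((x - 1) / 2) ^ s * ((x + 1) / 2) ^ (l - s)" for s
    have "jacobi_poly l a a (- x) = (\<Sum>s\<le>l. g (l - s))"
      unfolding jacobi_poly_def
    proof (intro sum.cong refl)
      fix s assume "s \<in> {..l}"
      hence s: "s \<le> l" by simp
      have "(- x - 1) / 2 = (-1) * ((x + 1) / 2)" "(1 - x) / 2 = (-1) * ((x - 1) / 2)"
        by (simp_all add: field_simps)
      hence "((- x - 1) / 2) ^ s = (-1) ^ s * ((x + 1) / 2) ^ s"
        "((1 - x) / 2) ^ (l - s) = (-1) ^ (l - s) * ((x - 1) / 2) ^ (l - s)"
        by (simp_all only: power_mult_distrib)
      moreover have "(-1 :: real) ^ s * (-1) ^ (l - s) = 1"
        using assms s by (simp flip: power_add)
      moreover have "p * q * A * B = q * p * (e * B) * (e' * A)" if "e * e' = 1" for p q A B e e' :: real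
      proof -
        have "q * p * (e * B) * (e' * A) = (e * e') * (p * q * A * B)" by (simp only: mult_ac)
        thus ?thesis using that by simp
      qed
      ultimately show "(real l + a gchoose (l - s)) * (real l + a gchoose s) * ((- x - 1) / 2) ^ s * ((- x + 1) / 2) ^ (l - s) = g (l - s)"
        using s by (simp add: g_def)
    qed
    also have "\<dots> = (\<Sum>s\<le>l. g s)"
      by (rule sum.reindex_bij_witness [of _ "\<lambda>s. l - s" "\<lambda>s. l - s"]) auto
    finally show ?thesis by (simp add: jacobi_poly_def g_def)
  qed
  thus ?thesis by (simp add: gegenbauer_def)
qed

section \<open>The zonal function in the polar angle and its differential equation\<close>

definition zonal :: "nat \<Rightarrow> nat \<Rightarrow> real \<Rightarrow> real" where
  "zonal d l \<theta> = gegenbauer d l (cos \<theta>)"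

text \<open>The chain rule through (cos \<theta> - 1)/2, which has derivative -sin \<theta>/2. The
  closed form is continuous everywhere and vanishes at both poles, where the differential equation
  is singular.\<close>

definition zonal' :: "nat \<Rightarrow> nat \<Rightarrow> real \<Rightarrow> real" where
  "zonal' d l \<theta> = - (sin \<theta> / 2) * poly (pderiv (geg_poly d l)) ((cos \<theta> - 1) / 2)"

text \<open>The eigenvalue of minus the Laplace-Beltrami operator on spherical harmonics of degree
  \<open>l\<close>.\<close>

definition zonal_ev :: "nat \<Rightarrow> nat \<Rightarrow> real" where
  "zonal_ev d l = real l * (real l + real d - 1)"

lemma zonal_0: "d \<ge> 1 \<Longrightarrow> zonal d l 0 = 1"
  by (simp add: zonal_def gegenbauer_at_1)

lemma zonal'_0: "zonal' d l 0 = 0"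
  by (simp add: zonal'_def)

lemma zonal'_pi: "zonal' d l pi = 0"
  by (simp add: zonal'_def)

lemma zonal_deriv:
  assumes "d \<ge> 1"
  shows "(zonal d l has_real_derivative zonal' d l \<theta>) (at \<theta>)"
proof -
  have *: "zonal d l = (\<lambda>\<theta>. poly (geg_poly d l) ((cos \<theta> - 1) / 2))"
    by (simp add: zonal_def gegenbauer_eq_poly [OF assms] fun_eq_iff)
  show ?thesis unfolding * zonal'_def
    by (auto intro!: derivative_eq_intros DERIV_chain2 [OF poly_DERIV])
qed

text \<open>The hypergeometric equation pulled back to the angle, by means of cos \<theta> = 1 + 2t
  and (sin \<theta>)^2 = -4t(1+t). It is the eigenvalue equation of the Laplacian for functions of
  the polar angle.\<close>

lemma zonal'_deriv:
  assumes "d \<ge> 1" "sin \<theta> \<noteq> 0"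
  shows "(zonal' d l has_real_derivative
     - zonal_ev d l * zonal d l \<theta> - (real d - 1) * (cos \<theta> / sin \<theta>) * zonal' d l \<theta>) (at \<theta>)"
proof -
  define t where "t = (cos \<theta> - 1) / 2"
  define p0 p1 p2 where "p0 = poly (geg_poly d l) t" and "p1 = poly (pderiv (geg_poly d l)) t"
    and "p2 = poly (pderiv (pderiv (geg_poly d l))) t"
  have der: "(zonal' d l has_real_derivative
     - (cos \<theta> / 2) * p1 + (sin \<theta>)\<^sup>2 / 4 * p2) (at \<theta>)"
    unfolding zonal'_def [abs_def] p1_def p2_def t_def
    by (auto intro!: derivative_eq_intros DERIV_chain2 [OF poly_DERIV] simp: power2_eq_square field_simps)
  have "poly ([:0, 1, 1:] * pderiv (pderiv (geg_poly d l)) + [:real d / 2, real d:] * pderiv (geg_poly d l)) t =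
     poly (smult (real l * (real l + real d - 1)) (geg_poly d l)) t"
    by (simp only: geg_poly_ode [OF assms(1)])
  hence ode: "(t + t * t) * p2 + (real d / 2 + real d * t) * p1 = zonal_ev d l * p0"
    by (simp add: p0_def p1_def p2_def zonal_ev_def algebra_simps)
  have c: "cos \<theta> = 1 + 2 * t" by (simp add: t_def field_simps)
  have s: "(sin \<theta>)\<^sup>2 = - 4 * (t + t * t)"
    using sin_squared_eq [of \<theta>] by (simp add: c power2_eq_square algebra_simps)
  have z: "zonal d l \<theta> = p0" "zonal' d l \<theta> = - (sin \<theta> / 2) * p1"
    by (simp_all add: zonal_def zonal'_def gegenbauer_eq_poly [OF assms(1)] p0_def p1_def t_def)
  have "- zonal_ev d l * zonal d l \<theta> - (real d - 1) * (cos \<theta> / sin \<theta>) * zonal' d l \<theta> =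
     - zonal_ev d l * p0 + (real d - 1) * cos \<theta> / 2 * p1"
    using assms(2) unfolding z by simp
  also have "\<dots> = - (cos \<theta> / 2) * p1 + (sin \<theta>)\<^sup>2 / 4 * p2"
  proof -
    have "- zonal_ev d l * p0 = - ((t + t * t) * p2 + (real d / 2 + real d * t) * p1)"
      using ode by simp
    thus ?thesis unfolding s c by (simp add: field_simps)
  qed
  finally show ?thesis using der by simp
qed

lemma zonal_reflect: "even l \<Longrightarrow> zonal d l (pi - \<theta>) = zonal d l \<theta>"
  by (simp add: zonal_def gegenbauer_minus)

text \<open>The function 0F1(; d/2; -y). In the variable y = \<psi>^2/4 the normalized Bessel
  function is an everywhere convergent power series with value 1 at 0, free of the special role of 0
  in \<open>powr\<close>.\<close>

definition bessel_series :: "nat \<Rightarrow> real \<Rightarrow> real" where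
  "bessel_series d y = (\<Sum>k. (- 1) ^ k / (fact k * pochhammer (real d / 2) k) * y ^ k)"

lemma summable_bessel_series:
  assumes "d \<ge> 2"
  shows "summable (\<lambda>k. (- 1) ^ k / (fact k * pochhammer (real d / 2) k) * (y::real) ^ k)"
proof (rule summable_comparison_test')
  show "summable (\<lambda>k. \<bar>y\<bar> ^ k /\<^sub>R fact k)" by (rule summable_exp_generic)
  fix k :: nat
  have "pochhammer (real d / 2) k \<ge> 1"
    unfolding pochhammer_prod using assms by (intro prod_ge_1) auto
  hence "inverse (fact k * pochhammer (real d / 2) k) \<le> inverse (fact k)"
    by (intro le_imp_inverse_le) auto
  hence "inverse (fact k * pochhammer (real d / 2) k) * \<bar>y\<bar> ^ k \<le> inverse (fact k) * \<bar>y\<bar> ^ k"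
    by (intro mult_right_mono) auto
  moreover have "norm ((- 1) ^ k / (fact k * pochhammer (real d / 2) k) * y ^ k) =
     inverse (fact k * pochhammer (real d / 2) k) * \<bar>y\<bar> ^ k"
    using \<open>pochhammer (real d / 2) k \<ge> 1\<close>
    by (simp add: abs_mult abs_divide power_abs field_simps)
  ultimately show "norm ((- 1) ^ k / (fact k * pochhammer (real d / 2) k) * y ^ k) \<le> \<bar>y\<bar> ^ k /\<^sub>R fact k"
    by simp
qed

lemma scaled_bessel_eq_series:
  assumes "d \<ge> 2" "\<psi> > 0"
  shows "scaled_bessel d \<psi> = bessel_series d (\<psi>\<^sup>2 / 4)"
proof -
  define \<nu> where "\<nu> = real d / 2 - 1"
  have nu: "\<nu> \<ge> 0" using assms by (simp add: \<nu>_def)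
  have G: "Gamma (real m + \<nu> + 1) = Gamma (real d / 2) * pochhammer (real d / 2) m" for m
  proof -
    have "real d / 2 \<notin> \<int>\<^sub>\<le>\<^sub>0" using assms by (auto elim!: nonpos_Ints_cases)
    from pochhammer_Gamma [OF this, of m] have "pochhammer (real d / 2) m = Gamma (real d / 2 + real m) / Gamma (real d / 2)" .
    moreover have "Gamma (real d / 2) > 0" using assms by (intro Gamma_real_pos) auto
    ultimately show ?thesis by (simp add: \<nu>_def field_simps)
  qed
  have Gp: "Gamma (real d / 2) > 0" using assms by (intro Gamma_real_pos) auto
  have p: "(\<psi> / 2) powr (2 * real m + \<nu>) = (\<psi>\<^sup>2 / 4) ^ m * (\<psi> / 2) powr \<nu>" for m
  proof -
    have "(\<psi> / 2) powr (2 * real m) = (\<psi> / 2) ^ (2 * m)"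
      using assms powr_realpow [of "\<psi> / 2" "2 * m"] by simp
    also have "\<dots> = (\<psi>\<^sup>2 / 4) ^ m" by (simp add: power_mult power_divide)
    finally show ?thesis by (simp add: powr_add)
  qed
  have "bessel_J \<nu> \<psi> = (\<Sum>m. ((\<psi> / 2) powr \<nu> / Gamma (real d / 2)) *
      ((-1) ^ m / (fact m * pochhammer (real d / 2) m) * (\<psi>\<^sup>2 / 4) ^ m))"
    unfolding bessel_J_def p G by (simp add: mult_ac)
  also have "\<dots> = ((\<psi> / 2) powr \<nu> / Gamma (real d / 2)) * bessel_series d (\<psi>\<^sup>2 / 4)"
    unfolding bessel_series_def by (rule suminf_mult [OF summable_bessel_series [OF assms(1)]])
  finally have "scaled_bessel d \<psi> = 2 powr \<nu> * (\<psi> / 2) powr \<nu> * \<psi> powr (- \<nu>) * bessel_series d (\<psi>\<^sup>2 / 4)"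
    using Gp by (simp add: scaled_bessel_def \<nu>_def [symmetric])
  also have "2 powr \<nu> * (\<psi> / 2) powr \<nu> * \<psi> powr (- \<nu>) = 1"
    using assms by (simp add: powr_divide powr_minus field_simps)
  finally show ?thesis by simp
qed

lemma geg_coeff_tendsto:
  assumes "d \<ge> 2"
  shows "(\<lambda>l. geg_coeff d l k * (- ((sin (\<psi> / (2 * real l)))\<^sup>2)) ^ k) \<longlonglongrightarrow>
     (- 1) ^ k / (fact k * pochhammer (real d / 2) k) * (\<psi>\<^sup>2 / 4) ^ k"
proof -
  have sin_lim: "(\<lambda>l. real l * sin (\<psi> / (2 * real l))) \<longlonglongrightarrow> \<psi> / 2"
  proof (cases "\<psi> = 0")
    case False
    have "(\<lambda>l. \<psi> / (2 * real l)) \<longlonglongrightarrow> 0" by real_asymp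
    moreover have "eventually (\<lambda>l. \<psi> / (2 * real l) \<noteq> 0) sequentially"
      using eventually_gt_at_top [of 0] by eventually_elim (use False in auto)
    ultimately have "filterlim (\<lambda>l. \<psi> / (2 * real l)) (at 0) sequentially"
      by (simp add: filterlim_at)
    moreover have "((\<lambda>x::real. sin x / x) \<longlongrightarrow> 1) (at 0)"
      by real_asymp
    ultimately have "(\<lambda>l. sin (\<psi> / (2 * real l)) / (\<psi> / (2 * real l))) \<longlonglongrightarrow> 1"
      by (rule filterlim_compose [rotated])
    hence "(\<lambda>l. (\<psi> / 2) * (sin (\<psi> / (2 * real l)) / (\<psi> / (2 * real l)))) \<longlonglongrightarrow> (\<psi> / 2) * 1"
      by (intro tendsto_mult tendsto_const)
    thus ?thesis using False by (simp add: mult_ac)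
  qed auto
  \<comment> \<open>Each of the two linear factors takes one division by \<open>real l\<close>, and
    the squared sine takes the compensating square of \<open>real l\<close>. Every factor then
    converges on its own.\<close>
  have "(\<lambda>l. \<Prod>j<k. ((real l - real j) / real l) * ((real l + real d - 1 + real j) / real l) / ((real d / 2 + real j) * (real j + 1)) *
        (- ((real l * sin (\<psi> / (2 * real l)))\<^sup>2))) \<longlonglongrightarrow>
     (\<Prod>j<k. 1 * 1 / ((real d / 2 + real j) * (real j + 1)) * (- ((\<psi> / 2)\<^sup>2)))"
  proof (intro tendsto_prod tendsto_mult tendsto_divide tendsto_const tendsto_minus tendsto_power sin_lim)
    fix j show "(\<lambda>l. (real l - real j) / real l) \<longlonglongrightarrow> 1" by real_asymp
    show "(\<lambda>l. (real l + real d - 1 + real j) / real l) \<longlonglongrightarrow> 1" by real_asymp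
  qed (use assms in auto)
  also have "(\<Prod>j<k. 1 * 1 / ((real d / 2 + real j) * (real j + 1)) * (- ((\<psi> / 2)\<^sup>2))) =
     (- 1) ^ k / (fact k * pochhammer (real d / 2) k) * (\<psi>\<^sup>2 / 4) ^ k"
  proof -
    have "(fact k :: real) = (\<Prod>j<k. real j + 1)"
      by (induction k) (auto simp: algebra_simps)
    moreover have "pochhammer (real d / 2) k = (\<Prod>j<k. real d / 2 + real j)"
      by (simp add: pochhammer_prod atLeast0LessThan)
    ultimately have "fact k * pochhammer (real d / 2) k = (\<Prod>j<k. (real d / 2 + real j) * (real j + 1))"
      by (simp add: prod.distrib mult.commute)
    moreover have "(\<Prod>j<k. 1 * 1 / ((real d / 2 + real j) * (real j + 1)) * (- ((\<psi> / 2)\<^sup>2))) =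
        (1 / (\<Prod>j<k. (real d / 2 + real j) * (real j + 1))) * (- ((\<psi> / 2)\<^sup>2)) ^ k"
      by (simp only: prod.distrib prod_constant card_lessThan prod_dividef mult_1 prod.neutral_const power_one)
    moreover have "(- ((\<psi> / 2)\<^sup>2)) ^ k = (- 1) ^ k * (\<psi>\<^sup>2 / 4) ^ k"
    proof -
      have "- ((\<psi> / 2)\<^sup>2) = (- 1) * (\<psi>\<^sup>2 / 4)" by (simp add: power_divide)
      thus ?thesis by (simp only: power_mult_distrib)
    qed
    ultimately show ?thesis by simp
  qed
  finally show ?thesis
  proof (rule Lim_transform_eventually)
    show "\<forall>\<^sub>F l in sequentially. (\<Prod>j<k. ((real l - real j) / real l) * ((real l + real d - 1 + real j) / real l) / ((real d / 2 + real j) * (real j + 1)) *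
        (- ((real l * sin (\<psi> / (2 * real l)))\<^sup>2))) = geg_coeff d l k * (- ((sin (\<psi> / (2 * real l)))\<^sup>2)) ^ k"
      using eventually_gt_at_top [of 0]
    proof eventually_elim
      case (elim l)
      have "geg_coeff d l k * (- ((sin (\<psi> / (2 * real l)))\<^sup>2)) ^ k =
        (\<Prod>j<k. (real l - real j) * (real l + real d - 1 + real j) / ((real d / 2 + real j) * (real j + 1)) * - ((sin (\<psi> / (2 * real l)))\<^sup>2))"
        by (simp only: geg_coeff_def prod.distrib prod_constant card_lessThan)
      also have "\<dots> = (\<Prod>j<k. ((real l - real j) / real l) * ((real l + real d - 1 + real j) / real l) / ((real d / 2 + real j) * (real j + 1)) *
        (- ((real l * sin (\<psi> / (2 * real l)))\<^sup>2)))"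
      proof (intro prod.cong refl)
        fix j
        have "A * B / C * - (s\<^sup>2) = (A / L) * (B / L) / C * (- ((L * s)\<^sup>2))" if "L > 0" for A B C s L :: real
          using that by (simp add: power2_eq_square)
        thus "(real l - real j) * (real l + real d - 1 + real j) / ((real d / 2 + real j) * (real j + 1)) * - ((sin (\<psi> / (2 * real l)))\<^sup>2) =
          ((real l - real j) / real l) * ((real l + real d - 1 + real j) / real l) / ((real d / 2 + real j) * (real j + 1)) *
          (- ((real l * sin (\<psi> / (2 * real l)))\<^sup>2))"
          using elim by simp
      qed
      finally show ?case ..
    qed
  qed
qed

text \<open>The summable majorant, uniform in \<open>l\<close>, for exchanging limit and series.
  Each factor is controlled by (l-j)(l+d-1+j) <= l(l+d-1) <= d l^2 and l^2 sin^2(\<psi>/(2l)) <=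
  \<psi>^2/4, while d/2 + j >= 1 leaves only the factorial in the denominator.\<close>

lemma geg_coeff_bound:
  assumes "d \<ge> 2" "l \<ge> 1"
  shows "\<bar>geg_coeff d l k * (- ((sin (\<psi> / (2 * real l)))\<^sup>2)) ^ k\<bar> \<le> (real d * \<psi>\<^sup>2 / 4) ^ k / fact k"
proof (cases "k \<le> l")
  case False
  hence "geg_coeff d l k = 0"
    unfolding geg_coeff_def by (intro prod_zero) (auto intro!: bexI [of _ l])
  thus ?thesis by simp
next
  case True
  have "\<bar>geg_coeff d l k * (- ((sin (\<psi> / (2 * real l)))\<^sup>2)) ^ k\<bar> =
    (\<Prod>j<k. \<bar>(real l - real j) * (real l + real d - 1 + real j) / ((real d / 2 + real j) * (real j + 1)) * (- ((sin (\<psi> / (2 * real l)))\<^sup>2))\<bar>)"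
    unfolding abs_prod [symmetric] by (simp only: geg_coeff_def prod.distrib prod_constant card_lessThan)
  also have "\<dots> \<le> (\<Prod>j<k. (real d * \<psi>\<^sup>2 / 4) / (real j + 1))"
  proof (intro prod_mono conjI)
    fix j assume j: "j \<in> {..<k}"
    hence jl: "real j \<le> real l" using True by auto
    have "(sin (\<psi> / (2 * real l)))\<^sup>2 \<le> (\<psi> / (2 * real l))\<^sup>2"
      by (metis abs_ge_zero abs_sin_x_le_abs_x power2_abs power_mono)
    hence s: "(real l)\<^sup>2 * (sin (\<psi> / (2 * real l)))\<^sup>2 \<le> \<psi>\<^sup>2 / 4"
      using assms by (simp add: power_divide power_mult_distrib field_simps)

    have "(real l - real j) * (real l + real d - 1 + real j) = real l * (real l + real d - 1) - real j * (real d - 1) - real j * real j"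
      by (simp add: algebra_simps)
    also have "\<dots> \<le> real l * (real l + real d - 1)"
    proof -
      have "0 \<le> real j * (real d - 1)" "0 \<le> real j * real j" using assms by auto
      thus ?thesis by linarith
    qed
    also have "\<dots> \<le> real d * (real l)\<^sup>2"
    proof -
      have "(real d - 1) * real l \<le> (real d - 1) * (real l * real l)"
        using assms by (intro mult_left_mono) auto
      thus ?thesis by (simp add: power2_eq_square algebra_simps)
    qed
    finally have 1: "(real l - real j) * (real l + real d - 1 + real j) \<le> real d * (real l)\<^sup>2" .
    have 0: "0 \<le> (real l - real j) * (real l + real d - 1 + real j)"
      using jl assms by (intro mult_nonneg_nonneg) auto
    have "(real l - real j) * (real l + real d - 1 + real j) * (sin (\<psi> / (2 * real l)))\<^sup>2 \<le>
       (real d * (real l)\<^sup>2) * (sin (\<psi> / (2 * real l)))\<^sup>2"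
      using 1 by (intro mult_right_mono) auto
    also have "\<dots> \<le> real d * (\<psi>\<^sup>2 / 4)"
      using mult_left_mono [OF s, of "real d"] by (simp add: mult_ac)
    finally have 2: "(real l - real j) * (real l + real d - 1 + real j) * (sin (\<psi> / (2 * real l)))\<^sup>2 \<le> real d * (\<psi>\<^sup>2 / 4)" .
    have 3: "(real d / 2 + real j) * (real j + 1) \<ge> 1 * (real j + 1)"
      using assms by (intro mult_right_mono) auto
    have "\<bar>(real l - real j) * (real l + real d - 1 + real j) / ((real d / 2 + real j) * (real j + 1)) * (- ((sin (\<psi> / (2 * real l)))\<^sup>2))\<bar> =
       ((real l - real j) * (real l + real d - 1 + real j) * (sin (\<psi> / (2 * real l)))\<^sup>2) / ((real d / 2 + real j) * (real j + 1))"
    proof -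
      have "\<bar>A / B * (- S)\<bar> = A * S / B" if "A \<ge> 0" "B \<ge> 0" "S \<ge> 0" for A B S :: real
        using that by (simp add: abs_mult)
      thus ?thesis using 0 3 by auto
    qed
    also have "\<dots> \<le> (real d * (\<psi>\<^sup>2 / 4)) / (1 * (real j + 1))"
      using 2 3 0 by (intro frac_le) auto
    finally show "\<bar>(real l - real j) * (real l + real d - 1 + real j) / ((real d / 2 + real j) * (real j + 1)) * (- ((sin (\<psi> / (2 * real l)))\<^sup>2))\<bar> \<le>
       (real d * \<psi>\<^sup>2 / 4) / (real j + 1)" by simp
  qed auto
  also have "\<dots> = (real d * \<psi>\<^sup>2 / 4) ^ k / fact k"
  proof -
    have "(fact k :: real) = (\<Prod>j<k. real j + 1)"
      by (induction k) (auto simp: algebra_simps)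
    hence "(\<Prod>j<k. A / (real j + 1)) = A ^ k / fact k" for A
      by (simp only: prod_dividef prod_constant card_lessThan)
    thus ?thesis .
  qed
  finally show ?thesis .
qed

theorem mehler_heine:
  assumes "d \<ge> 2"
  shows "(\<lambda>l. zonal d l (\<psi> / real l)) \<longlonglongrightarrow> bessel_series d (\<psi>\<^sup>2 / 4)"
proof -
  define f where "f k l = geg_coeff d l k * (- ((sin (\<psi> / (2 * real l)))\<^sup>2)) ^ k" for k l
  have z: "zonal d l (\<psi> / real l) = (\<Sum>k. f k l)" for l
  proof -
    have "cos (\<psi> / real l) = 1 - 2 * (sin (\<psi> / (2 * real l)))\<^sup>2"
      using cos_double_sin [of "\<psi> / (2 * real l)"] by simp
    hence "zonal d l (\<psi> / real l) = (\<Sum>k\<le>l. f k l)"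
      using assms by (simp add: zonal_def gegenbauer_eq_sum f_def)
    also have "\<dots> = (\<Sum>k. f k l)"
    proof (rule suminf_finite [symmetric])
      fix k assume "k \<notin> {..l}"
      hence "geg_coeff d l k = 0"
        unfolding geg_coeff_def by (intro prod_zero) (auto intro!: bexI [of _ l])
      thus "f k l = 0" by (simp add: f_def)
    qed auto
    finally show ?thesis .
  qed
  have "((\<lambda>l. \<Sum>k. f k l) \<longlongrightarrow> (\<Sum>k. (- 1) ^ k / (fact k * pochhammer (real d / 2) k) * (\<psi>\<^sup>2 / 4) ^ k)) sequentially"
  proof (rule tannerys_theorem [THEN conjunct2, THEN conjunct2])
    show "\<forall>\<^sub>F (k, l) in at_top \<times>\<^sub>F sequentially. norm (f k l) \<le> (real d * \<psi>\<^sup>2 / 4) ^ k / fact k"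
      unfolding f_def
      by (subst eventually_prod_filter)
         (use geg_coeff_bound [OF assms(1), of _ _ \<psi>] in
          \<open>auto intro!: exI [of _ "\<lambda>_. True"] exI [of _ "\<lambda>l. l \<ge> 1"] eventually_ge_at_top\<close>)
    show "summable (\<lambda>k. (real d * \<psi>\<^sup>2 / 4) ^ k / fact k)"
    proof -
      have "summable (\<lambda>k. c ^ k / fact k)" for c :: real
        using summable_exp_generic [of c] by (simp add: divide_inverse mult_ac)
      thus ?thesis .
    qed
  qed (use geg_coeff_tendsto [OF assms] in \<open>simp_all add: f_def\<close>)
  thus ?thesis by (simp add: z bessel_series_def)
qed

section \<open>Decay of the zonal function\<close>

lemma mult_cos_le_sin:
  assumes "0 \<le> x" "x \<le> pi"
  shows "x * cos x \<le> sin x"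
proof -
  have "sin 0 - 0 * cos 0 \<le> sin x - x * cos x"
  proof (rule DERIV_nonneg_imp_nondecreasing [of 0 x])
    fix y assume y: "0 \<le> y" "y \<le> x"
    have "((\<lambda>x. sin x - x * cos x) has_real_derivative y * sin y) (at y)"
      by (auto intro!: derivative_eq_intros)
    moreover have "y * sin y \<ge> 0" using y assms by (intro mult_nonneg_nonneg sin_ge_zero) auto
    ultimately show "\<exists>z. ((\<lambda>x. sin x - x * cos x) has_real_derivative z) (at y) \<and> 0 \<le> z" by blast
  qed (use assms in auto)
  thus ?thesis by simp
qed

lemma cot_le_inverse:
  assumes "0 < x" "x \<le> pi / 2"
  shows "cos x / sin x \<le> 1 / x"
proof -
  have "sin x > 0" using assms by (intro sin_gt_zero) auto
  thus ?thesis using mult_cos_le_sin [of x] assms by (simp add: field_simps)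
qed

text \<open>The quotient sin x / x decreases on (0, pi/2], so its least value is the one at
  pi/2.\<close>

lemma jordan_sin_ge:
  assumes "0 < x" "x \<le> pi / 2"
  shows "x \<le> pi / 2 * sin x"
proof -
  have "sin (pi / 2) / (pi / 2) \<le> sin x / x"
  proof (rule DERIV_nonpos_imp_nonincreasing [of x "pi / 2"])
    fix y assume y: "x \<le> y" "y \<le> pi / 2"
    have "((\<lambda>x. sin x / x) has_real_derivative (y * cos y - sin y) / (y * y)) (at y)"
      using y assms by (auto intro!: derivative_eq_intros simp: field_simps)
    moreover have "(y * cos y - sin y) / (y * y) \<le> 0"
      using mult_cos_le_sin [of y] y assms by (intro divide_nonpos_nonneg) auto
    ultimately show "\<exists>z. ((\<lambda>x. sin x / x) has_real_derivative z) (at y) \<and> z \<le> 0" by blast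
  qed (use assms in auto)
  thus ?thesis using assms by (simp add: field_simps)
qed

lemma cot_antimono:
  assumes "0 < x" "x \<le> y" "y \<le> pi / 2"
  shows "cos y / sin y \<le> cos x / sin x"
proof (rule frac_le)
  show "0 < sin x" using assms by (intro sin_gt_zero) auto
  show "sin x \<le> sin y" using assms by (intro sin_monotone_2pi_le) auto
  show "cos y \<le> cos x" using assms by (intro cos_monotone_0_pi_le) auto
  show "0 \<le> cos x" using assms by (intro cos_ge_zero) auto
qed

text \<open>The integrand \<open>h\<close> is compared with an exact derivative \<open>f\<close>,
  and the discrepancy with a second exact derivative \<open>g\<close>. Only values at the end-points
  enter the bound, so cancellation in \<open>h\<close> is kept and the length of the interval does
  not matter.\<close>

lemma abs_integral_le_FTC:
  fixes f F G h :: "real \<Rightarrow> real"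
  assumes "a \<le> b" "continuous_on {a..b} h"
    and F: "\<And>x. x \<in> {a..b} \<Longrightarrow> (F has_real_derivative f x) (at x)"
    and G: "\<And>x. x \<in> {a..b} \<Longrightarrow> (G has_real_derivative g x) (at x)"
    and le: "\<And>x. x \<in> {a..b} \<Longrightarrow> \<bar>f x - h x\<bar> \<le> g x"
  shows "\<bar>integral {a..b} h\<bar> \<le> \<bar>F b - F a\<bar> + (G b - G a)"
proof -
  have h: "h integrable_on {a..b}" using assms(2) by (rule integrable_continuous_real)
  have f: "(f has_integral (F b - F a)) {a..b}"
    by (rule fundamental_theorem_of_calculus [OF assms(1)])
       (use F in \<open>auto simp: has_real_derivative_iff_has_vector_derivative [symmetric]
          intro: has_field_derivative_at_within\<close>)
  have g: "(g has_integral (G b - G a)) {a..b}"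
    by (rule fundamental_theorem_of_calculus [OF assms(1)])
       (use G in \<open>auto simp: has_real_derivative_iff_has_vector_derivative [symmetric]
          intro: has_field_derivative_at_within\<close>)
  have "((\<lambda>x. f x - h x) has_integral (F b - F a - integral {a..b} h)) {a..b}"
    using f h by (intro has_integral_diff integrable_integral)
  moreover have "norm (integral {a..b} (\<lambda>x. f x - h x)) \<le> integral {a..b} g"
    using le f g h by (intro integral_norm_bound_integral integrable_diff) (auto simp: has_integral_integrable)
  ultimately have "\<bar>F b - F a - integral {a..b} h\<bar> \<le> G b - G a"
    using integral_unique [OF g] by (simp add: integral_unique)
  thus ?thesis by linarith
qed

section \<open>The energy method at a fixed degree\<close>

locale zonal_fun =
  fixes d l :: nat
  assumes d: "d \<ge> 2" and l: "l \<ge> 1"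
begin

abbreviation "n \<equiv> d - 1"
abbreviation "u \<equiv> zonal d l"
abbreviation "v \<equiv> zonal' d l"
abbreviation "lam \<equiv> zonal_ev d l"

text \<open>The equation u'' + n cot(x) u' + lam u = 0 describes an oscillator with friction
  coefficient n cot(x). This is twice its mechanical energy; the friction is nonnegative up to
  \<open>pi / 2\<close>.\<close>

definition energy :: "real \<Rightarrow> real" where
  "energy x = (v x)\<^sup>2 + lam * (u x)\<^sup>2"

lemma n: "n \<ge> 1" "real n = real d - 1" "real n > 0" "Suc n = d"
  using d by auto

lemma lam_ge: "lam \<ge> (real l)\<^sup>2"
proof -
  have "real l * (real l + real d - 1) \<ge> real l * real l" using d by (intro mult_left_mono) auto
  thus ?thesis by (simp add: zonal_ev_def power2_eq_square)
qed

lemma lam_pos: "lam > 0"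
proof -
  have "(real l)\<^sup>2 > 0" using l by simp
  thus ?thesis using lam_ge by linarith
qed

lemma l_le_sqrt_lam: "real l \<le> sqrt lam"
  using lam_ge by (simp add: real_le_rsqrt)

lemma u_deriv: "(u has_real_derivative v x) (at x)"
  using zonal_deriv d by simp

lemma v_deriv: "sin x \<noteq> 0 \<Longrightarrow> (v has_real_derivative - lam * u x - real n * (cos x / sin x) * v x) (at x)"
  using zonal'_deriv [of d x l] d by simp

lemma u_cont: "continuous_on A u"
  using u_deriv by (meson DERIV_isCont continuous_at_imp_continuous_on)

lemma v_cont: "continuous_on A v"
  unfolding zonal'_def [abs_def] by (intro continuous_intros) auto

lemma energy_cont: "continuous_on A energy"
  unfolding energy_def [abs_def] by (intro continuous_intros u_cont v_cont)

lemma energy_0: "energy 0 = lam"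
  using d by (simp add: energy_def zonal_0 zonal'_0)

lemma energy_nonneg: "energy x \<ge> 0"
  using lam_pos by (simp add: energy_def)

lemma energy_deriv:
  assumes "sin x \<noteq> 0"
  shows "(energy has_real_derivative - 2 * real n * (cos x / sin x) * (v x)\<^sup>2) (at x)"
proof -
  have "(energy has_real_derivative 2 * v x * (- lam * u x - real n * (cos x / sin x) * v x) + lam * (2 * u x * v x)) (at x)"
    unfolding energy_def [abs_def]
    by (rule derivative_eq_intros u_deriv v_deriv [OF assms] refl)+ (simp add: mult_ac)
  also have "2 * v x * (- lam * u x - real n * (cos x / sin x) * v x) + lam * (2 * u x * v x) =
     - 2 * real n * (cos x / sin x) * (v x)\<^sup>2"
    by (simp add: power2_eq_square algebra_simps)
  finally show ?thesis .
qed

lemma energy_antimono: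
  assumes "0 \<le> a" "a \<le> b" "b \<le> pi / 2"
  shows "energy b \<le> energy a"
proof (rule DERIV_nonpos_imp_decreasing_open [OF assms(2) _ energy_cont])
  fix x assume x: "a < x" "x < b"
  have s: "sin x > 0" using x assms by (intro sin_gt_zero) auto
  have "cos x / sin x \<ge> 0" using s x assms by (intro divide_nonneg_nonneg cos_ge_zero) auto
  hence "0 \<le> 2 * real n * (cos x / sin x) * (v x)\<^sup>2"
    by (intro mult_nonneg_nonneg) auto
  hence "- 2 * real n * (cos x / sin x) * (v x)\<^sup>2 \<le> 0"
    by (simp only: mult_minus_left neg_le_0_iff_le)
  thus "\<exists>y. (energy has_real_derivative y) (at x) \<and> y \<le> 0"
    using energy_deriv [OF less_imp_neq [OF s, symmetric]] by blast
qed

lemma energy_le: "0 \<le> x \<Longrightarrow> x \<le> pi / 2 \<Longrightarrow> energy x \<le> lam"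
  using energy_antimono [of 0 x] energy_0 by simp

lemma abs_u_le_1:
  assumes "0 \<le> x" "x \<le> pi / 2"
  shows "\<bar>u x\<bar> \<le> 1"
proof -
  have "lam * (u x)\<^sup>2 \<le> lam * 1" using energy_le [OF assms] zero_le_power2 [of "v x"] unfolding energy_def by linarith
  hence "(u x)\<^sup>2 \<le> 1" using lam_pos by (simp only: mult_le_cancel_left_pos)
  thus ?thesis by (simp add: abs_square_le_1)
qed

text \<open>Measures the energy lost on \<open>{0..a}\<close>: the friction there is at least n
  cot(a), and the mean slope of \<open>u\<close> is \<open>(u a - 1) / a\<close>. The loss is not
  recovered before \<open>pi / 2\<close>. This is the source of a bound below 1 for the limit
  function away from 0, which \<open>abs_u_le_1\<close> does not give.\<close>

lemma energy_gap:
  assumes "0 < a" "a \<le> x" "x \<le> pi / 2"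
  shows "lam * (u x)\<^sup>2 \<le> lam - 2 * real n * (cos a / sin a) / a * (1 - u a)\<^sup>2"
proof -
  define c where "c = (u a - 1) / a"
  define k where "k = cos a / sin a"
  have k0: "k \<ge> 0" unfolding k_def using assms by (intro divide_nonneg_nonneg cos_ge_zero sin_ge_zero) auto
  \<comment> \<open>\<open>Q\<close> decreases because \<open>(v - c)\<^sup>2 \<ge> 0\<close>; this replaces the Cauchy-Schwarz inequality for \<open>\<integral> v\<^sup>2\<close>.\<close>
  define Q where "Q = (\<lambda>x. energy x + 2 * real n * k * (2 * c * u x - c\<^sup>2 * x))"
  have "Q a \<le> Q 0"
  proof (rule DERIV_nonpos_imp_decreasing_open [of 0 a])
    show "continuous_on {0..a} Q" unfolding Q_def by (intro continuous_intros energy_cont u_cont)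
    fix y assume y: "0 < y" "y < a"
    have s: "sin y > 0" using y assms by (intro sin_gt_zero) auto
    have der: "(Q has_real_derivative - 2 * real n * (cos y / sin y) * (v y)\<^sup>2 + 2 * real n * k * (2 * c * v y - c\<^sup>2)) (at y)"
      unfolding Q_def by (rule derivative_eq_intros energy_deriv u_deriv refl | use s in simp)+
    have "k * (2 * c * v y - c\<^sup>2) \<le> k * (v y)\<^sup>2"
      using k0 sum_squares_ge_zero [of "v y - c" 0] by (intro mult_left_mono) (auto simp: power2_eq_square algebra_simps)
    also have "\<dots> \<le> (cos y / sin y) * (v y)\<^sup>2"
      unfolding k_def using y assms by (intro mult_right_mono cot_antimono) auto
    finally have "2 * real n * (k * (2 * c * v y - c\<^sup>2)) \<le> 2 * real n * ((cos y / sin y) * (v y)\<^sup>2)"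
      by (intro mult_left_mono) auto
    hence "- 2 * real n * (cos y / sin y) * (v y)\<^sup>2 + 2 * real n * k * (2 * c * v y - c\<^sup>2) \<le> 0"
      by (simp add: mult_ac)
    thus "\<exists>z. (Q has_real_derivative z) (at y) \<and> z \<le> 0" using der by blast
  qed (use assms in auto)
  hence "energy a \<le> lam - 2 * real n * k * (2 * c * (u a - 1) - c\<^sup>2 * a)"
    using d by (simp add: Q_def energy_0 zonal_0 algebra_simps)
  also have "2 * c * (u a - 1) - c\<^sup>2 * a = (1 - u a)\<^sup>2 / a"
    using assms by (simp add: c_def power2_eq_square field_simps)
  finally have "energy a \<le> lam - 2 * real n * k / a * (1 - u a)\<^sup>2"
    by (simp add: mult_ac)
  moreover have "lam * (u x)\<^sup>2 \<le> energy x" by (simp add: energy_def)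
  moreover have "energy x \<le> energy a" using assms by (intro energy_antimono) auto
  ultimately show ?thesis unfolding k_def by linarith
qed

lemma sin_pow_deriv:
  assumes "sin x \<noteq> 0"
  shows "((\<lambda>x. sin x ^ n) has_real_derivative real n * (cos x / sin x) * sin x ^ n) (at x)"
proof -
  have "((\<lambda>x. sin x ^ n) has_real_derivative real n * (cos x * sin x ^ (n - Suc 0))) (at x)"
    by (rule derivative_eq_intros refl)+ simp
  moreover have "sin x ^ n = sin x * sin x ^ (n - Suc 0)"
    using n(1) by (cases "n") auto
  ultimately show ?thesis using assms by simp
qed

lemma abs_uv_le: "\<bar>u x * v x\<bar> \<le> energy x / (2 * sqrt lam)"
proof -
  have "0 \<le> (\<bar>v x\<bar> - sqrt lam * \<bar>u x\<bar>)\<^sup>2" by simp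
  also have "\<dots> = (v x)\<^sup>2 + (sqrt lam)\<^sup>2 * (u x)\<^sup>2 - 2 * sqrt lam * (\<bar>u x\<bar> * \<bar>v x\<bar>)"
    by (simp add: power2_eq_square algebra_simps)
  also have "(sqrt lam)\<^sup>2 = lam" using lam_pos by simp
  finally have "2 * sqrt lam * \<bar>u x * v x\<bar> \<le> energy x" by (simp add: energy_def abs_mult)
  thus ?thesis using lam_pos by (simp add: field_simps)
qed

text \<open>The derivative of \<open>sin x ^ n * energy x\<close> is n cot(x) sin(x)^n (lam u^2 -
  v^2), which oscillates, so the weighted energy should stay of its initial size. From
  \<open>real n / real l\<close> on, the friction n cot(x) is at most \<open>sqrt lam\<close>, hence
  \<open>K\<close> and \<open>F\<close> differ by at most half of \<open>F\<close>. The constant 9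
  is 2 * 3 * (3/2): from \<open>F\<close> to \<open>K\<close>, from the exponential factor, and back
  from \<open>K\<close> to \<open>F\<close>.\<close>

lemma sin_pow_energy_le:
  assumes "real n / real l \<le> x" "x \<le> pi / 2"
  shows "sin x ^ n * energy x \<le> 9 * lam * (real n / real l) ^ n"
proof -
  define L where "L = sqrt lam"
  define a where "a = real n / real l"
  have L: "L > 0" "real l \<le> L" using lam_pos l_le_sqrt_lam by (auto simp: L_def)
  have a: "a > 0" "a \<le> x" using n(3) l assms by (auto simp: a_def)
  moreover have "a \<le> pi / 2" using a(2) assms(2) by linarith
  ultimately have a: "a > 0" "a \<le> x" "a \<le> pi / 2" by auto
  \<comment> \<open>\<open>K\<close> differs from \<open>F\<close> by a term that cancels the oscillating part of \<open>F'\<close>; the exponential factor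
    in \<open>M\<close> absorbs the remaining derivative.\<close>
  define F where "F = (\<lambda>x. sin x ^ n * energy x)"
  define K where "K = (\<lambda>x. F x + real n * (cos x / sin x) * (sin x ^ n * u x * v x))"
  define M where "M = (\<lambda>x. K x * exp (real n * (cos x / sin x) / L))"
  have rng: "sin y > 0" "cos y \<ge> 0" "real n * (cos y / sin y) \<le> L" "F y \<ge> 0" if "y \<in> {a..pi/2}" for y
  proof -
    show s: "sin y > 0" using that a by (intro sin_gt_zero) auto
    show "cos y \<ge> 0" using that a by (intro cos_ge_zero) auto
    have "real n * (cos y / sin y) \<le> real n * (1 / y)"
      using that a by (intro mult_left_mono cot_le_inverse) auto
    also have "\<dots> \<le> real n * (1 / a)"
      using that a by (intro mult_left_mono divide_left_mono) auto
    also have "\<dots> = real l" using n(3) l by (simp add: a_def)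
    finally show "real n * (cos y / sin y) \<le> L" using L by simp
    show "F y \<ge> 0" using s energy_nonneg by (simp add: F_def)
  qed
  have suv: "\<bar>sin y ^ n * u y * v y\<bar> \<le> F y / (2 * L)" if "y \<in> {a..pi/2}" for y
  proof -
    have "\<bar>sin y ^ n * u y * v y\<bar> = sin y ^ n * \<bar>u y * v y\<bar>"
      using rng(1) [OF that] by (simp add: abs_mult)
    also have "\<dots> \<le> sin y ^ n * (energy y / (2 * L))"
      unfolding L_def using rng(1) [OF that] abs_uv_le by (intro mult_left_mono) auto
    finally show ?thesis by (simp add: F_def)
  qed
  have KF: "\<bar>K y - F y\<bar> \<le> F y / 2" if "y \<in> {a..pi/2}" for y
  proof -
    have "\<bar>K y - F y\<bar> = real n * (cos y / sin y) * \<bar>sin y ^ n * u y * v y\<bar>"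
      using rng [OF that] by (simp add: K_def abs_mult)
    also have "\<dots> \<le> L * (F y / (2 * L))"
      using rng [OF that] suv [OF that] L by (intro mult_mono) auto
    finally show ?thesis using L by simp
  qed
  have "M x \<le> M a"
  proof (rule DERIV_nonpos_imp_nonincreasing [OF a(2)])
    fix y assume "a \<le> y" "y \<le> x"
    hence y: "y \<in> {a..pi/2}" using assms by auto
    note r = rng [OF y]
    have s: "sin y \<noteq> 0" using r by simp
    have cot: "((\<lambda>x. cos x / sin x) has_real_derivative - 1 / (sin y)\<^sup>2) (at y)"
    proof -
      have "((\<lambda>x. cos x / sin x) has_real_derivative (- sin y * sin y - cos y * cos y) / (sin y * sin y)) (at y)"
        by (rule derivative_eq_intros refl s)+ simp
      also have "- sin y * sin y - cos y * cos y = - 1"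
        using sin_cos_squared_add [of y] by (simp add: power2_eq_square)
      finally show ?thesis by (simp add: power2_eq_square)
    qed
    define c where "c = cos y / sin y"
    define S where "S = sin y ^ n"
    have K': "(K has_real_derivative - real n * (S * u y * v y) / (sin y)\<^sup>2) (at y)"
    proof -
      have "(K has_real_derivative
          (real n * c * S * energy y + S * (- 2 * real n * c * (v y)\<^sup>2)) +
          (real n * (- 1 / (sin y)\<^sup>2) * (S * u y * v y) +
           real n * c * ((real n * c * S * u y + S * v y) * v y + S * u y * (- lam * u y - real n * c * v y)))) (at y)"
        unfolding K_def F_def c_def S_def
        apply (rule DERIV_add)
         apply (rule DERIV_cong, rule DERIV_mult, rule sin_pow_deriv [OF s], rule energy_deriv [OF s], simp)
        apply (rule DERIV_cong, rule DERIV_mult, rule DERIV_cmult, rule cot, rule DERIV_mult, rule DERIV_mult,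
            rule sin_pow_deriv [OF s], rule u_deriv, rule v_deriv [OF s])
        apply (simp only: algebra_simps)
        done
      also have "(real n * c * S * energy y + S * (- 2 * real n * c * (v y)\<^sup>2)) +
          (real n * (- 1 / (sin y)\<^sup>2) * (S * u y * v y) +
           real n * c * ((real n * c * S * u y + S * v y) * v y + S * u y * (- lam * u y - real n * c * v y))) =
         - real n * (S * u y * v y) / (sin y)\<^sup>2"
        by (simp add: energy_def power2_eq_square algebra_simps)
      finally show ?thesis .
    qed
    define D where "D = - real n * (S * u y * v y) / (sin y)\<^sup>2 - K y * (real n / (L * (sin y)\<^sup>2))"
    have M': "(M has_real_derivative exp (real n * (cos y / sin y) / L) * D) (at y)"
      unfolding M_def
      by (rule DERIV_cong, rule DERIV_mult [OF K'], rule DERIV_chain2 [OF DERIV_exp],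
          rule DERIV_cdivide, rule DERIV_cmult, rule cot)
         (use L s in \<open>simp add: D_def algebra_simps\<close>)
    have "- (S * u y * v y) \<le> F y / (2 * L)" using suv [OF y] unfolding S_def by linarith
    also have "\<dots> \<le> K y / L"
    proof -
      have "F y \<le> 2 * K y" using KF [OF y] by linarith
      thus ?thesis using L by (simp add: field_simps)
    qed
    finally have "- (S * u y * v y) * (real n / (sin y)\<^sup>2) \<le> K y / L * (real n / (sin y)\<^sup>2)"
      by (intro mult_right_mono) auto
    hence "D \<le> 0" by (simp add: D_def mult_ac)
    hence "exp (real n * (cos y / sin y) / L) * D \<le> 0" by (simp add: mult_nonneg_nonpos)
    thus "\<exists>z. (M has_real_derivative z) (at y) \<and> z \<le> 0" using M' by blast
  qed
  have x: "x \<in> {a..pi/2}" and a': "a \<in> {a..pi/2}" using a assms by auto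
  have "F x \<le> 2 * K x" using KF [OF x] by linarith
  also have "K x * 1 \<le> K x * exp (real n * (cos x / sin x) / L)"
  proof (rule mult_left_mono)
    have "real n * (cos x / sin x) / L \<ge> 0" using rng [OF x] L by auto
    thus "1 \<le> exp (real n * (cos x / sin x) / L)" by simp
    show "K x \<ge> 0" using KF [OF x] rng(4) [OF x] by linarith
  qed
  hence "2 * K x \<le> 2 * M x" by (simp add: M_def)
  also have "2 * M x \<le> 2 * M a" using \<open>M x \<le> M a\<close> by simp
  also have "M a \<le> K a * 3"
    unfolding M_def
  proof (rule mult_left_mono)
    have "real n * (cos a / sin a) / L \<le> 1"
      using rng(3) [OF a'] L(1) by (subst divide_le_eq_1_pos)
    hence "exp (real n * (cos a / sin a) / L) \<le> exp 1" by simp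
    also have "\<dots> \<le> 3" by (rule exp_le)
    finally show "exp (real n * (cos a / sin a) / L) \<le> 3" .
    show "K a \<ge> 0" using KF [OF a'] rng(4) [OF a'] by linarith
  qed
  hence "2 * M a \<le> 6 * K a" by simp
  also have "6 * K a \<le> 9 * F a" using KF [OF a'] by linarith
  also have "F a \<le> a ^ n * lam"
    unfolding F_def using a rng [OF a'] energy_nonneg energy_le [of a]
    by (intro mult_mono power_mono sin_x_le_x) auto
  hence "9 * F a \<le> 9 * lam * a ^ n" by (simp add: mult_ac)
  finally show ?thesis by (simp add: F_def a_def)
qed

text \<open>The 9 is that of \<open>sin_pow_energy_le\<close>; the power comes from (n/l)^n once the
  sine is replaced by the angle at the price of \<open>pi / 2\<close> per factor. The value depends
  on \<open>d\<close> only, which is what makes the tail bounds uniform in the degree.\<close>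

definition decay :: real where
  "decay = 9 * (real n * pi / 2) ^ n"

lemma decay_pos: "decay > 0"
  unfolding decay_def using n by (intro mult_pos_pos zero_less_power) auto

text \<open>For \<open>real l * x \<le> real n\<close> the trivial bound
  \<open>energy x \<le> lam\<close> is enough, since the power is then at most (n pi/2)^n. Beyond
  that point the weighted energy bound takes over.\<close>

lemma energy_decay:
  assumes "0 < x" "x \<le> pi / 2"
  shows "energy x * (real l * x) ^ n \<le> decay * lam"
proof (cases "real l * x \<le> real n")
  case True
  have "real n * 1 \<le> real n * (pi / 2)" using pi_gt3 by (intro mult_left_mono) auto
  hence "(real l * x) ^ n \<le> (real n * pi / 2) ^ n"
    using True assms by (intro power_mono) auto
  hence "energy x * (real l * x) ^ n \<le> lam * (real n * pi / 2) ^ n"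
    using assms energy_le energy_nonneg lam_pos by (intro mult_mono) auto
  also have "\<dots> \<le> decay * lam" using lam_pos n by (simp add: decay_def)
  finally show ?thesis .
next
  case False
  hence nl: "real n / real l \<le> x" using l by (simp add: field_simps)
  have "energy x * (real l * x) ^ n \<le> energy x * (real l * (pi / 2 * sin x)) ^ n"
    using energy_nonneg jordan_sin_ge [OF assms] assms by (intro mult_left_mono power_mono) auto
  also have "\<dots> = (real l * (pi / 2)) ^ n * (sin x ^ n * energy x)"
  proof -
    have "real l * (pi / 2 * sin x) = (real l * (pi / 2)) * sin x" by simp
    thus ?thesis by (simp only: power_mult_distrib mult_ac)
  qed
  also have "\<dots> \<le> (real l * (pi / 2)) ^ n * (9 * lam * (real n / real l) ^ n)"
    using sin_pow_energy_le [OF nl assms(2)] by (intro mult_left_mono) auto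
  also have "\<dots> = 9 * lam * (real l * (pi / 2) * (real n / real l)) ^ n"
    by (simp only: power_mult_distrib mult_ac)
  also have "real l * (pi / 2) * (real n / real l) = real n * pi / 2" using l by simp
  finally show ?thesis by (simp add: decay_def mult_ac)
qed

text \<open>The amplitude of \<open>u\<close> in the scaled variable \<open>real l * x\<close>.
  Since its derivative is a negative multiple of \<open>rate x / x\<close>, an integrand bounded by
  \<open>rate x / x\<close> has a tail of size \<open>rate a\<close>.\<close>

definition rate :: "real \<Rightarrow> real" where
  "rate x = (real l * x) powr (- (real n / 2))"

lemma rate_pos: "x > 0 \<Longrightarrow> rate x > 0"
  using l by (simp add: rate_def)

lemma rate_sq: "x > 0 \<Longrightarrow> (rate x)\<^sup>2 * (real l * x) ^ n = 1"
proof -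
  assume x: "x > 0"
  have "(rate x)\<^sup>2 = (real l * x) powr (- real n)"
    using x l by (simp add: rate_def power2_eq_square flip: powr_add)
  also have "\<dots> = inverse ((real l * x) ^ n)"
    using x l by (simp add: powr_minus powr_realpow)
  finally show ?thesis using x l by simp
qed

lemma rate_deriv:
  assumes "x > 0"
  shows "(rate has_real_derivative - (real n / 2) * (rate x / x)) (at x)"
proof -
  have "(rate has_real_derivative (- (real n / 2)) * (real l * x) powr (- (real n / 2) - 1) * real l) (at x)"
    unfolding rate_def [abs_def] using assms l
    by (auto intro!: derivative_eq_intros)
  also have "(real l * x) powr (- (real n / 2) - 1) = rate x / (real l * x)"
    using assms l by (simp add: rate_def powr_diff)
  finally show ?thesis using l by simp
qed

lemma energy_le_rate:
  assumes "0 < x" "x \<le> pi / 2"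
  shows "energy x \<le> lam * (sqrt decay * rate x)\<^sup>2"
proof -
  have p: "(real l * x) ^ n > 0" using assms l by simp
  have "energy x = energy x * (real l * x) ^ n * (rate x)\<^sup>2"
    using rate_sq [OF assms(1)] by (simp add: mult_ac)
  also have "\<dots> \<le> decay * lam * (rate x)\<^sup>2"
    using energy_decay [OF assms] by (intro mult_right_mono) auto
  also have "\<dots> = lam * (sqrt decay * rate x)\<^sup>2"
    using decay_pos by (simp add: power_mult_distrib mult_ac)
  finally show ?thesis .
qed

lemma u_le_rate:
  assumes "0 < x" "x \<le> pi / 2"
  shows "\<bar>u x\<bar> \<le> sqrt decay * rate x"
proof -
  have "lam * (u x)\<^sup>2 \<le> lam * (sqrt decay * rate x)\<^sup>2"
    using energy_le_rate [OF assms] zero_le_power2 [of "v x"] unfolding energy_def by linarith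
  hence "\<bar>u x\<bar>\<^sup>2 \<le> (sqrt decay * rate x)\<^sup>2" using lam_pos by simp
  moreover have "sqrt decay * rate x \<ge> 0" using rate_pos [OF assms(1)] decay_pos by simp
  ultimately show ?thesis by (rule power2_le_imp_le)
qed

lemma v_le_rate:
  assumes "0 < x" "x \<le> pi / 2"
  shows "\<bar>v x\<bar> \<le> sqrt lam * (sqrt decay * rate x)"
proof -
  have "(v x)\<^sup>2 \<le> lam * (sqrt decay * rate x)\<^sup>2"
    using energy_le_rate [OF assms] mult_nonneg_nonneg [OF less_imp_le [OF lam_pos] zero_le_power2 [of "u x"]]
    unfolding energy_def by linarith
  hence "\<bar>v x\<bar>\<^sup>2 \<le> (sqrt lam * (sqrt decay * rate x))\<^sup>2"
    using lam_pos by (simp add: power_mult_distrib)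
  moreover have "sqrt lam * (sqrt decay * rate x) \<ge> 0" using rate_pos [OF assms(1)] decay_pos lam_pos by simp
  ultimately show ?thesis by (rule power2_le_imp_le)
qed

text \<open>Two amplitudes exactly compensate the weight. A weighted product of m amplitudes is
  therefore as small as m - 2 of them, up to the factor \<open>1 / real l ^ n\<close>.\<close>

lemma sin_pow_le_rate:
  assumes "0 < x" "x \<le> pi / 2"
  shows "sin x ^ n * (rate x)\<^sup>2 \<le> 1 / real l ^ n"
proof -
  have "sin x ^ n \<le> x ^ n" using assms by (intro power_mono sin_x_le_x sin_ge_zero) auto
  hence "sin x ^ n * (rate x)\<^sup>2 \<le> x ^ n * (rate x)\<^sup>2" by (rule mult_right_mono) auto
  also have "\<dots> = (rate x)\<^sup>2 * (real l * x) ^ n / real l ^ n" using l by (simp add: power_mult_distrib)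
  also have "\<dots> = 1 / real l ^ n" by (simp only: rate_sq [OF assms(1)])
  finally show ?thesis .
qed

section \<open>Tail integrals of the third and fifth powers and of general nonlinearities\<close>

lemma l_pow_d: "real l * real l ^ n = real l ^ d"
  using d by (cases d) auto

lemma inverse_sqrt_lam_le: "1 / (sqrt lam * real l ^ n) \<le> 1 / real l ^ d"
  using l_le_sqrt_lam l d by (simp add: frac_le l_pow_d [symmetric])

text \<open>Taking absolute values would leave one amplitude, whose integral over the scaled
  variable is unbounded for \<open>n\<close> equal to 1 or 2. Integrating exactly yields boundary
  terms of size \<open>Q * rate a\<close>, and an error that carries an additional cotangent, hence
  at most a multiple of \<open>rate x / x\<close>.\<close>

lemma cubic_tail:
  assumes "0 < a" "a \<le> b" "b \<le> pi / 2"
  shows "\<bar>integral {a..b} (\<lambda>x. sin x ^ n * u x ^ 3)\<bar> \<le> 5 * sqrt decay ^ 3 * rate a / real l ^ d"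
proof -
  define Q where "Q = sqrt decay ^ 3 / real l ^ d"
  have Q: "Q > 0" using decay_pos l by (simp add: Q_def)
  \<comment> \<open>From \<open>(u\<^sup>2 v s)' = 2 u s E - 3 \<lambda> s u\<^sup>3\<close> and \<open>(s v E)' = - \<lambda> u s E - 2 n s cot v\<^sup>3\<close>, where \<open>E\<close> is the
    energy and \<open>s = sin^n\<close>: eliminating \<open>u s E\<close> leaves \<open>s u\<^sup>3\<close> and an integrable error.\<close>
  define W where "W = (\<lambda>x. - ((u x)\<^sup>2 * v x * sin x ^ n + 2 / lam * (sin x ^ n * v x * energy x)) / (3 * lam))"
  have Wb: "\<bar>W x\<bar> \<le> Q * rate x" if x: "0 < x" "x \<le> pi / 2" for x
  proof -
    have s: "sin x ^ n \<ge> 0" using x by (intro zero_le_power sin_ge_zero) auto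
    have ue: "(u x)\<^sup>2 \<le> energy x / lam" using lam_pos by (simp add: energy_def field_simps)
    have "\<bar>W x\<bar> = \<bar>sin x ^ n * v x * ((u x)\<^sup>2 + 2 * energy x / lam)\<bar> / (3 * lam)"
      unfolding W_def using lam_pos by (simp add: abs_mult field_simps)
    also have "\<dots> = sin x ^ n * \<bar>v x\<bar> * ((u x)\<^sup>2 + 2 * energy x / lam) / (3 * lam)"
      using s lam_pos energy_nonneg [of x] by (simp add: abs_mult)
    also have "\<dots> \<le> sin x ^ n * \<bar>v x\<bar> * (3 * (energy x / lam)) / (3 * lam)"
      using s ue lam_pos by (intro divide_right_mono mult_left_mono mult_nonneg_nonneg) auto
    also have "\<dots> \<le> sin x ^ n * (sqrt lam * (sqrt decay * rate x)) * (3 * (lam * (sqrt decay * rate x)\<^sup>2 / lam)) / (3 * lam)"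
      using s v_le_rate [OF x] energy_le_rate [OF x] lam_pos energy_nonneg [of x] decay_pos rate_pos [OF x(1)]
      by (intro divide_right_mono mult_mono mult_left_mono mult_nonneg_nonneg) auto
    also have "\<dots> = (sin x ^ n * (rate x)\<^sup>2) * (sqrt decay ^ 3 * rate x * (sqrt lam / lam))"
      using lam_pos by (simp add: power2_eq_square power3_eq_cube)
    also have "sqrt lam / lam = 1 / sqrt lam"
      using lam_pos by (simp add: field_simps)
    also have "(sin x ^ n * (rate x)\<^sup>2) * (sqrt decay ^ 3 * rate x * (1 / sqrt lam)) \<le>
       1 / real l ^ n * (sqrt decay ^ 3 * rate x * (1 / sqrt lam))"
      using sin_pow_le_rate [OF x] decay_pos rate_pos [OF x(1)] lam_pos
      by (intro mult_right_mono) auto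
    also have "\<dots> = (sqrt decay ^ 3 * rate x) * (1 / (sqrt lam * real l ^ n))"
      by simp
    also have "\<dots> \<le> (sqrt decay ^ 3 * rate x) * (1 / real l ^ d)"
      using inverse_sqrt_lam_le decay_pos rate_pos [OF x(1)] by (intro mult_left_mono) auto
    finally show ?thesis by (simp add: Q_def)
  qed
  define f where "f = (\<lambda>x. sin x ^ n * u x ^ 3 + 4 * real n / (3 * lam\<^sup>2) * (sin x ^ n * (cos x / sin x) * v x ^ 3))"
  \<comment> \<open>Differentiating \<open>rate\<close> brings out the factor -n/2, so this is a
    primitive of the error bound (4n/3) Q \<open>rate x / x\<close>. Together with the boundary term
    at \<open>a\<close> it gives 1 + 8/3 = 11/3, rounded up to 5 in the statement.\<close>
  define G where "G = (\<lambda>x. - (8 / 3) * Q * rate x)"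
  have "\<bar>integral {a..b} (\<lambda>x. sin x ^ n * u x ^ 3)\<bar> \<le> \<bar>W b - W a\<bar> + (G b - G a)"
  proof (rule abs_integral_le_FTC [OF assms(2)])
    show "continuous_on {a..b} (\<lambda>x. sin x ^ n * u x ^ 3)"
      by (intro continuous_intros u_cont)
    fix x assume "x \<in> {a..b}"
    hence x: "0 < x" "x \<le> pi / 2" using assms by auto
    have s: "sin x > 0" using x by (intro sin_gt_zero) auto
    have s': "sin x \<noteq> 0" using s by simp
    have c: "cos x \<ge> 0" using x by (intro cos_ge_zero) auto
    define ct where "ct = cos x / sin x"
    define S where "S = sin x ^ n"
    define U where "U = u x"
    define V where "V = v x"
    have "(W has_real_derivative
       - (((2 * U * V) * V + U\<^sup>2 * (- lam * U - real n * ct * V)) * S + U\<^sup>2 * V * (real n * ct * S) +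
          2 / lam * ((real n * ct * S * V + S * (- lam * U - real n * ct * V)) * energy x + S * V * (- 2 * real n * ct * V\<^sup>2))) / (3 * lam)) (at x)"
      unfolding W_def ct_def S_def U_def V_def
      apply (rule DERIV_cdivide)
      apply (rule DERIV_minus)
      apply (rule DERIV_add)
       apply (rule DERIV_cong, rule DERIV_mult, rule DERIV_mult, rule DERIV_power [OF u_deriv], rule v_deriv [OF s'],
              rule sin_pow_deriv [OF s'])
       apply (simp add: mult_ac)
      apply (rule DERIV_cmult)
      apply (rule DERIV_cong, rule DERIV_mult, rule DERIV_mult, rule sin_pow_deriv [OF s'], rule v_deriv [OF s'], rule energy_deriv [OF s'])
      apply (simp add: mult_ac)
      done
    also have "- (((2 * U * V) * V + U\<^sup>2 * (- lam * U - real n * ct * V)) * S + U\<^sup>2 * V * (real n * ct * S) +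
          2 / lam * ((real n * ct * S * V + S * (- lam * U - real n * ct * V)) * energy x + S * V * (- 2 * real n * ct * V\<^sup>2))) / (3 * lam) =
       S * U ^ 3 + 4 * real n / (3 * lam\<^sup>2) * (S * ct * V ^ 3)"
    proof -
      have en: "energy x = V\<^sup>2 + lam * U\<^sup>2" by (simp add: energy_def U_def V_def)
      have "- (((2 * U * V) * V + U\<^sup>2 * (- e * U - m * ct * V)) * S + U\<^sup>2 * V * (m * ct * S) +
          2 / e * ((m * ct * S * V + S * (- e * U - m * ct * V)) * (V\<^sup>2 + e * U\<^sup>2) + S * V * (- 2 * m * ct * V\<^sup>2))) / (3 * e) =
         S * U ^ 3 + 4 * m / (3 * e\<^sup>2) * (S * ct * V ^ 3)" if "e > 0" for e m :: real
        using that by (simp add: field_simps power2_eq_square power3_eq_cube)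
      thus ?thesis unfolding en using lam_pos .
    qed
    finally show "(W has_real_derivative f x) (at x)"
      by (simp add: f_def S_def U_def V_def ct_def)
    show "(G has_real_derivative 4 * real n / 3 * Q * (rate x / x)) (at x)"
      unfolding G_def by (rule DERIV_cong, rule DERIV_cmult, rule rate_deriv [OF x(1)]) simp
    have "\<bar>f x - sin x ^ n * u x ^ 3\<bar> = 4 * real n / (3 * lam\<^sup>2) * (S * ct * \<bar>V\<bar> ^ 3)"
      using s c lam_pos by (simp add: f_def S_def ct_def V_def abs_mult power_abs)
    also have "\<dots> \<le> 4 * real n / (3 * lam\<^sup>2) * (S * (1 / x) * (sqrt lam * (sqrt decay * rate x)) ^ 3)"
      unfolding S_def ct_def V_def
      using s c x cot_le_inverse [OF x] v_le_rate [OF x]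
      by (intro mult_left_mono mult_mono power_mono mult_nonneg_nonneg divide_nonneg_nonneg) auto
    also have "\<dots> = 4 * real n / 3 * ((S * (rate x)\<^sup>2) * (sqrt decay ^ 3 * (rate x / x) * (sqrt lam ^ 3 / lam\<^sup>2)))"
    proof -
      have "4 * m / (3 * e\<^sup>2) * (S * (1 / x) * (q * (D * r)) ^ 3) = 4 * m / 3 * ((S * r\<^sup>2) * (D ^ 3 * (r / x) * (q ^ 3 / e\<^sup>2)))"
        for m e q D r :: real
        by (simp add: power_mult_distrib power2_eq_square power3_eq_cube mult_ac)
      thus ?thesis .
    qed
    also have "sqrt lam ^ 3 / lam\<^sup>2 = 1 / sqrt lam"
    proof -
      have "lam\<^sup>2 = sqrt lam ^ 4" using lam_pos by (simp add: power4_eq_xxxx power2_eq_square)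
      thus ?thesis using lam_pos by (simp add: power4_eq_xxxx power3_eq_cube)
    qed
    also have "4 * real n / 3 * ((S * (rate x)\<^sup>2) * (sqrt decay ^ 3 * (rate x / x) * (1 / sqrt lam))) \<le>
        4 * real n / 3 * (1 / real l ^ n * (sqrt decay ^ 3 * (rate x / x) * (1 / sqrt lam)))"
      unfolding S_def using sin_pow_le_rate [OF x] decay_pos rate_pos [OF x(1)] lam_pos x
      by (intro mult_left_mono mult_right_mono) auto
    also have "\<dots> = 4 * real n / 3 * ((sqrt decay ^ 3 * (rate x / x)) * (1 / (sqrt lam * real l ^ n)))"
      by simp
    also have "\<dots> \<le> 4 * real n / 3 * ((sqrt decay ^ 3 * (rate x / x)) * (1 / real l ^ d))"
      using inverse_sqrt_lam_le decay_pos rate_pos [OF x(1)] x by (intro mult_left_mono) auto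
    finally show "\<bar>f x - sin x ^ n * u x ^ 3\<bar> \<le> 4 * real n / 3 * Q * (rate x / x)"
      by (simp add: Q_def mult_ac)
  qed
  also have "\<dots> \<le> Q * rate b + Q * rate a + (G b - G a)"
    using Wb [of a] Wb [of b] assms by linarith
  also have "\<dots> = (11 / 3) * (Q * rate a) - (5 / 3) * (Q * rate b)"
    by (simp add: G_def algebra_simps)
  also have "\<dots> \<le> 5 * (Q * rate a)"
  proof -
    have "0 \<le> Q * rate a" "0 \<le> Q * rate b" using Q rate_pos [of a] rate_pos [of b] assms by auto
    thus ?thesis by linarith
  qed
  finally show ?thesis by (simp add: Q_def mult_ac)
qed

text \<open>The weight cancels two of the five amplitudes. Since \<open>real l * x \<ge> 1\<close>
  and \<open>n \<ge> 1\<close>, two of the remaining three are together at most 1/(l x), which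
  leaves a multiple of \<open>rate x / x\<close>.\<close>

lemma quintic_tail:
  assumes "1 / real l \<le> a" "a \<le> b" "b \<le> pi / 2"
  shows "integral {a..b} (\<lambda>x. sin x ^ n * \<bar>u x\<bar> ^ 5) \<le> 2 * sqrt decay ^ 5 * rate a / real l ^ d"
proof -
  have a: "a > 0" using assms(1) l by (meson divide_pos_pos less_le_trans of_nat_0_less_iff zero_less_one less_eq_Suc_le One_nat_def)
  define Q where "Q = sqrt decay ^ 5 / real l ^ d"
  have Q: "Q > 0" using decay_pos l by (simp add: Q_def)
  define G where "G = (\<lambda>x. - (2 / real n) * Q * rate x)"
  have "\<bar>integral {a..b} (\<lambda>x. sin x ^ n * \<bar>u x\<bar> ^ 5)\<bar> \<le> \<bar>0 - 0\<bar> + (G b - G a)"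
  proof (rule abs_integral_le_FTC [OF assms(2)])
    show "continuous_on {a..b} (\<lambda>x. sin x ^ n * \<bar>u x\<bar> ^ 5)"
      by (intro continuous_intros u_cont)
    fix x assume "x \<in> {a..b}"
    hence x: "0 < x" "x \<le> pi / 2" "1 / real l \<le> x" using assms a by auto
    have s: "sin x > 0" using x by (intro sin_gt_zero) auto
    show "((\<lambda>_. 0) has_real_derivative 0) (at x)" by simp
    show "(G has_real_derivative Q * (rate x / x)) (at x)"
      unfolding G_def by (rule DERIV_cong, rule DERIV_cmult, rule rate_deriv [OF x(1)]) (use n in simp)
    have r: "(rate x)\<^sup>2 \<le> 1 / (real l * x)"
    proof -
      have lx: "real l * x \<ge> 1" using x(3) l by (simp add: field_simps)
      hence "real l * x \<le> (real l * x) ^ n" using n(1) by (metis power_increasing power_one_right)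
      hence "(rate x)\<^sup>2 * (real l * x) \<le> (rate x)\<^sup>2 * (real l * x) ^ n" by (intro mult_left_mono) auto
      also have "\<dots> = 1" by (rule rate_sq [OF x(1)])
      finally show ?thesis using lx by (simp add: field_simps)
    qed
    have "\<bar>0 - sin x ^ n * \<bar>u x\<bar> ^ 5\<bar> = sin x ^ n * \<bar>u x\<bar> ^ 5"
      using s by simp
    also have "\<dots> \<le> sin x ^ n * (sqrt decay * rate x) ^ 5"
      using s u_le_rate [OF x(1,2)] by (intro mult_left_mono power_mono) auto
    also have "\<dots> = (sin x ^ n * (rate x)\<^sup>2) * ((rate x)\<^sup>2 * (sqrt decay ^ 5 * rate x))"
      by (simp add: power_mult_distrib power2_eq_square eval_nat_numeral)
    also have "\<dots> \<le> (1 / real l ^ n) * (1 / (real l * x) * (sqrt decay ^ 5 * rate x))"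
      using sin_pow_le_rate [OF x(1,2)] r rate_pos [OF x(1)] decay_pos l x
      by (intro mult_mono mult_nonneg_nonneg) auto
    also have "\<dots> = Q * (rate x / x)"
      by (simp add: Q_def l_pow_d [symmetric])
    finally show "\<bar>0 - sin x ^ n * \<bar>u x\<bar> ^ 5\<bar> \<le> Q * (rate x / x)" .
  qed
  also have "\<dots> = 2 / real n * (Q * rate a) - 2 / real n * (Q * rate b)"
    by (simp add: G_def algebra_simps)
  also have "\<dots> \<le> 2 / real n * (Q * rate a)"
    using Q rate_pos [of b] a assms by simp
  also have "\<dots> \<le> 2 * (Q * rate a)"
  proof -
    have "2 / real n \<le> 2" using n by (simp add: field_simps)
    thus ?thesis using Q rate_pos [OF a] by (intro mult_right_mono) auto
  qed
  finally show ?thesis by (simp add: Q_def mult_ac)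
qed

text \<open>Stated for any nonlinearity that is cubic up to fifth order, so that it serves
  \<open>arcsin x - x\<close> and, with \<open>c = 0\<close>, also the fifth power of the absolute
  value and the high odd powers.\<close>

lemma tail_bound:
  assumes H: "continuous_on {-1..1} H" "\<And>x. \<bar>x\<bar> \<le> 1 \<Longrightarrow> \<bar>H x - c * x ^ 3\<bar> \<le> B * \<bar>x\<bar> ^ 5" "B \<ge> 0"
    and ab: "1 / real l \<le> a" "a \<le> b" "b \<le> pi / 2"
  shows "\<bar>integral {a..b} (\<lambda>x. sin x ^ n * H (u x))\<bar> \<le>
    (\<bar>c\<bar> * (5 * sqrt decay ^ 3) + B * (2 * sqrt decay ^ 5)) * rate a / real l ^ d"
proof -
  have a: "a > 0" using ab(1) l by (meson divide_pos_pos less_le_trans of_nat_0_less_iff zero_less_one less_eq_Suc_le One_nat_def)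
  have rng: "u x \<in> {-1..1}" if "x \<in> {a..b}" for x
    using abs_u_le_1 [of x] that a ab by auto
  have cH: "continuous_on {a..b} (\<lambda>x. sin x ^ n * H (u x))"
    by (intro continuous_intros continuous_on_compose2 [OF H(1)] u_cont) (use rng in auto)
  have c3: "continuous_on {a..b} (\<lambda>x. c * (sin x ^ n * u x ^ 3))" by (intro continuous_intros u_cont)
  have c5: "continuous_on {a..b} (\<lambda>x. B * (sin x ^ n * \<bar>u x\<bar> ^ 5))" by (intro continuous_intros u_cont)
  have "norm (integral {a..b} (\<lambda>x. sin x ^ n * H (u x) - c * (sin x ^ n * u x ^ 3))) \<le>
     integral {a..b} (\<lambda>x. B * (sin x ^ n * \<bar>u x\<bar> ^ 5))"
  proof (rule integral_norm_bound_integral)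
    fix x assume x: "x \<in> {a..b}"
    hence s: "sin x ^ n \<ge> 0" using a ab by (intro zero_le_power sin_ge_zero) auto
    have "norm (sin x ^ n * H (u x) - c * (sin x ^ n * u x ^ 3)) = sin x ^ n * \<bar>H (u x) - c * u x ^ 3\<bar>"
    proof -
      have "norm (S * h - c * (S * k)) = S * \<bar>h - c * k\<bar>" if "S \<ge> 0" for S h k :: real
      proof -
        have "S * h - c * (S * k) = S * (h - c * k)" by (simp add: algebra_simps)
        thus ?thesis using that by (simp add: abs_mult)
      qed
      thus ?thesis using s .
    qed
    also have "\<dots> \<le> sin x ^ n * (B * \<bar>u x\<bar> ^ 5)"
      using s rng [OF x] by (intro mult_left_mono H(2)) auto
    finally show "norm (sin x ^ n * H (u x) - c * (sin x ^ n * u x ^ 3)) \<le> B * (sin x ^ n * \<bar>u x\<bar> ^ 5)"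
      by (simp add: mult_ac)
  qed (use cH c3 c5 in \<open>auto intro!: integrable_continuous_real continuous_on_diff\<close>)
  also have "\<dots> = B * integral {a..b} (\<lambda>x. sin x ^ n * \<bar>u x\<bar> ^ 5)" by simp
  also have "\<dots> \<le> B * (2 * sqrt decay ^ 5 * rate a / real l ^ d)"
    using H(3) quintic_tail [OF ab] by (intro mult_left_mono)
  finally have 1: "\<bar>integral {a..b} (\<lambda>x. sin x ^ n * H (u x)) - integral {a..b} (\<lambda>x. c * (sin x ^ n * u x ^ 3))\<bar> \<le>
     B * (2 * sqrt decay ^ 5 * rate a / real l ^ d)"
    using cH c3 by (subst (asm) integral_diff) (auto intro: integrable_continuous_real)
  have "\<bar>integral {a..b} (\<lambda>x. c * (sin x ^ n * u x ^ 3))\<bar> = \<bar>c\<bar> * \<bar>integral {a..b} (\<lambda>x. sin x ^ n * u x ^ 3)\<bar>"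
    by (simp add: abs_mult)
  also have "\<dots> \<le> \<bar>c\<bar> * (5 * sqrt decay ^ 3 * rate a / real l ^ d)"
    using cubic_tail [OF a ab(2,3)] by (intro mult_left_mono) auto
  finally have "\<bar>integral {a..b} (\<lambda>x. sin x ^ n * H (u x))\<bar> \<le>
     \<bar>c\<bar> * (5 * sqrt decay ^ 3 * rate a / real l ^ d) + B * (2 * sqrt decay ^ 5 * rate a / real l ^ d)"
    using 1 by linarith
  also have "\<dots> = (\<bar>c\<bar> * (5 * sqrt decay ^ 3) + B * (2 * sqrt decay ^ 5)) * rate a / real l ^ d"
    by (simp add: add_divide_distrib algebra_simps)
  finally show ?thesis .
qed

end

section \<open>The scaling limit\<close>

definition bessel_lim :: "nat \<Rightarrow> real \<Rightarrow> real" where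
  "bessel_lim d x = bessel_series d (x\<^sup>2 / 4)"

lemma bessel_lim_tendsto:
  "d \<ge> 2 \<Longrightarrow> (\<lambda>l. zonal d l (x / real l)) \<longlonglongrightarrow> bessel_lim d x"
  unfolding bessel_lim_def by (rule mehler_heine)

lemma isCont_bessel_series:
  assumes "d \<ge> 2"
  shows "isCont (bessel_series d) y"
  unfolding bessel_series_def [abs_def]
  by (rule isCont_powser_converges_everywhere [OF summable_bessel_series [OF assms]])

lemma bessel_lim_cont:
  assumes "d \<ge> 2"
  shows "continuous_on A (bessel_lim d)"
  unfolding bessel_lim_def [abs_def]
  by (intro continuous_at_imp_continuous_on ballI isCont_o2 [OF _ isCont_bessel_series [OF assms]]
      continuous_intros) auto

lemma bessel_series_0 [simp]: "bessel_series d 0 = 1"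
proof -
  have "(\<Sum>k. (- 1) ^ k / (fact k * pochhammer (real d / 2) k) * (0::real) ^ k) =
    (- 1) ^ 0 / (fact 0 * pochhammer (real d / 2) 0)"
    by (rule powser_zero)
  thus ?thesis by (simp add: bessel_series_def)
qed

lemma bessel_lim_0 [simp]: "bessel_lim d 0 = 1"
  by (simp add: bessel_lim_def)

text \<open>The linear coefficient of the series in y = x^2/4 is -2/d. Once the constant 1 is split
  off, the cofactor of y is continuous and negative at 0.\<close>

lemma bessel_lim_less_1:
  assumes "d \<ge> 2"
  shows "eventually (\<lambda>x. bessel_lim d x < 1) (at_right 0)"
proof -
  define c where "c k = (- 1) ^ k / (fact k * pochhammer (real d / 2) k)" for k
  have sm: "summable (\<lambda>k. c k * y ^ k)" for y
    unfolding c_def by (rule summable_bessel_series [OF assms])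
  define r where "r y = (\<Sum>k. c (Suc k) * y ^ k)" for y
  have B: "bessel_series d y = 1 + r y * y" for y
    using powser_split_head(1) [OF sm [of y]] by (simp add: bessel_series_def c_def [symmetric] r_def) (simp add: c_def)
  have "isCont r 0"
    unfolding r_def [abs_def]
    by (rule isCont_powser_converges_everywhere) (use sm summable_powser_split_head in blast)
  moreover have "r 0 < 0"
  proof -
    have "r 0 = c 1" unfolding r_def using powser_zero [of "\<lambda>k. c (Suc k)"] by simp
    thus ?thesis using assms by (simp add: c_def)
  qed
  ultimately have "eventually (\<lambda>y. r y < 0) (at 0)"
    unfolding isCont_def by (intro order_tendstoD(2))
  moreover have "filterlim (\<lambda>x::real. x\<^sup>2 / 4) (at 0) (at_right 0)"
    by real_asymp
  ultimately have "eventually (\<lambda>x::real. r (x\<^sup>2 / 4) < 0) (at_right 0)"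
    by (rule eventually_compose_filterlim)
  thus ?thesis using eventually_at_right_less [of 0]
  proof eventually_elim
    case (elim x)
    hence "r (x\<^sup>2 / 4) * (x\<^sup>2 / 4) < 0" by (intro mult_neg_pos) auto
    thus ?case by (simp add: bessel_lim_def B)
  qed
qed

lemma eventually_scaled_le:
  "eventually (\<lambda>l. x / real l \<le> pi / 2 \<and> l \<ge> 1) sequentially"
proof -
  have "(\<lambda>l. x / real l) \<longlonglongrightarrow> 0" by real_asymp
  hence "eventually (\<lambda>l. x / real l < pi / 2) sequentially"
    by (rule order_tendstoD) simp
  thus ?thesis using eventually_ge_at_top [of 1] by eventually_elim auto
qed

lemma abs_bessel_lim_le_1:
  assumes "d \<ge> 2" "x \<ge> 0"
  shows "\<bar>bessel_lim d x\<bar> \<le> 1"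
proof (rule tendsto_upperbound)
  show "(\<lambda>l. \<bar>zonal d l (x / real l)\<bar>) \<longlonglongrightarrow> \<bar>bessel_lim d x\<bar>"
    by (intro tendsto_rabs bessel_lim_tendsto assms)
  show "\<forall>\<^sub>F l in sequentially. \<bar>zonal d l (x / real l)\<bar> \<le> 1"
    using eventually_scaled_le [of x]
  proof eventually_elim
    case (elim l)
    interpret zonal_fun d l using elim assms by unfold_locales auto
    show ?case using elim assms by (intro abs_u_le_1) auto
  qed
qed auto

text \<open>The limit of \<open>energy_gap\<close> at the angles \<open>a / real l\<close> and
  \<open>x / real l\<close>: after division by the eigenvalue, the factor cot(a/l)/(a/l) tends to
  1/a^2.\<close>

lemma bessel_lim_gap:
  assumes "d \<ge> 2" "0 < a" "a \<le> x"
  shows "(bessel_lim d x)\<^sup>2 \<le> 1 - 2 * (real d - 1) / a\<^sup>2 * (1 - bessel_lim d a)\<^sup>2"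
proof (rule tendsto_le)
  define c where "c l = cos (a / real l) / (sin (a / real l) * (a / real l) * (real l * (real l + real d - 1)))" for l
  have "(\<lambda>l. c l) \<longlonglongrightarrow> 1 / a\<^sup>2"
    unfolding c_def using assms(2) by (real_asymp simp: power2_eq_square divide_inverse)
  thus "(\<lambda>l. 1 - 2 * (real d - 1) * c l * (1 - zonal d l (a / real l))\<^sup>2) \<longlonglongrightarrow>
     1 - 2 * (real d - 1) / a\<^sup>2 * (1 - bessel_lim d a)\<^sup>2"
    by (auto intro!: tendsto_eq_intros bessel_lim_tendsto assms)
  show "(\<lambda>l. (zonal d l (x / real l))\<^sup>2) \<longlonglongrightarrow> (bessel_lim d x)\<^sup>2"
    by (intro tendsto_power bessel_lim_tendsto assms)
  show "\<forall>\<^sub>F l in sequentially. (zonal d l (x / real l))\<^sup>2 \<le> 1 - 2 * (real d - 1) * c l * (1 - zonal d l (a / real l))\<^sup>2"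
    using eventually_scaled_le [of x]
  proof eventually_elim
    case (elim l)
    interpret zonal_fun d l using elim assms by unfold_locales auto
    have "lam * (u (x / real l))\<^sup>2 \<le> lam - 2 * real n * (cos (a / real l) / sin (a / real l)) / (a / real l) * (1 - u (a / real l))\<^sup>2"
      using elim assms by (intro energy_gap divide_right_mono) auto
    also have "\<dots> = lam * (1 - 2 * real n * c l * (1 - u (a / real l))\<^sup>2)"
    proof -
      have c: "c l = cos (a / real l) / (sin (a / real l) * (a / real l) * lam)"
        by (simp only: c_def zonal_ev_def)
      have "e - 2 * m * (C / S) / x * k = e * (1 - 2 * m * (C / (S * x * e)) * k)" if "e > 0" for e m C S x k :: real
        using that by (simp add: right_diff_distrib)
      thus ?thesis unfolding c using lam_pos .
    qed
    finally show ?case using lam_pos n(2) by (simp only: mult_le_cancel_left_pos)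
  qed
qed auto

section \<open>Convergence of the rescaled integrals, on bounded intervals and globally\<close>

lemma integral_scaled:
  fixes f :: "real \<Rightarrow> real"
  assumes "c > 0"
  shows "integral {0..A} (\<lambda>x. f (x / c)) = c * integral {0..A / c} f"
proof -
  have "(\<lambda>x. x / (1 / c)) ` {0..A / c} = {0..A}"
    using assms by (subst image_divide_atLeastAtMost) (auto)
  moreover have "integral ((\<lambda>x. x / (1 / c)) ` {0..A / c}) (\<lambda>x. f (1 / c * x)) = (1 / \<bar>1 / c\<bar>) *\<^sub>R integral {0..A / c} f"
    using assms by (intro integral_stretch_real) auto
  ultimately show ?thesis using assms by simp
qed

lemma scaled_integral_tendsto:
  assumes d: "d \<ge> 2" and H: "continuous_on {-1..1} (H :: real \<Rightarrow> real)" and A: "A \<ge> 0"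
  shows "(\<lambda>x. x ^ (d - 1) * H (bessel_lim d x)) integrable_on {0..A}"
    and "(\<lambda>l. real l ^ d * integral {0..A / real l} (\<lambda>x. sin x ^ (d - 1) * H (zonal d l x))) \<longlonglongrightarrow>
       integral {0..A} (\<lambda>x. x ^ (d - 1) * H (bessel_lim d x))"
proof -
  have rng: "bessel_lim d x \<in> {-1..1}" if "x \<in> {0..A}" for x
    using abs_bessel_lim_le_1 [OF d, of x] that by auto
  show "(\<lambda>x. x ^ (d - 1) * H (bessel_lim d x)) integrable_on {0..A}"
    by (intro integrable_continuous_real continuous_intros continuous_on_compose2 [OF H bessel_lim_cont [OF d]])
       (use rng in auto)
  \<comment> \<open>For smaller \<open>l\<close> the interval up to \<open>A / real l\<close> may
    leave the range on which \<open>u\<close> is known to be bounded by 1, and \<open>l = 0\<close>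
    has to be avoided. The sequence is shifted by \<open>N\<close>, which does not affect its
    limit.\<close>
  obtain N where N: "\<And>l. l \<ge> N \<Longrightarrow> A / real l \<le> pi / 2 \<and> l \<ge> 1"
    using eventually_scaled_le [of A] unfolding eventually_sequentially by blast
  obtain B where B: "\<And>y. y \<in> {-1..1} \<Longrightarrow> \<bar>H y\<bar> \<le> B"
    using compact_imp_bounded [OF compact_continuous_image [OF H compact_Icc]] unfolding bounded_iff
    by (metis imageI real_norm_def)
  \<comment> \<open>The factor \<open>real l ^ d\<close> is used up completely: one power by the
    change of variables and \<open>d - 1\<close> powers by the sines.\<close>
  define g where "g l x = (real l * sin (x / real l)) ^ (d - 1) * H (zonal d l (x / real l))" for l x
  have zr: "zonal d (l + N) (x / real (l + N)) \<in> {-1..1}" if "x \<in> {0..A}" for l x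
  proof -
    interpret zonal_fun d "l + N" using N [of "l + N"] d by unfold_locales auto
    have "x / real (l + N) \<le> A / real (l + N)" using that by (intro divide_right_mono) auto
    also have "\<dots> \<le> pi / 2" using N [of "l + N"] by auto
    finally have "\<bar>u (x / real (l + N))\<bar> \<le> 1" using that by (intro abs_u_le_1) auto
    thus ?thesis by auto
  qed
  have "(\<lambda>k. integral {0..A} (g (k + N))) \<longlonglongrightarrow> integral {0..A} (\<lambda>x. x ^ (d - 1) * H (bessel_lim d x))"
  proof (rule dominated_convergence(2))
    show "(\<lambda>_. A ^ (d - 1) * B) integrable_on {0..A}" by (rule integrable_const_ivl)
    fix k
    show "g (k + N) integrable_on {0..A}"
    proof (rule integrable_continuous_real)
      have "continuous_on UNIV (zonal d (k + N))"
        using zonal_deriv [of d "k + N"] d by (meson DERIV_isCont continuous_at_imp_continuous_on le_trans one_le_numeral)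
      hence "continuous_on {0..A} (\<lambda>x. zonal d (k + N) (x / real (k + N)))"
        by (rule continuous_on_compose2) (use N [of "k + N"] in \<open>auto intro!: continuous_intros\<close>)
      thus "continuous_on {0..A} (g (k + N))" unfolding g_def
        by (intro continuous_intros continuous_on_compose2 [OF H]) (use zr N [of "k + N"] in auto)
    qed
    fix x assume x: "x \<in> {0..A}"
    have Nk: "real (k + N) > 0" using N [of "k + N"] by auto
    have "\<bar>real (k + N) * sin (x / real (k + N))\<bar> \<le> real (k + N) * \<bar>x / real (k + N)\<bar>"
      unfolding abs_mult abs_of_nat by (intro mult_left_mono abs_sin_x_le_abs_x) auto
    also have "\<dots> \<le> A" using Nk x by simp
    finally have "\<bar>real (k + N) * sin (x / real (k + N))\<bar> ^ (d - 1) \<le> A ^ (d - 1)"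
      by (intro power_mono) auto
    hence "\<bar>real (k + N) * sin (x / real (k + N))\<bar> ^ (d - 1) * \<bar>H (zonal d (k + N) (x / real (k + N)))\<bar> \<le> A ^ (d - 1) * B"
      using B [OF zr [OF x, of k]] A by (intro mult_mono) auto
    thus "norm (g (k + N) x) \<le> A ^ (d - 1) * B"
      by (simp only: g_def real_norm_def abs_mult power_abs)
  next
    fix x assume x: "x \<in> {0..A}"
    have 1: "(\<lambda>l. real l * sin (x / real l)) \<longlonglongrightarrow> x"
    proof (cases "x = 0")
      case False
      with x have "x > 0" by auto
      thus ?thesis by real_asymp
    qed auto
    have 2: "(\<lambda>k. H (zonal d (k + N) (x / real (k + N)))) \<longlonglongrightarrow> H (bessel_lim d x)"
      by (rule continuous_on_tendsto_compose [OF H])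
         (use LIMSEQ_ignore_initial_segment [OF bessel_lim_tendsto [OF d, of x], of N] zr [OF x] rng [OF x] in auto)
    show "(\<lambda>k. g (k + N) x) \<longlonglongrightarrow> x ^ (d - 1) * H (bessel_lim d x)"
      unfolding g_def by (intro tendsto_mult tendsto_power 2 LIMSEQ_ignore_initial_segment [OF 1])
  qed
  hence "(\<lambda>l. integral {0..A} (g l)) \<longlonglongrightarrow> integral {0..A} (\<lambda>x. x ^ (d - 1) * H (bessel_lim d x))"
    by (rule LIMSEQ_offset)
  moreover have "eventually (\<lambda>l. integral {0..A} (g l) = real l ^ d * integral {0..A / real l} (\<lambda>x. sin x ^ (d - 1) * H (zonal d l x))) sequentially"
    using eventually_ge_at_top [of 1]
  proof eventually_elim
    case (elim l)
    have "integral {0..A} (g l) = real l * integral {0..A / real l} (\<lambda>x. (real l * sin x) ^ (d - 1) * H (zonal d l x))"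
      unfolding g_def by (rule integral_scaled) (use elim in auto)
    also have "(\<lambda>x. (real l * sin x) ^ (d - 1) * H (zonal d l x)) =
       (\<lambda>x. real l ^ (d - 1) * (sin x ^ (d - 1) * H (zonal d l x)))"
      by (simp add: power_mult_distrib mult_ac fun_eq_iff)
    finally show ?case using d by (cases d) auto
  qed
  ultimately show "(\<lambda>l. real l ^ d * integral {0..A / real l} (\<lambda>x. sin x ^ (d - 1) * H (zonal d l x))) \<longlonglongrightarrow>
       integral {0..A} (\<lambda>x. x ^ (d - 1) * H (bessel_lim d x))"
    by (rule Lim_transform_eventually)
qed

text \<open>The Cauchy criterion with an explicit modulus: letting \<open>b\<close> tend to infinity
  in the tail bound keeps the same \<open>r a\<close> as a bound for the distance to the
  limit.\<close>

lemma tendsto_at_top_of_tail: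
  fixes F :: "real \<Rightarrow> real"
  assumes tail: "\<And>a b. 1 \<le> a \<Longrightarrow> a \<le> b \<Longrightarrow> \<bar>F b - F a\<bar> \<le> r a" and r: "(r \<longlongrightarrow> 0) at_top"
  obtains J where "(F \<longlongrightarrow> J) at_top" "\<And>a. 1 \<le> a \<Longrightarrow> \<bar>F a - J\<bar> \<le> r a"
proof -
  have rk: "(\<lambda>k. r (real k)) \<longlonglongrightarrow> 0"
    by (rule filterlim_compose [OF r filterlim_real_sequentially])
  have "Cauchy (\<lambda>k. F (real k))"
  proof (rule metric_CauchyI)
    fix e :: real assume "e > 0"
    hence "eventually (\<lambda>k. r (real k) < e / 2) sequentially"
      by (intro order_tendstoD(2) [OF rk]) auto
    then obtain N where N: "\<And>k. k \<ge> N \<Longrightarrow> r (real k) < e / 2"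
      unfolding eventually_sequentially by blast
    define K where "K = max N 1"
    have K: "\<bar>F (real k) - F (real K)\<bar> < e / 2" if "k \<ge> K" for k
      using tail [of "real K" "real k"] N [of K] that by (auto simp: K_def)
    show "\<exists>M. \<forall>m\<ge>M. \<forall>n\<ge>M. dist (F (real m)) (F (real n)) < e"
    proof (intro exI [of _ K] allI impI)
      fix m n assume "K \<le> m" "K \<le> n"
      from K [OF this(1)] K [OF this(2)] show "dist (F (real m)) (F (real n)) < e"
        unfolding dist_real_def by linarith
    qed
  qed
  then obtain J where J: "(\<lambda>k. F (real k)) \<longlonglongrightarrow> J"
    using Cauchy_convergent convergent_def by blast
  have b: "\<bar>F a - J\<bar> \<le> r a" if "1 \<le> a" for a
  proof (rule tendsto_upperbound)
    show "(\<lambda>k. \<bar>F a - F (real k)\<bar>) \<longlonglongrightarrow> \<bar>F a - J\<bar>"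
      by (intro tendsto_intros J)
    show "\<forall>\<^sub>F k in sequentially. \<bar>F a - F (real k)\<bar> \<le> r a"
      using eventually_ge_at_top [of "nat \<lceil>a\<rceil>"]
    proof eventually_elim
      case (elim k)
      hence "a \<le> real k" by linarith
      from tail [OF that this] show ?case by (simp add: abs_minus_commute)
    qed
  qed auto
  have "((\<lambda>a. F a - J) \<longlongrightarrow> 0) at_top"
  proof (rule Lim_null_comparison [OF _ r])
    show "\<forall>\<^sub>F a in at_top. norm (F a - J) \<le> r a"
      using eventually_ge_at_top [of 1] by eventually_elim (use b in auto)
  qed
  hence "(F \<longlongrightarrow> J) at_top" by (rule LIM_zero_cancel)
  with b show ?thesis using that by blast
qed

text \<open>A Moore-Osgood argument. The same \<open>r a\<close> bounds the tails of
  \<open>Fl l\<close> for every degree and, after letting \<open>l\<close> tend to infinity between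
  fixed end-points, those of \<open>F\<close>. Hence both limits exist and are one number.\<close>

theorem scaling_limit:
  assumes d: "d \<ge> 2" and H: "continuous_on {-1..1} H" "\<And>x. \<bar>x\<bar> \<le> 1 \<Longrightarrow> \<bar>H x - c * x ^ 3\<bar> \<le> B * \<bar>x\<bar> ^ 5" "B \<ge> 0"
  obtains J where
    "((\<lambda>A. integral {0..A} (\<lambda>x. x ^ (d - 1) * H (bessel_lim d x))) \<longlongrightarrow> J) at_top"
    "(\<lambda>l. real l ^ d * integral {0..pi / 2} (\<lambda>x. sin x ^ (d - 1) * H (zonal d l x))) \<longlonglongrightarrow> J"
proof -
  \<comment> \<open>Outside the locale the constant keeps \<open>d\<close> as its only argument, so
    neither \<open>C\<close> nor \<open>r\<close> depends on \<open>l\<close>.\<close>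
  define D where "D = zonal_fun.decay d"
  define C where "C = \<bar>c\<bar> * (5 * sqrt D ^ 3) + B * (2 * sqrt D ^ 5)"
  define r where "r a = C * a powr (- (real (d - 1) / 2))" for a
  define Fl where "Fl l A = real l ^ d * integral {0..A / real l} (\<lambda>x. sin x ^ (d - 1) * H (zonal d l x))" for l A
  define F where "F A = integral {0..A} (\<lambda>x. x ^ (d - 1) * H (bessel_lim d x))" for A
  have lim: "(\<lambda>l. Fl l A) \<longlonglongrightarrow> F A" if "A \<ge> 0" for A
    unfolding Fl_def F_def by (rule scaled_integral_tendsto(2) [OF d H(1) that])
  have tl: "\<bar>Fl l b - Fl l a\<bar> \<le> r a" if "1 \<le> a" "a \<le> b" "l \<ge> 1" "b / real l \<le> pi / 2" for a b l
  proof -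
    interpret zonal_fun d l using that d by unfold_locales auto
    let ?g = "\<lambda>x. sin x ^ (d - 1) * H (u x)"
    have "continuous_on {0..b / real l} ?g"
    proof (intro continuous_intros continuous_on_compose2 [OF H(1)] u_cont)
      have "u x \<in> {-1..1}" if "x \<in> {0..b / real l}" for x
      proof -
        have "x \<le> pi / 2" using that \<open>b / real l \<le> pi / 2\<close> unfolding atLeastAtMost_iff by linarith
        thus ?thesis using abs_u_le_1 [of x] that by auto
      qed
      thus "u ` {0..b / real l} \<subseteq> {- 1..1}" by auto
    qed
    hence "?g integrable_on {0..b / real l}" by (rule integrable_continuous_real)
    hence "integral {0..a / real l} ?g + integral {a / real l..b / real l} ?g = integral {0..b / real l} ?g"
      using that by (intro Henstock_Kurzweil_Integration.integral_combine) (auto simp: divide_right_mono)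
    hence "Fl l b - Fl l a = real l ^ d * integral {a / real l..b / real l} ?g"
      unfolding Fl_def by (simp flip: right_diff_distrib)
    hence "\<bar>Fl l b - Fl l a\<bar> = real l ^ d * \<bar>integral {a / real l..b / real l} ?g\<bar>"
      by (simp add: abs_mult)
    also have "\<dots> \<le> real l ^ d * (C * rate (a / real l) / real l ^ d)"
    proof (rule mult_left_mono)
      show "\<bar>integral {a / real l..b / real l} ?g\<bar> \<le> C * rate (a / real l) / real l ^ d"
        unfolding C_def D_def using that by (intro tail_bound H divide_right_mono) auto
    qed auto
    \<comment> \<open>At \<open>a / real l\<close> the degree cancels inside \<open>rate\<close>,
      leaving a power of \<open>a\<close> alone.\<close>
    also have "\<dots> = r a" using that(3) by (simp add: r_def rate_def)
    finally show ?thesis .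
  qed
  have tF: "\<bar>F b - F a\<bar> \<le> r a" if ab: "1 \<le> a" "a \<le> b" for a b
  proof (rule tendsto_upperbound)
    show "(\<lambda>l. \<bar>Fl l b - Fl l a\<bar>) \<longlonglongrightarrow> \<bar>F b - F a\<bar>"
      using ab by (intro tendsto_intros lim) auto
    show "\<forall>\<^sub>F l in sequentially. \<bar>Fl l b - Fl l a\<bar> \<le> r a"
      using eventually_scaled_le [of b] by eventually_elim (use ab tl in auto)
  qed auto
  have r: "(r \<longlongrightarrow> 0) at_top"
  proof -
    have "((\<lambda>a::real. C * a powr (- (real (d - 1) / 2))) \<longlongrightarrow> C * 0) at_top"
      by (intro tendsto_mult tendsto_const tendsto_neg_powr filterlim_ident) (use d in auto)
    thus ?thesis by (simp add: r_def [abs_def])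
  qed
  obtain J where J: "(F \<longlongrightarrow> J) at_top" "\<And>a. 1 \<le> a \<Longrightarrow> \<bar>F a - J\<bar> \<le> r a"
    using tendsto_at_top_of_tail [OF tF r] by blast
  define X where "X l = real l ^ d * integral {0..pi / 2} (\<lambda>x. sin x ^ (d - 1) * H (zonal d l x))" for l
  have "X \<longlonglongrightarrow> J"
  proof (rule LIMSEQ_I)
    fix e :: real assume e: "e > 0"
    have "eventually (\<lambda>a. r a < e / 3 \<and> a \<ge> 1) at_top"
      using order_tendstoD(2) [OF r, of "e / 3"] eventually_ge_at_top [of 1] e by (intro eventually_conj) auto
    then obtain a where a: "r a < e / 3" "a \<ge> 1"
      using eventually_happens' [of "at_top :: real filter"] by auto
    have "eventually (\<lambda>l. \<bar>Fl l a - F a\<bar> < e / 3) sequentially"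
      using tendstoD [OF lim [of a], of "e / 3"] a e by (simp add: dist_real_def)
    hence "eventually (\<lambda>l. norm (X l - J) < e) sequentially"
      using eventually_scaled_le [of a]
    proof eventually_elim
      case (elim l)
      hence "a / real l * real l \<le> pi / 2 * real l" by (intro mult_right_mono) auto
      hence al: "a \<le> real l * (pi / 2)" using elim by (simp add: mult.commute)
      \<comment> \<open>In the scaled variable the upper end-point moves with \<open>l\<close>, so
        the tail bound is needed for all upper end-points up to this one at once.\<close>
      have "X l = Fl l (real l * (pi / 2))" using elim by (simp add: X_def Fl_def)
      hence "\<bar>X l - Fl l a\<bar> \<le> r a" using tl [OF a(2) al] elim by simp
      moreover have "\<bar>Fl l a - F a\<bar> < e / 3" "\<bar>F a - J\<bar> \<le> r a" using elim J(2) [OF a(2)] by auto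
      ultimately show ?case using a(1) unfolding real_norm_def by linarith
    qed
    thus "\<exists>no. \<forall>l\<ge>no. norm (X l - J) < e" by (simp add: eventually_sequentially)
  qed
  with J show ?thesis using that unfolding F_def X_def by blast
qed

theorem bessel_lim_power_pos:
  assumes d: "d \<ge> 2"
  obtains k J where "k \<ge> 2" "J > 0"
    "(\<lambda>l. real l ^ d * integral {0..pi / 2} (\<lambda>x. sin x ^ (d - 1) * zonal d l x ^ (2 * k + 1))) \<longlonglongrightarrow> J"
proof -
  let ?b = "bessel_lim d"
  \<comment> \<open>The fifth absolute power has a finite weighted integral. It serves as the common
    majorant for all higher powers away from 0.\<close>
  obtain J5 where J5: "((\<lambda>A. integral {0..A} (\<lambda>x. x ^ (d - 1) * \<bar>?b x\<bar> ^ 5)) \<longlongrightarrow> J5) at_top"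
    by (rule scaling_limit [OF d, of "\<lambda>x. \<bar>x\<bar> ^ 5" 0 1]) (auto intro!: continuous_intros)
  have c5: "(\<lambda>x. x ^ (d - 1) * \<bar>?b x\<bar> ^ 5) integrable_on {a..b}" for a b
    by (intro integrable_continuous_real continuous_intros bessel_lim_cont d)
  have le5: "integral {a..A} (\<lambda>x. x ^ (d - 1) * \<bar>?b x\<bar> ^ 5) \<le> J5" if a: "0 \<le> a" for a A
  proof (rule tendsto_lowerbound [OF J5])
    show "\<forall>\<^sub>F A' in at_top. integral {a..A} (\<lambda>x. x ^ (d - 1) * \<bar>?b x\<bar> ^ 5) \<le> integral {0..A'} (\<lambda>x. x ^ (d - 1) * \<bar>?b x\<bar> ^ 5)"
      using eventually_ge_at_top [of A]
      by eventually_elim (rule integral_subset_le, use a c5 in auto)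
  qed auto
  have b0: "(?b \<longlongrightarrow> 1) (at_right 0)"
  proof -
    have "\<forall>x. (?b \<longlongrightarrow> ?b x) (at x)" using bessel_lim_cont [OF d, of UNIV] by (simp add: continuous_on_def)
    from this [rule_format, of 0] have "(?b \<longlongrightarrow> 1) (at 0)" by (simp only: bessel_lim_0)
    thus ?thesis using tendsto_within_subset by fastforce
  qed
  have near: "\<exists>e>0. \<forall>x. 0 \<le> x \<and> x \<le> e \<longrightarrow> q \<le> ?b x" if "q < 1" for q
  proof -
    have "eventually (\<lambda>x. q < ?b x) (at_right 0)" using b0 that by (rule order_tendstoD)
    then obtain e where e: "e > 0" "\<And>x. 0 < x \<Longrightarrow> x < e \<Longrightarrow> q < ?b x"
      by (auto simp: eventually_at_right_field)
    show ?thesis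
    proof (intro exI [of _ "e / 2"] conjI allI impI)
      fix x assume "0 \<le> x \<and> x \<le> e / 2"
      thus "q \<le> ?b x" using e(2) [of x] e(1) that by (cases "x = 0") auto
    qed (use e in auto)
  qed
  obtain e0 where e0: "e0 > 0" "\<And>x. 0 \<le> x \<Longrightarrow> x \<le> e0 \<Longrightarrow> 0 \<le> ?b x"
    using near [of 0] by auto
  have "eventually (\<lambda>x. ?b x < 1 \<and> 0 < x \<and> x < e0) (at_right 0)"
    using bessel_lim_less_1 [OF d] eventually_at_right_real [OF e0(1)] by eventually_elim auto
  then obtain p where p: "?b p < 1" "0 < p" "p < e0"
    using eventually_happens' [of "at_right 0 :: real filter"] by auto
  define g where "g = 2 * (real d - 1) / p\<^sup>2 * (1 - ?b p)\<^sup>2"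
  have g: "g > 0" using p d by (simp add: g_def)
  \<comment> \<open>The 1/4 only keeps \<open>m\<close> positive, since \<open>m\<close> is divided
    by below; any number strictly between 0 and 1 would do.\<close>
  define m where "m = sqrt (max (1 - g) (1 / 4))"
  have m: "0 < m" "m < 1" using g by (auto simp: m_def real_sqrt_lt_1_iff)
  have bm: "\<bar>?b x\<bar> \<le> m" if "x \<ge> p" for x
  proof -
    have "(?b x)\<^sup>2 \<le> max (1 - g) (1 / 4)" using bessel_lim_gap [OF d p(2) that] by (simp add: g_def)
    thus ?thesis unfolding m_def by (metis real_sqrt_abs real_sqrt_le_mono)
  qed
  \<comment> \<open>With \<open>q\<close> strictly between \<open>m\<close> and 1, a contribution of
    order \<open>q ^ M\<close> near 0 eventually beats one of order \<open>m ^ M\<close> beyond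
    \<open>p\<close>.\<close>
  define q where "q = (1 + m) / 2"
  have q: "m < q" "q < 1" "0 < q" using m by (auto simp: q_def)
  obtain e1 where e1: "e1 > 0" "\<And>x. 0 \<le> x \<Longrightarrow> x \<le> e1 \<Longrightarrow> q \<le> ?b x"
    using near [OF q(2)] by auto
  \<comment> \<open>The half-line is split into three pieces: up to \<open>z\<close> the function is
    at least \<open>q\<close>, between \<open>z\<close> and \<open>p\<close> it is nonnegative
    because \<open>p < e0\<close>, and beyond \<open>p\<close> its absolute value is at most
    \<open>m\<close>.\<close>
  define z where "z = min e1 p"
  have z: "0 < z" "z \<le> p" "\<And>x. 0 \<le> x \<Longrightarrow> x \<le> z \<Longrightarrow> q \<le> ?b x"
    using e1 p by (auto simp: z_def)
  define w where "w = z ^ d / real d"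
  have w: "w > 0" using z d by (simp add: w_def)
  have "(\<lambda>k. J5 / m ^ 5 * (m / q) ^ k) \<longlonglongrightarrow> J5 / m ^ 5 * 0"
    by (intro tendsto_mult tendsto_const LIMSEQ_realpow_zero) (use m q in auto)
  hence "eventually (\<lambda>k. J5 / m ^ 5 * (m / q) ^ k < w / 2) sequentially"
    by (intro order_tendstoD(2)) (use w in auto)
  then obtain N where N: "\<And>k. k \<ge> N \<Longrightarrow> J5 / m ^ 5 * (m / q) ^ k < w / 2"
    unfolding eventually_sequentially by blast
  \<comment> \<open>The 2 ensures that the exponent \<open>M\<close> is at least 5, so the power is
    covered by \<open>scaling_limit\<close> with no cubic term.\<close>
  define k where "k = max N 2"
  define M where "M = 2 * k + 1"
  have M: "M \<ge> N" "M \<ge> 5" "k \<ge> 2" "odd M" by (auto simp: M_def k_def)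
  have H: "\<bar>x ^ M - 0 * x ^ 3\<bar> \<le> 1 * \<bar>x\<bar> ^ 5" if "\<bar>x\<bar> \<le> 1" for x :: real
    using that M by (simp add: power_abs power_decreasing)
  obtain J where J: "((\<lambda>A. integral {0..A} (\<lambda>x. x ^ (d - 1) * ?b x ^ M)) \<longlongrightarrow> J) at_top"
    "(\<lambda>l. real l ^ d * integral {0..pi / 2} (\<lambda>x. sin x ^ (d - 1) * zonal d l x ^ M)) \<longlonglongrightarrow> J"
    by (rule scaling_limit [OF d, of "\<lambda>x. x ^ M" 0 1]) (use H in \<open>auto intro!: continuous_intros\<close>)
  have cM: "(\<lambda>x. x ^ (d - 1) * ?b x ^ M) integrable_on {a..b}" for a b
    by (intro integrable_continuous_real continuous_intros bessel_lim_cont d)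
  have low: "q ^ M * w / 2 \<le> integral {0..A} (\<lambda>x. x ^ (d - 1) * ?b x ^ M)" if A: "A \<ge> p" for A
  proof -
    have s1: "integral {0..z} (\<lambda>x. x ^ (d - 1) * ?b x ^ M) + integral {z..A} (\<lambda>x. x ^ (d - 1) * ?b x ^ M) =
        integral {0..A} (\<lambda>x. x ^ (d - 1) * ?b x ^ M)"
      using z A cM by (intro Henstock_Kurzweil_Integration.integral_combine) auto
    have s2: "integral {z..p} (\<lambda>x. x ^ (d - 1) * ?b x ^ M) + integral {p..A} (\<lambda>x. x ^ (d - 1) * ?b x ^ M) =
        integral {z..A} (\<lambda>x. x ^ (d - 1) * ?b x ^ M)"
      using z A cM by (intro Henstock_Kurzweil_Integration.integral_combine) auto
    have "((\<lambda>x. q ^ M * x ^ (d - 1)) has_integral q ^ M * (z ^ d / real d) - q ^ M * (0 ^ d / real d)) {0..z}"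
      by (rule fundamental_theorem_of_calculus)
         (use z d in \<open>auto intro!: derivative_eq_intros simp: has_real_derivative_iff_has_vector_derivative [symmetric]\<close>)
    hence i: "((\<lambda>x. q ^ M * x ^ (d - 1)) has_integral q ^ M * w) {0..z}" using d by (simp add: w_def zero_power)
    have "integral {0..z} (\<lambda>x. q ^ M * x ^ (d - 1)) \<le> integral {0..z} (\<lambda>x. x ^ (d - 1) * ?b x ^ M)"
    proof (rule integral_le)
      fix x assume "x \<in> {0..z}"
      hence "q ^ M \<le> ?b x ^ M" "0 \<le> x ^ (d - 1)" using z q by (auto intro!: power_mono)
      thus "q ^ M * x ^ (d - 1) \<le> x ^ (d - 1) * ?b x ^ M" by (simp add: mult.commute mult_right_mono)
    qed (use i cM in auto)
    hence 1: "q ^ M * w \<le> integral {0..z} (\<lambda>x. x ^ (d - 1) * ?b x ^ M)"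
      by (simp only: integral_unique [OF i])
    have 2: "0 \<le> integral {z..p} (\<lambda>x. x ^ (d - 1) * ?b x ^ M)"
      using e0(2) z p by (intro integral_nonneg cM mult_nonneg_nonneg) auto
    have "norm (integral {p..A} (\<lambda>x. x ^ (d - 1) * ?b x ^ M)) \<le> integral {p..A} (\<lambda>x. m ^ (M - 5) * (x ^ (d - 1) * \<bar>?b x\<bar> ^ 5))"
    proof (rule integral_norm_bound_integral)
      fix x assume x: "x \<in> {p..A}"
      have M5: "M = (M - 5) + 5" using M by simp
      have "\<bar>?b x\<bar> ^ M = \<bar>?b x\<bar> ^ (M - 5) * \<bar>?b x\<bar> ^ 5" by (subst M5) (rule power_add)
      also have "\<dots> \<le> m ^ (M - 5) * \<bar>?b x\<bar> ^ 5"
        using bm x by (intro mult_right_mono power_mono) auto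
      finally have "x ^ (d - 1) * \<bar>?b x\<bar> ^ M \<le> x ^ (d - 1) * (m ^ (M - 5) * \<bar>?b x\<bar> ^ 5)"
        using x p by (intro mult_left_mono) auto
      thus "norm (x ^ (d - 1) * ?b x ^ M) \<le> m ^ (M - 5) * (x ^ (d - 1) * \<bar>?b x\<bar> ^ 5)"
        using x p by (simp add: abs_mult power_abs mult_ac)
    qed (use cM c5 in \<open>auto intro!: integrable_on_mult_right\<close>)
    also have "\<dots> = m ^ (M - 5) * integral {p..A} (\<lambda>x. x ^ (d - 1) * \<bar>?b x\<bar> ^ 5)" by simp
    also have "\<dots> \<le> m ^ (M - 5) * J5"
      using le5 [of p A] p m by (intro mult_left_mono) auto
    also have "\<dots> = q ^ M * (J5 / m ^ 5 * (m / q) ^ M)"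
      using m q M by (simp add: power_divide power_diff)
    also have "\<dots> \<le> q ^ M * (w / 2)"
      using N [OF M(1)] q by (intro mult_left_mono) auto
    finally have "\<bar>integral {p..A} (\<lambda>x. x ^ (d - 1) * ?b x ^ M)\<bar> \<le> q ^ M * w / 2" by simp
    thus ?thesis using 1 2 s1 s2 by linarith
  qed
  have "q ^ M * w / 2 \<le> J"
    by (rule tendsto_lowerbound [OF J(1) eventually_mono [OF eventually_ge_at_top low]]) auto
  moreover have "q ^ M * w / 2 > 0" using q w by simp
  ultimately have "J > 0" by linarith
  with J(2) M that [of k J] show ?thesis by (simp add: M_def)
qed

section \<open>Zonal integrals on the sphere\<close>

lemma nn_integral_lborel_affine:
  fixes f :: "'a::euclidean_space \<Rightarrow> ennreal"
  assumes [measurable]: "f \<in> borel_measurable borel" and c: "\<bar>c\<bar> = 1"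
  shows "(\<integral>\<^sup>+x. f (t + c *\<^sub>R x) \<partial>lborel) = (\<integral>\<^sup>+x. f x \<partial>lborel)"
proof -
  have c0: "c \<noteq> 0" using c by auto
  have "(lborel :: 'a measure) = distr lborel borel (\<lambda>x. t + c *\<^sub>R x)"
    using lborel_affine [OF c0, of t] c by (simp add: density_1)
  hence "(\<integral>\<^sup>+x. f x \<partial>lborel) = (\<integral>\<^sup>+x. f x \<partial>(distr lborel borel (\<lambda>x. t + c *\<^sub>R x)))"
    by metis
  also have "\<dots> = (\<integral>\<^sup>+x. f (t + c *\<^sub>R x) \<partial>lborel)"
    by (subst nn_integral_distr) auto
  finally show ?thesis ..
qed

text \<open>Uniqueness of Haar measure by the Fubini argument, with the unit ball as test set.\<close>

lemma nn_integral_lborel_involution: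
  fixes f :: "'a::euclidean_space \<Rightarrow> ennreal" and g :: "'a \<Rightarrow> 'a"
  assumes [measurable]: "f \<in> borel_measurable borel"
    and lin: "linear g" and iso: "\<And>x. norm (g x) = norm x" and inv: "\<And>x. g (g x) = x"
  shows "(\<integral>\<^sup>+x. f (g x) \<partial>lborel) = (\<integral>\<^sup>+x. f x \<partial>lborel)"
proof -
  define h :: "'a \<Rightarrow> ennreal" where "h = indicator (ball 0 1)"
  define V where "V = emeasure lborel (ball (0::'a) 1)"
  have [measurable]: "g \<in> borel_measurable borel"
    using lin by (intro borel_measurable_continuous_onI linear_continuous_on) (simp add: linear_conv_bounded_linear)
  have [measurable]: "h \<in> borel_measurable borel" unfolding h_def by (intro borel_measurable_indicator) auto
  have hV: "(\<integral>\<^sup>+x. h x \<partial>lborel) = V" by (simp add: h_def V_def)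
  have "(\<integral>\<^sup>+x. f (g x) \<partial>lborel) * V = (\<integral>\<^sup>+x. f (g x) * V \<partial>lborel)"
    by (rule nn_integral_multc [symmetric]) measurable
  also have "\<dots> = (\<integral>\<^sup>+x. \<integral>\<^sup>+y. f (g x) * h (g x + (- 1) *\<^sub>R y) \<partial>lborel \<partial>lborel)"
  proof (rule nn_integral_cong)
    fix x
    have "V = (\<integral>\<^sup>+y. h (g x + (- 1) *\<^sub>R y) \<partial>lborel)"
      by (subst nn_integral_lborel_affine) (auto simp: hV)
    thus "f (g x) * V = (\<integral>\<^sup>+y. f (g x) * h (g x + (- 1) *\<^sub>R y) \<partial>lborel)"
      by (simp add: nn_integral_cmult)
  qed
  also have "\<dots> = (\<integral>\<^sup>+y. \<integral>\<^sup>+x. f (g x) * h (g x + (- 1) *\<^sub>R y) \<partial>lborel \<partial>lborel)"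
    by (rule lborel_pair.Fubini') measurable
  also have "\<dots> = (\<integral>\<^sup>+y. \<integral>\<^sup>+x. f (y - g x) * h x \<partial>lborel \<partial>lborel)"
  proof (rule nn_integral_cong)
    fix y
    have "(\<integral>\<^sup>+x. f (g x) * h (g x + (- 1) *\<^sub>R y) \<partial>lborel) =
      (\<integral>\<^sup>+x. f (g (g y + (- 1) *\<^sub>R x)) * h (g (g y + (- 1) *\<^sub>R x) + (- 1) *\<^sub>R y) \<partial>lborel)"
      by (rule nn_integral_lborel_affine [symmetric]) auto
    \<comment> \<open>Here \<open>g (g y - x) - y\<close> equals \<open>- g x\<close>, and the unit
      ball is invariant under \<open>g\<close> and under negation, so the test function is evaluated
      at \<open>x\<close> again.\<close>
    also have "\<dots> = (\<integral>\<^sup>+x. f (y - g x) * h x \<partial>lborel)"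
      by (intro nn_integral_cong) (simp add: linear_diff [OF lin] inv h_def iso indicator_def)
    finally show "(\<integral>\<^sup>+x. f (g x) * h (g x + (- 1) *\<^sub>R y) \<partial>lborel) = (\<integral>\<^sup>+x. f (y - g x) * h x \<partial>lborel)" .
  qed
  also have "\<dots> = (\<integral>\<^sup>+x. \<integral>\<^sup>+y. f (y - g x) * h x \<partial>lborel \<partial>lborel)"
    by (rule lborel_pair.Fubini') measurable
  also have "\<dots> = (\<integral>\<^sup>+x. (\<integral>\<^sup>+y. f y \<partial>lborel) * h x \<partial>lborel)"
  proof (rule nn_integral_cong)
    fix x
    have "(\<integral>\<^sup>+y. f (y - g x) \<partial>lborel) = (\<integral>\<^sup>+y. f y \<partial>lborel)"
      using nn_integral_lborel_affine [of f 1 "- g x"] by simp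
    thus "(\<integral>\<^sup>+y. f (y - g x) * h x \<partial>lborel) = (\<integral>\<^sup>+y. f y \<partial>lborel) * h x"
      by (simp add: nn_integral_multc)
  qed
  also have "\<dots> = (\<integral>\<^sup>+x. f x \<partial>lborel) * V"
    by (simp add: nn_integral_cmult hV)
  finally have eq: "(\<integral>\<^sup>+x. f (g x) \<partial>lborel) * V = (\<integral>\<^sup>+x. f x \<partial>lborel) * V" .
  have V: "V \<noteq> 0" "V \<noteq> \<top>"
  proof -
    show "V \<noteq> \<top>" unfolding V_def using emeasure_lborel_ball_finite [of "0::'a" 1] by simp
    have "V = ennreal (unit_ball_vol (real DIM('a)))" unfolding V_def by (subst emeasure_ball) auto
    moreover have "unit_ball_vol (real DIM('a)) > 0" by (rule unit_ball_vol_pos) simp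
    ultimately show "V \<noteq> 0" by (metis ennreal_eq_0_iff linorder_not_less)
  qed
  show ?thesis
    using arg_cong [OF eq, of "\<lambda>z. z / V"] V by (simp add: ennreal_mult_divide_eq)
qed

section \<open>Slicing the cone over the sphere by the polar angle\<close>

lemma nn_integral_surface_measure:
  fixes f :: "'a::euclidean_space \<Rightarrow> ennreal"
  assumes [measurable]: "f \<in> borel_measurable borel"
  shows "(\<integral>\<^sup>+x. f x \<partial>surface_measure) =
     of_nat DIM('a) * (\<integral>\<^sup>+x. f (x /\<^sub>R norm x) * indicator {0<..1} (norm x) \<partial>lborel)"
proof -
  have meas: "(\<lambda>x::'a. x /\<^sub>R norm x) \<in>
      restrict_space lborel (cball 0 1 - {0}) \<rightarrow>\<^sub>M restrict_space borel (sphere 0 1)"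
    by (rule measurable_restrict_space2)
      (auto simp: space_restrict_space intro!: measurable_restrict_space1)
  have fm: "f \<in> borel_measurable (restrict_space borel (sphere 0 1))"
    by (rule measurable_restrict_space1) measurable
  show ?thesis
    unfolding surface_measure_def
    by (simp add: nn_integral_scale_measure fm nn_integral_distr [OF meas] nn_integral_restrict_space)
       (auto intro!: nn_integral_cong arg_cong2 [where f = "(*)"] simp: indicator_def)
qed

text \<open>The zero vector lies in balls of arbitrarily small volume. This removes the axis, where
  the passage from the axial coordinate to the angle degenerates.\<close>

lemma AE_norm_PiM_pos:
  assumes "finite A" "A \<noteq> {}"
  shows "AE p in Pi\<^sub>M A (\<lambda>_. lborel). 0 < sqrt (\<Sum>i\<in>A. (p i)\<^sup>2)"
proof -
  let ?P = "Pi\<^sub>M A (\<lambda>_. lborel :: real measure)"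
  let ?\<rho> = "\<lambda>p. sqrt (\<Sum>i\<in>A. (p i)\<^sup>2)"
  have [measurable]: "?\<rho> \<in> borel_measurable ?P" by measurable
  define N where "N = {p \<in> space ?P. ?\<rho> p \<le> 0}"
  have [measurable]: "N \<in> sets ?P" unfolding N_def by measurable
  have "emeasure ?P N \<le> ennreal (unit_ball_vol (real (card A)) * (1 / real (Suc m)) ^ card A)" for m
  proof -
    have "N \<subseteq> {f. ?\<rho> f \<le> 1 / real (Suc m)} \<inter> space ?P"
    proof
      fix p assume "p \<in> N"
      hence "?\<rho> p \<le> 0" "p \<in> space ?P" by (auto simp: N_def)
      moreover have "0 \<le> 1 / real (Suc m)" by simp
      ultimately have "?\<rho> p \<le> 1 / real (Suc m)" by linarith
      thus "p \<in> {f. ?\<rho> f \<le> 1 / real (Suc m)} \<inter> space ?P" using \<open>p \<in> space ?P\<close> by blast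
    qed
    moreover have "{f. ?\<rho> f \<le> 1 / real (Suc m)} \<inter> space ?P \<in> sets ?P" by measurable
    ultimately have "emeasure ?P N \<le> emeasure ?P ({f. ?\<rho> f \<le> 1 / real (Suc m)} \<inter> space ?P)"
      by (rule emeasure_mono)
    also have "\<dots> = ennreal (unit_ball_vol (real (card A)) * (1 / real (Suc m)) ^ card A)"
      using assms by (intro emeasure_cball_aux) auto
    finally show ?thesis .
  qed
  moreover have "(\<lambda>m. ennreal (unit_ball_vol (real (card A)) * (1 / real (Suc m)) ^ card A)) \<longlonglongrightarrow> ennreal (unit_ball_vol (real (card A)) * 0 ^ card A)"
    by (intro tendsto_intros tendsto_ennrealI LIMSEQ_Suc [OF lim_1_over_n])
  ultimately have "emeasure ?P N \<le> ennreal (unit_ball_vol (real (card A)) * 0 ^ card A)"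
    by (meson LIMSEQ_le_const)
  also have "\<dots> = 0" using assms by (simp add: card_gt_0_iff)
  finally have "N \<in> null_sets ?P" by (simp add: null_sets_def)
  thus ?thesis by (rule AE_I') (auto simp: N_def not_less)
qed

text \<open>Layer-cake formula: the radius is the integral of the indicator of t < radius over t >=
  0, and the points with t < radius <= \<open>R\<close> form a shell whose volume is a difference of
  two ball volumes. What remains is a polynomial in t.\<close>

lemma nn_integral_radius:
  assumes A: "finite A" "A \<noteq> {}" and R: "R > 0"
  shows "(\<integral>\<^sup>+p. (if sqrt (\<Sum>i\<in>A. (p i)\<^sup>2) \<le> R then ennreal (sqrt (\<Sum>i\<in>A. (p i)\<^sup>2)) else 0) \<partial>Pi\<^sub>M A (\<lambda>_. lborel)) =
    ennreal (unit_ball_vol (real (card A)) * (real (card A) / (real (card A) + 1)) * R ^ (card A + 1))"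
proof -
  let ?P = "Pi\<^sub>M A (\<lambda>_. lborel :: real measure)"
  define \<rho> where "\<rho> = (\<lambda>p. sqrt (\<Sum>i\<in>A. (p i)\<^sup>2))"
  define k where "k = card A"
  define \<omega> where "\<omega> = unit_ball_vol (real k)"
  have w: "\<omega> > 0" by (simp add: \<omega>_def)
  have [measurable]: "\<rho> \<in> borel_measurable ?P" unfolding \<rho>_def by measurable
  interpret P: finite_product_sigma_finite "\<lambda>_. lborel :: real measure" A by standard (rule A)
  interpret pair_sigma_finite ?P "lborel :: real measure" ..
  have rho0: "\<rho> p \<ge> 0" for p by (simp add: \<rho>_def sum_nonneg)
  have cball: "emeasure ?P {p \<in> space ?P. \<rho> p \<le> r} = ennreal (\<omega> * r ^ k)" if "r > 0" for r
    using emeasure_cball_aux [OF A(1) that] by (simp add: \<rho>_def \<omega>_def k_def Collect_conj_eq Int_commute)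
  have "(\<integral>\<^sup>+p. (if \<rho> p \<le> R then ennreal (\<rho> p) else 0) \<partial>?P) =
     (\<integral>\<^sup>+p. \<integral>\<^sup>+t. (if 0 \<le> t \<and> t < \<rho> p \<and> \<rho> p \<le> R then 1 else 0) \<partial>lborel \<partial>?P)"
  proof (rule nn_integral_cong)
    fix p
    have "(\<integral>\<^sup>+t. (if 0 \<le> t \<and> t < \<rho> p \<and> \<rho> p \<le> R then 1 else 0) \<partial>lborel) =
      (\<integral>\<^sup>+t. (if \<rho> p \<le> R then 1 else 0) * indicator {0..<\<rho> p} t \<partial>lborel)"
      by (intro nn_integral_cong) (auto simp: indicator_def)
    also have "\<dots> = (if \<rho> p \<le> R then 1 else 0) * emeasure lborel {0..<\<rho> p}"
      by (rule nn_integral_cmult_indicator) auto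
    finally show "(if \<rho> p \<le> R then ennreal (\<rho> p) else 0) = (\<integral>\<^sup>+t. (if 0 \<le> t \<and> t < \<rho> p \<and> \<rho> p \<le> R then 1 else 0) \<partial>lborel)"
      using rho0 [of p] by simp
  qed
  also have "\<dots> = (\<integral>\<^sup>+t. \<integral>\<^sup>+p. (if 0 \<le> t \<and> t < \<rho> p \<and> \<rho> p \<le> R then 1 else 0) \<partial>?P \<partial>lborel)"
    by (rule Fubini' [symmetric]) measurable
  also have "\<dots> = (\<integral>\<^sup>+t. ennreal (\<omega> * R ^ k - \<omega> * t ^ k) * indicator {0..R} t \<partial>lborel)"
  proof (rule nn_integral_cong_AE)
    have "AE t in lborel. t \<noteq> (0::real)" by (rule AE_lborel_singleton)
    thus "AE t in lborel. (\<integral>\<^sup>+p. (if 0 \<le> t \<and> t < \<rho> p \<and> \<rho> p \<le> R then 1 else 0) \<partial>?P) =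
       ennreal (\<omega> * R ^ k - \<omega> * t ^ k) * indicator {0..R} t"
    proof eventually_elim
      case (elim t)
      show ?case
      proof (cases "0 < t \<and> t \<le> R")
        case True
        have "(\<integral>\<^sup>+p. (if 0 \<le> t \<and> t < \<rho> p \<and> \<rho> p \<le> R then 1 else 0) \<partial>?P) =
            (\<integral>\<^sup>+p. indicator ({p \<in> space ?P. \<rho> p \<le> R} - {p \<in> space ?P. \<rho> p \<le> t}) p \<partial>?P)"
          using True by (intro nn_integral_cong) (auto simp: indicator_def)
        also have "\<dots> = emeasure ?P ({p \<in> space ?P. \<rho> p \<le> R} - {p \<in> space ?P. \<rho> p \<le> t})"
          by (rule nn_integral_indicator) measurable
        also have "\<dots> = emeasure ?P {p \<in> space ?P. \<rho> p \<le> R} - emeasure ?P {p \<in> space ?P. \<rho> p \<le> t}"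
          using True by (intro emeasure_Diff) (auto simp: cball)
        also have "\<dots> = ennreal (\<omega> * R ^ k) - ennreal (\<omega> * t ^ k)"
          using True R by (simp add: cball)
        also have "\<dots> = ennreal (\<omega> * R ^ k - \<omega> * t ^ k)"
          using True w by (intro ennreal_minus) auto
        finally show ?thesis using True by simp
      next
        case False
        hence "(\<integral>\<^sup>+p. (if 0 \<le> t \<and> t < \<rho> p \<and> \<rho> p \<le> R then 1 else 0) \<partial>?P) = (\<integral>\<^sup>+p. 0 \<partial>?P)"
          using elim by (intro nn_integral_cong) auto
        thus ?thesis using False elim by (auto simp: indicator_def)
      qed
    qed
  qed
  also have "\<dots> = ennreal ((\<omega> * R ^ k * R - \<omega> * (R ^ (k + 1) / (k + 1))) - (\<omega> * R ^ k * 0 - \<omega> * (0 ^ (k + 1) / (k + 1))))"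
  proof (rule nn_integral_FTC_Icc [where F = "\<lambda>t. \<omega> * R ^ k * t - \<omega> * (t ^ (k + 1) / (k + 1))"])
    fix t assume "t \<in> {0..R}"
    hence t: "0 \<le> t" "t \<le> R" by auto
    have "((\<lambda>t. t ^ (k + 1)) has_real_derivative real (k + 1) * t ^ k) (at t)"
      using DERIV_pow [of "k + 1" t] by simp
    from DERIV_diff [OF DERIV_cmult [OF DERIV_ident, of "\<omega> * R ^ k"] DERIV_cmult [OF DERIV_cdivide [OF this, of "real (k + 1)"], of \<omega>]]
    show "((\<lambda>t. \<omega> * R ^ k * t - \<omega> * (t ^ (k + 1) / (k + 1))) has_real_derivative \<omega> * R ^ k - \<omega> * t ^ k) (at t)"
      by simp
    show "0 \<le> \<omega> * R ^ k - \<omega> * t ^ k" using t w by (auto intro!: mult_left_mono power_mono)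
  qed (use R in auto)
  also have "(\<omega> * R ^ k * R - \<omega> * (R ^ (k + 1) / (k + 1))) - (\<omega> * R ^ k * 0 - \<omega> * (0 ^ (k + 1) / (k + 1))) =
     \<omega> * (real k / (real k + 1)) * R ^ (k + 1)"
    by (simp add: field_simps)
  finally show ?thesis unfolding \<rho>_def \<omega>_def k_def .
qed

text \<open>Here \<open>s\<close> is the coordinate along an axis, \<open>r\<close> the distance
  from it and \<open>t\<close> an angle, with s = -r cot(t). The norm becomes r / sin(t), so lying
  in the unit ball means \<open>r \<le> sin t\<close>. The minus sign makes the substitution
  increasing.\<close>

lemma nn_integral_cot_substitution:
  fixes f :: "real \<Rightarrow> real"
  assumes [measurable]: "f \<in> borel_measurable borel" and f: "\<And>x. f x \<ge> 0" and r: "0 < r"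
  shows "(\<integral>\<^sup>+s. (if sqrt (s\<^sup>2 + r\<^sup>2) \<le> 1 then ennreal (f (- s / sqrt (s\<^sup>2 + r\<^sup>2))) else 0) \<partial>lborel) =
    (\<integral>\<^sup>+t. (if 0 \<le> t \<and> t \<le> pi \<and> r \<le> sin t then ennreal (f (cos t) * (r / (sin t)\<^sup>2)) else 0) \<partial>lborel)"
proof (cases "r \<le> 1")
  case False
  have "1 < sqrt (s\<^sup>2 + r\<^sup>2)" for s
  proof (rule real_less_rsqrt)
    have "1 < r\<^sup>2" using False by (simp add: one_less_power)
    moreover have "0 \<le> s\<^sup>2" by simp
    ultimately show "1\<^sup>2 < s\<^sup>2 + r\<^sup>2" unfolding power_one by linarith
  qed
  hence L: "\<not> sqrt (s\<^sup>2 + r\<^sup>2) \<le> 1" for s using not_le by blast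
  have R: "\<not> r \<le> sin t" for t using sin_le_one [of t] False by linarith
  show ?thesis by (simp only: L R if_False simp_thms)
next
  case True
  define a where "a = arcsin r"
  have a: "0 < a" "a \<le> pi / 2" "sin a = r" "cos a = sqrt (1 - r\<^sup>2)"
    using r True arcsin_less_mono [of 0 r] arcsin_bounded [of r] cos_arcsin [of r] by (auto simp: a_def)
  define g where "g = (\<lambda>t. - r * (cos t / sin t))"
  have s: "sin t > 0" if "t \<in> {a..pi - a}" for t using that a by (intro sin_gt_zero) auto
  have ga: "g a = - sqrt (1 - r\<^sup>2)" "g (pi - a) = sqrt (1 - r\<^sup>2)"
    using a r by (simp_all add: g_def)
  define F where "F = (\<lambda>s. f (- s / sqrt (s\<^sup>2 + r\<^sup>2)))"
  have "(\<integral>\<^sup>+s. (if sqrt (s\<^sup>2 + r\<^sup>2) \<le> 1 then ennreal (F s) else 0) \<partial>lborel) =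
    (\<integral>\<^sup>+s. ennreal (F s * indicator {g a..g (pi - a)} s) \<partial>lborel)"
  proof (rule nn_integral_cong)
    fix s
    have "sqrt (s\<^sup>2 + r\<^sup>2) \<le> 1 \<longleftrightarrow> s\<^sup>2 \<le> 1 - r\<^sup>2" by auto
    also have "\<dots> \<longleftrightarrow> \<bar>s\<bar> \<le> sqrt (1 - r\<^sup>2)"
      by (metis real_sqrt_abs real_sqrt_le_iff)
    also have "\<dots> \<longleftrightarrow> s \<in> {g a..g (pi - a)}" unfolding ga by auto
    finally show "(if sqrt (s\<^sup>2 + r\<^sup>2) \<le> 1 then ennreal (F s) else 0) = ennreal (F s * indicator {g a..g (pi - a)} s)"
      by (auto simp: indicator_def)
  qed
  also have "\<dots> = (\<integral>\<^sup>+t. ennreal (F (g t) * (r / (sin t)\<^sup>2) * indicator {a..pi - a} t) \<partial>lborel)"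
  proof (rule nn_integral_substitution)
    show "set_borel_measurable borel {g a..g (pi - a)} F"
      unfolding set_borel_measurable_def F_def by measurable
    fix t assume t: "t \<in> {a..pi - a}"
    show "(g has_real_derivative r / (sin t)\<^sup>2) (at t)"
    proof -
      have "(g has_real_derivative - r * ((- sin t * sin t - cos t * cos t) / (sin t * sin t))) (at t)"
        unfolding g_def by (rule derivative_eq_intros refl | use s [OF t] in simp)+
      also have "- sin t * sin t - cos t * cos t = - 1"
        using sin_cos_squared_add [of t] by (simp add: power2_eq_square)
      finally show ?thesis by (simp add: power2_eq_square)
    qed
    show "0 \<le> r / (sin t)\<^sup>2" using r by simp
  next
    show "continuous_on {a..pi - a} (\<lambda>t. r / (sin t)\<^sup>2)"
      by (intro continuous_intros) (use s in force)
    show "a \<le> pi - a" using a by simp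
  qed
  also have "\<dots> = (\<integral>\<^sup>+t. (if 0 \<le> t \<and> t \<le> pi \<and> r \<le> sin t then ennreal (f (cos t) * (r / (sin t)\<^sup>2)) else 0) \<partial>lborel)"
  proof (rule nn_integral_cong)
    fix t
    have iff: "0 \<le> t \<and> t \<le> pi \<and> r \<le> sin t \<longleftrightarrow> t \<in> {a..pi - a}"
    proof
      assume t: "t \<in> {a..pi - a}"
      have "sin a \<le> sin t"
      proof (cases "t \<le> pi / 2")
        case True thus ?thesis using a t by (intro sin_monotone_2pi_le) auto
      next
        case False
        hence "sin a \<le> sin (pi - t)" using a t by (intro sin_monotone_2pi_le) auto
        thus ?thesis by simp
      qed
      thus "0 \<le> t \<and> t \<le> pi \<and> r \<le> sin t" using t a by auto
    next
      assume t: "0 \<le> t \<and> t \<le> pi \<and> r \<le> sin t"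
      have "a \<le> t"
      proof (rule ccontr)
        assume "\<not> a \<le> t"
        hence "sin t < sin a" using t a by (intro sin_monotone_2pi) auto
        thus False using t a by simp
      qed
      moreover have "a \<le> pi - t"
      proof (rule ccontr)
        assume "\<not> a \<le> pi - t"
        hence "sin (pi - t) < sin a" using t a by (intro sin_monotone_2pi) auto
        thus False using t a by simp
      qed
      ultimately show "t \<in> {a..pi - a}" by auto
    qed
    show "ennreal (F (g t) * (r / (sin t)\<^sup>2) * indicator {a..pi - a} t) =
      (if 0 \<le> t \<and> t \<le> pi \<and> r \<le> sin t then ennreal (f (cos t) * (r / (sin t)\<^sup>2)) else 0)"
    proof (cases "t \<in> {a..pi - a}")
      case True
      have st: "sin t > 0" using s [OF True] .
      define q where "q = r / sin t"
      have "g t = - (q * cos t)" "r = q * sin t" using st by (simp_all add: g_def q_def)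
      hence "(g t)\<^sup>2 + r\<^sup>2 = (q * cos t)\<^sup>2 + (q * sin t)\<^sup>2" by simp
      also have "\<dots> = (r / sin t)\<^sup>2 * ((cos t)\<^sup>2 + (sin t)\<^sup>2)"
        by (simp only: q_def [symmetric] power_mult_distrib distrib_left)
      finally have "(g t)\<^sup>2 + r\<^sup>2 = (r / sin t)\<^sup>2 * ((cos t)\<^sup>2 + (sin t)\<^sup>2)" .
      hence "(g t)\<^sup>2 + r\<^sup>2 = (r / sin t)\<^sup>2" by simp
      hence "sqrt ((g t)\<^sup>2 + r\<^sup>2) = r / sin t" using st r by simp
      hence "F (g t) = f (cos t)" using st r by (simp add: F_def g_def)
      thus ?thesis using True iff by simp
    next
      case False
      thus ?thesis using iff by auto
    qed
  qed
  finally show ?thesis unfolding F_def .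
qed

lemma sphere_mass_unit_ball_vol:
  assumes "d \<ge> 1"
  shows "sphere_mass (d - 1) = real d * unit_ball_vol (real d)"
proof -
  define h where "h = real d / 2"
  have h: "h > 0" "real d = 2 * h" "(real (d - 1) + 1) / 2 = h" using assms by (auto simp: h_def)
  have "Gamma (h + 1) = h * Gamma h"
    by (rule Gamma_plus1) (use h(1) in \<open>auto elim!: nonpos_Ints_cases\<close>)
  moreover have "Gamma h > 0" using h(1) by (rule Gamma_real_pos)
  ultimately show ?thesis
    using h unfolding sphere_mass_def unit_ball_vol_def h(3) by simp
qed

text \<open>The reflection in the hyperplane orthogonal to \<open>a - b\<close>, or the identity if
  \<open>a = b\<close>. Equality of the norms gives
  \<open>2 * (a \<bullet> w) = w \<bullet> w\<close>, which is why \<open>a\<close> is sent to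
  \<open>b\<close>.\<close>

lemma exists_isometric_involution:
  fixes a b :: "'a::euclidean_space"
  assumes "norm a = norm b"
  obtains g where "linear g" "\<And>x. g (g x) = x" "\<And>x y. g x \<bullet> g y = x \<bullet> y" "g a = b"
proof (cases "a = b")
  case True
  thus ?thesis using that [of "\<lambda>x. x"] by (simp add: linear_ident)
next
  case False
  define w where "w = a - b"
  have w: "w \<bullet> w \<noteq> 0" using False by (simp add: w_def)
  define g where "g = (\<lambda>x. x - (2 * (x \<bullet> w) / (w \<bullet> w)) *\<^sub>R w)"
  have 1: "linear g"
    unfolding g_def by (rule linearI) (simp_all add: inner_add_left algebra_simps add_divide_distrib scaleR_add_left)
  have 2: "g (g x) = x" for x
    using w by (simp add: g_def inner_diff_left algebra_simps)
  have 3: "g x \<bullet> g y = x \<bullet> y" for x y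
    using w by (simp add: g_def inner_diff_left inner_diff_right inner_commute field_simps)
  have ab: "a \<bullet> a = b \<bullet> b" using assms by (simp add: dot_square_norm)
  have "2 * (a \<bullet> w) = w \<bullet> w" using ab by (simp add: w_def inner_diff_left inner_diff_right inner_commute)
  hence 4: "g a = b" using w by (simp add: g_def w_def)
  show ?thesis using that 1 2 3 4 by blast
qed

text \<open>A reflection puts the pole on a coordinate axis. For each point of the orthogonal
  hyperplane, the axial coordinate is then traded for the angle. Integrating the distance from the
  axis over a ball of radius sin t produces sin(t)^(d+1), of which the Jacobian removes two powers.
  The factor \<open>DIM('a)\<close> from the cone cancels the 1/(d+1) of the radius
  integral.\<close>

theorem nn_integral_zonal:
  fixes f :: "real \<Rightarrow> real" and y :: "'a::euclidean_space"
  assumes [measurable]: "f \<in> borel_measurable borel" and f: "\<And>x. f x \<ge> 0" and y: "norm y = 1"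
    and d: "DIM('a) = d + 1" "d \<ge> 1"
  shows "(\<integral>\<^sup>+x. ennreal (f (x \<bullet> y)) \<partial>(surface_measure :: 'a measure)) =
    (\<integral>\<^sup>+t. ennreal (sphere_mass (d - 1) * (sin t ^ (d - 1) * f (cos t))) * indicator {0..pi} t \<partial>lborel)"
proof -
  obtain e :: 'a where e: "e \<in> Basis" using nonempty_Basis by blast
  define B where "B = (Basis :: 'a set) - {e}"
  have B: "finite B" "e \<notin> B" "insert e B = Basis" "card B = d"
    using e d by (auto simp: B_def)
  hence B: "finite B" "e \<notin> B" "insert e B = Basis" "card B = d" "B \<noteq> {}"
    using d by auto
  \<comment> \<open>The pole is sent to \<open>- y\<close>, not \<open>y\<close>, to match the sign
    in \<open>f (- s / ...)\<close> that the increasing substitution imposes.\<close>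
  have "norm e = norm (- y)" using e y by simp
  then obtain g where g: "linear g" "\<And>x. g (g x) = x" "\<And>x y. g x \<bullet> g y = x \<bullet> y" "g e = - y"
    using exists_isometric_involution by blast
  have gn: "norm (g x) = norm x" for x by (simp add: norm_eq_sqrt_inner g(3))
  have [measurable]: "g \<in> borel_measurable borel"
    using g(1) by (intro borel_measurable_continuous_onI linear_continuous_on) (simp add: linear_conv_bounded_linear)
  let ?P = "Pi\<^sub>M B (\<lambda>_. lborel :: real measure)"
  define \<rho> where "\<rho> = (\<lambda>p :: 'a \<Rightarrow> real. sqrt (\<Sum>i\<in>B. (p i)\<^sup>2))"
  have [measurable]: "\<rho> \<in> borel_measurable ?P" unfolding \<rho>_def by measurable
  interpret PS: product_sigma_finite "\<lambda>_. lborel :: real measure" ..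
  interpret P: finite_product_sigma_finite "\<lambda>_. lborel :: real measure" B by standard (rule B)
  interpret pair_sigma_finite ?P "lborel :: real measure" ..
  define \<Phi> where "\<Phi> = (\<lambda>x :: 'a. ennreal (f (- (x \<bullet> e) / norm x)) * indicator {0<..1} (norm x))"
  have [measurable]: "\<Phi> \<in> borel_measurable borel" unfolding \<Phi>_def by measurable
  define J where "J = (\<lambda>p t. if 0 \<le> t \<and> t \<le> pi \<and> \<rho> p \<le> sin t then ennreal (f (cos t) * (\<rho> p / (sin t)\<^sup>2)) else 0)"
  have "(\<integral>\<^sup>+x. ennreal (f (x \<bullet> y)) \<partial>(surface_measure :: 'a measure)) =
     of_nat DIM('a) * (\<integral>\<^sup>+x. ennreal (f ((x /\<^sub>R norm x) \<bullet> y)) * indicator {0<..1} (norm x) \<partial>lborel)"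
    by (rule nn_integral_surface_measure) measurable
  also have "(\<integral>\<^sup>+x. ennreal (f ((x /\<^sub>R norm x) \<bullet> y)) * indicator {0<..1} (norm x) \<partial>lborel) =
     (\<integral>\<^sup>+x. ennreal (f ((g x /\<^sub>R norm (g x)) \<bullet> y)) * indicator {0<..1} (norm (g x)) \<partial>lborel)"
    by (rule nn_integral_lborel_involution [OF _ g(1) gn g(2), symmetric]) measurable
  also have "\<dots> = (\<integral>\<^sup>+x. \<Phi> x \<partial>lborel)"
  proof (rule nn_integral_cong)
    fix x
    have "g x \<bullet> y = - (g x \<bullet> g e)" by (simp add: g(4))
    also have "\<dots> = - (x \<bullet> e)" by (simp only: g(3))
    finally have "(g x /\<^sub>R norm (g x)) \<bullet> y = - (x \<bullet> e) / norm x" by (simp add: gn divide_inverse)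
    moreover have "indicator {0<..1} (norm (g x)) = (indicator {0<..1} (norm x) :: ennreal)"
      by (simp only: gn)
    ultimately show "ennreal (f ((g x /\<^sub>R norm (g x)) \<bullet> y)) * indicator {0<..1} (norm (g x)) = \<Phi> x"
      by (simp add: \<Phi>_def)
  qed
  also have "\<dots> = (\<integral>\<^sup>+p. \<Phi> (\<Sum>b\<in>Basis. p b *\<^sub>R b) \<partial>Pi\<^sub>M Basis (\<lambda>_. lborel))"
    by (subst lborel_eq, subst nn_integral_distr) auto
  also have "\<dots> = (\<integral>\<^sup>+p. \<integral>\<^sup>+s. \<Phi> (\<Sum>b\<in>Basis. (p(e := s)) b *\<^sub>R b) \<partial>lborel \<partial>?P)"
    unfolding B(3) [symmetric] using B by (intro PS.product_nn_integral_insert) (auto simp del: B(3))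
  also have "\<dots> = (\<integral>\<^sup>+p. \<integral>\<^sup>+t. J p t \<partial>lborel \<partial>?P)"
  proof (rule nn_integral_cong_AE)
    have "AE p in ?P. 0 < \<rho> p" unfolding \<rho>_def using B by (intro AE_norm_PiM_pos) auto
    thus "AE p in ?P. (\<integral>\<^sup>+s. \<Phi> (\<Sum>b\<in>Basis. (p(e := s)) b *\<^sub>R b) \<partial>lborel) = (\<integral>\<^sup>+t. J p t \<partial>lborel)"
    proof eventually_elim
      case (elim p)
      have "\<Phi> (\<Sum>b\<in>Basis. (p(e := s)) b *\<^sub>R b) =
        (if sqrt (s\<^sup>2 + (\<rho> p)\<^sup>2) \<le> 1 then ennreal (f (- s / sqrt (s\<^sup>2 + (\<rho> p)\<^sup>2))) else 0)" for s
      proof -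
        define x where "x = (\<Sum>b\<in>Basis. (p(e := s)) b *\<^sub>R b)"
        have xb: "x \<bullet> b = (p(e := s)) b" if "b \<in> Basis" for b
          using that by (simp add: x_def inner_sum_left_Basis)
        have "norm x = sqrt (\<Sum>b\<in>Basis. (x \<bullet> b)\<^sup>2)"
          by (simp add: norm_eq_sqrt_inner euclidean_inner [of x x] power2_eq_square)
        also have "(\<Sum>b\<in>Basis. (x \<bullet> b)\<^sup>2) = (\<Sum>b\<in>insert e B. ((p(e := s)) b)\<^sup>2)"
          using xb B by (intro sum.cong) auto
        also have "\<dots> = s\<^sup>2 + (\<Sum>b\<in>B. ((p(e := s)) b)\<^sup>2)"
          using B by (subst sum.insert) auto
        also have "(\<Sum>b\<in>B. ((p(e := s)) b)\<^sup>2) = (\<Sum>b\<in>B. (p b)\<^sup>2)"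
          using B by (intro sum.cong) auto
        also have "\<dots> = (\<rho> p)\<^sup>2" by (simp add: \<rho>_def sum_nonneg)
        finally have nx: "norm x = sqrt (s\<^sup>2 + (\<rho> p)\<^sup>2)" .
        have "x \<noteq> 0" using elim nx by (metis add_nonneg_pos less_irrefl norm_zero real_sqrt_gt_0_iff zero_le_power2 zero_less_power)
        hence "\<Phi> x = (if sqrt (s\<^sup>2 + (\<rho> p)\<^sup>2) \<le> 1 then ennreal (f (- s / sqrt (s\<^sup>2 + (\<rho> p)\<^sup>2))) else 0)"
          using xb [OF e] nx by (simp add: \<Phi>_def indicator_def)
        thus ?thesis by (simp only: x_def)
      qed
      thus ?case unfolding J_def using nn_integral_cot_substitution [OF assms(1) f elim] by simp
    qed
  qed
  also have "\<dots> = (\<integral>\<^sup>+t. \<integral>\<^sup>+p. J p t \<partial>?P \<partial>lborel)"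
    by (rule Fubini' [symmetric]) (unfold J_def, measurable)
  also have "\<dots> = (\<integral>\<^sup>+t. ennreal (unit_ball_vol (real d) * (real d / (real d + 1)) * (sin t ^ (d - 1) * f (cos t))) * indicator {0..pi} t \<partial>lborel)"
  proof (rule nn_integral_cong_AE)
    have "AE t in lborel. t \<noteq> (0::real)" "AE t in lborel. t \<noteq> pi" by (rule AE_lborel_singleton)+
    thus "AE t in lborel. (\<integral>\<^sup>+p. J p t \<partial>?P) =
       ennreal (unit_ball_vol (real d) * (real d / (real d + 1)) * (sin t ^ (d - 1) * f (cos t))) * indicator {0..pi} t"
    proof eventually_elim
      case (elim t)
      show ?case
      proof (cases "0 \<le> t \<and> t \<le> pi")
        case True
        hence st: "sin t > 0" using elim by (intro sin_gt_zero) auto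
        have "(\<integral>\<^sup>+p. J p t \<partial>?P) = (\<integral>\<^sup>+p. ennreal (f (cos t) / (sin t)\<^sup>2) * (if \<rho> p \<le> sin t then ennreal (\<rho> p) else 0) \<partial>?P)"
          using True f [of "cos t"] by (intro nn_integral_cong) (auto simp: J_def ennreal_mult'' [symmetric] \<rho>_def sum_nonneg mult_ac)
        also have "\<dots> = ennreal (f (cos t) / (sin t)\<^sup>2) * (\<integral>\<^sup>+p. (if \<rho> p \<le> sin t then ennreal (\<rho> p) else 0) \<partial>?P)"
          by (rule nn_integral_cmult) measurable
        also have "(\<integral>\<^sup>+p. (if \<rho> p \<le> sin t then ennreal (\<rho> p) else 0) \<partial>?P) =
          ennreal (unit_ball_vol (real d) * (real d / (real d + 1)) * sin t ^ (d + 1))"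
          using nn_integral_radius [OF B(1,5) st] unfolding \<rho>_def B(4) .
        also have "ennreal (f (cos t) / (sin t)\<^sup>2) * \<dots> =
          ennreal (f (cos t) / (sin t)\<^sup>2 * (unit_ball_vol (real d) * (real d / (real d + 1)) * sin t ^ (d + 1)))"
          using f [of "cos t"] by (intro ennreal_mult' [symmetric]) auto
        also have "f (cos t) / (sin t)\<^sup>2 * (unit_ball_vol (real d) * (real d / (real d + 1)) * sin t ^ (d + 1)) =
          unit_ball_vol (real d) * (real d / (real d + 1)) * (sin t ^ (d - 1) * f (cos t))"
        proof -
          have "sin t ^ (d + 1) = sin t ^ (d - 1) * (sin t)\<^sup>2"
            using d(2) by (simp flip: power_add)
          thus ?thesis using st by simp
        qed
        finally show ?thesis using True by simp
      next
        case False
        hence "(\<integral>\<^sup>+p. J p t \<partial>?P) = (\<integral>\<^sup>+p. 0 \<partial>?P)"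
          by (intro nn_integral_cong) (auto simp: J_def)
        thus ?thesis using False by (auto simp: indicator_def)
      qed
    qed
  qed
  also have "of_nat DIM('a) * \<dots> =
    (\<integral>\<^sup>+t. of_nat DIM('a) * (ennreal (unit_ball_vol (real d) * (real d / (real d + 1)) * (sin t ^ (d - 1) * f (cos t))) * indicator {0..pi} t) \<partial>lborel)"
    by (rule nn_integral_cmult [symmetric]) measurable
  also have "\<dots> = (\<integral>\<^sup>+t. ennreal (sphere_mass (d - 1) * (sin t ^ (d - 1) * f (cos t))) * indicator {0..pi} t \<partial>lborel)"
  proof (rule nn_integral_cong)
    fix t
    have "of_nat DIM('a) * ennreal (unit_ball_vol (real d) * (real d / (real d + 1)) * X) = ennreal (sphere_mass (d - 1) * X)" for X
    proof -
      have "of_nat DIM('a) * ennreal (unit_ball_vol (real d) * (real d / (real d + 1)) * X) =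
        ennreal ((real d + 1) * (unit_ball_vol (real d) * (real d / (real d + 1)) * X))"
      proof -
        have "(of_nat DIM('a) :: ennreal) = ennreal (real (d + 1))"
          by (simp only: d ennreal_of_nat_eq_real_of_nat)
        also have "real (d + 1) = real d + 1" by simp
        finally show ?thesis by (simp only: ennreal_mult' [symmetric] of_nat_0_le_iff add_nonneg_nonneg zero_le_one)
      qed
      also have "(real d + 1) * (unit_ball_vol (real d) * (real d / (real d + 1)) * X) = sphere_mass (d - 1) * X"
        unfolding sphere_mass_unit_ball_vol [OF d(2)] by (simp add: add_eq_0_iff)
      finally show ?thesis .
    qed
    thus "of_nat DIM('a) * (ennreal (unit_ball_vol (real d) * (real d / (real d + 1)) * (sin t ^ (d - 1) * f (cos t))) * indicator {0..pi} t) =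
      ennreal (sphere_mass (d - 1) * (sin t ^ (d - 1) * f (cos t))) * indicator {0..pi} t"
      by (metis mult.assoc)
  qed
  finally show ?thesis .
qed

section \<open>Sign correlation of Gaussian pairs\<close>

lemma prob_std_normal: "prob_space std_normal_distribution"
  using real_dist_normal_dist by (simp add: real_distribution_def)

text \<open>Dividing the weight by \<open>\<kappa>\<close>, which is its total mass by the case
  \<open>t = 0\<close>, gives a probability measure under which \<open>Z\<close> has the standard
  normal characteristic function. Levy uniqueness then identifies its law.\<close>

lemma (in prob_space) weighted_char_std_normal:
  fixes W Z :: "'a \<Rightarrow> real"
  assumes [measurable]: "random_variable borel Z" and W: "integrable M W" "\<And>\<omega>. \<omega> \<in> space M \<Longrightarrow> 0 \<le> W \<omega>"
    and char: "\<And>t. (\<integral>\<omega>. W \<omega> *\<^sub>R iexp (t * Z \<omega>) \<partial>M) = of_real (\<kappa> * exp (- t\<^sup>2 / 2))" and "\<kappa> > 0"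
    and [measurable]: "B \<in> sets borel"
  shows "(\<integral>\<omega>. W \<omega> * indicator B (Z \<omega>) \<partial>M) = \<kappa> * measure std_normal_distribution B"
proof -
  have [measurable]: "W \<in> borel_measurable M" using W(1) by simp
  define M' where "M' = density M (\<lambda>\<omega>. ennreal (W \<omega> / \<kappa>))"
  define D where "D = distr M' borel Z"
  have nn: "AE \<omega> in M. 0 \<le> W \<omega> / \<kappa>" using W(2) \<open>\<kappa> > 0\<close> by (intro AE_I2) auto
  have "(\<integral>\<omega>. complex_of_real (W \<omega>) \<partial>M) = of_real \<kappa>"
    using char [of 0] by (simp add: scaleR_conv_of_real)
  hence tot: "(\<integral>\<omega>. W \<omega> \<partial>M) = \<kappa>" by (metis integral_complex_of_real of_real_eq_iff)
  have "emeasure M' (space M') = (\<integral>\<^sup>+\<omega>. ennreal (W \<omega> / \<kappa>) \<partial>M)"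
    unfolding M'_def space_density by (subst emeasure_density) (auto intro!: nn_integral_cong simp: indicator_def)
  also have "\<dots> = ennreal (\<integral>\<omega>. W \<omega> / \<kappa> \<partial>M)"
    using W(1) nn by (intro nn_integral_eq_integral) auto
  also have "\<dots> = 1" using tot \<open>\<kappa> > 0\<close> by simp
  finally have "prob_space M'" by (rule prob_spaceI)
  then interpret M': prob_space M' .
  have ZM': "Z \<in> measurable M' borel" by (simp add: M'_def)
  have D: "real_distribution D" unfolding D_def by (rule M'.real_distribution_distr) (use ZM' in simp)
  have "char D = char std_normal_distribution"
  proof
    fix t
    have "char D t = (\<integral>\<omega>. iexp (t * Z \<omega>) \<partial>M')"
      unfolding char_def D_def by (rule integral_distr) (use ZM' in auto)
    also have "\<dots> = (\<integral>\<omega>. (W \<omega> / \<kappa>) *\<^sub>R iexp (t * Z \<omega>) \<partial>M)"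
      unfolding M'_def by (rule integral_density) (use nn in auto)
    also have "\<dots> = (\<integral>\<omega>. (1 / \<kappa>) *\<^sub>R (W \<omega> *\<^sub>R iexp (t * Z \<omega>)) \<partial>M)"
      by simp
    also have "\<dots> = (1 / \<kappa>) *\<^sub>R of_real (\<kappa> * exp (- t\<^sup>2 / 2))"
      by (subst integral_scaleR_right) (simp only: char)
    also have "\<dots> = char std_normal_distribution t"
      using \<open>\<kappa> > 0\<close> by (simp add: char_std_normal_distribution scaleR_conv_of_real)
    finally show "char D t = char std_normal_distribution t" .
  qed
  hence "D = std_normal_distribution" by (rule Levy_uniqueness [OF D real_dist_normal_dist])
  hence "measure std_normal_distribution B = measure D B" by simp
  also have "\<dots> = (\<integral>x. indicator B x \<partial>D)" by (simp add: D_def)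
  also have "\<dots> = (\<integral>\<omega>. indicator B (Z \<omega>) \<partial>M')"
    unfolding D_def by (rule integral_distr) (use ZM' in auto)
  also have "\<dots> = (\<integral>\<omega>. (W \<omega> / \<kappa>) *\<^sub>R indicator B (Z \<omega>) \<partial>M)"
    unfolding M'_def by (rule integral_density) (use nn in auto)
  also have "\<dots> = (1 / \<kappa>) * (\<integral>\<omega>. W \<omega> * indicator B (Z \<omega>) \<partial>M)"
    by (subst integral_mult_right_zero [symmetric]) (simp add: mult_ac)
  finally show ?thesis using \<open>\<kappa> > 0\<close> by simp
qed

text \<open>
  Independence is read off the joint characteristic function by applying one-dimensional
  uniqueness to the measures weighted by \<open>1 + cos (s X)\<close> and \<open>1 + sin (s X)\<close>, and then to the
  measure weighted by the indicator of \<open>Z \<in> B\<close>.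
\<close>

lemma (in prob_space) joint_std_normal:
  fixes X Z :: "'a \<Rightarrow> real"
  assumes [measurable]: "random_variable borel X" "random_variable borel Z"
    and char: "\<And>s t. (\<integral>\<omega>. iexp (s * X \<omega> + t * Z \<omega>) \<partial>M) = of_real (exp (- s\<^sup>2 / 2) * exp (- t\<^sup>2 / 2))"
  shows "distr M (borel \<Otimes>\<^sub>M borel) (\<lambda>\<omega>. (X \<omega>, Z \<omega>)) = std_normal_distribution \<Otimes>\<^sub>M std_normal_distribution"
proof -
  let ?N = "std_normal_distribution"
  interpret N: prob_space ?N by (rule prob_std_normal)
  define \<phi> :: "real \<Rightarrow> real" where "\<phi> s = exp (- s\<^sup>2 / 2)" for s
  have int: "integrable M (\<lambda>\<omega>. iexp (s * X \<omega> + t * Z \<omega>))" for s t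
    by (intro integrable_iexp) auto
  have charZ: "(\<integral>\<omega>. iexp (t * Z \<omega>) \<partial>M) = of_real (\<phi> t)" for t
    using char [of 0 t] by (simp add: \<phi>_def)
  have Z: "(\<integral>\<omega>. indicator B (Z \<omega>) \<partial>M) = measure ?N B" if "B \<in> sets borel" for B
  proof -
    have "(\<integral>\<omega>. 1 * indicator B (Z \<omega>) \<partial>M) = 1 * measure ?N B"
      by (rule weighted_char_std_normal) (use charZ that in \<open>auto simp: \<phi>_def scaleR_conv_of_real\<close>)
    thus ?thesis by simp
  qed
  have ind: "integrable M (\<lambda>\<omega>. g (X \<omega>) * indicat_real B (Z \<omega>))"
    if [measurable]: "B \<in> sets borel" "g \<in> borel_measurable borel" and "\<And>x. \<bar>g x\<bar> \<le> 1" for B g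
    by (rule integrable_const_bound [where B = 1]) (use that(3) in \<open>auto simp: indicator_def\<close>)
  have weighted: "(\<integral>\<omega>. g (X \<omega>) * indicat_real B (Z \<omega>) \<partial>M) = \<kappa> * measure ?N B"
    if B [measurable]: "B \<in> sets borel" and g [measurable]: "g \<in> borel_measurable borel"
      and g1: "\<And>x. \<bar>g x\<bar> \<le> 1" and "- 1 < \<kappa>"
      and ch: "\<And>t. (\<integral>\<omega>. g (X \<omega>) *\<^sub>R iexp (t * Z \<omega>) \<partial>M) = of_real (\<kappa> * \<phi> t)" for B g \<kappa>
  proof -
    have "(\<integral>\<omega>. (1 + g (X \<omega>)) * indicat_real B (Z \<omega>) \<partial>M) = (1 + \<kappa>) * measure ?N B"
    proof (rule weighted_char_std_normal)
      have "norm (1 + g x) \<le> 2" for x using g1 [of x] by (simp add: abs_le_iff)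
      thus "integrable M (\<lambda>\<omega>. 1 + g (X \<omega>))"
        by (intro integrable_const_bound [where B = 2]) auto
      show "0 \<le> 1 + g (X \<omega>)" for \<omega> using g1 [of "X \<omega>"] by (simp add: abs_le_iff)
      fix t
      have "integrable M (\<lambda>\<omega>. g (X \<omega>) *\<^sub>R iexp (t * Z \<omega>))"
        by (rule integrable_const_bound [where B = 1]) (use g1 in auto)
      moreover have "integrable M (\<lambda>\<omega>. iexp (t * Z \<omega>))" by (intro integrable_iexp) auto
      ultimately have "(\<integral>\<omega>. (1 + g (X \<omega>)) *\<^sub>R iexp (t * Z \<omega>) \<partial>M) = of_real (\<phi> t) + of_real (\<kappa> * \<phi> t)"
        by (simp only: scaleR_add_left scaleR_one Bochner_Integration.integral_add charZ ch)
      thus "(\<integral>\<omega>. (1 + g (X \<omega>)) *\<^sub>R iexp (t * Z \<omega>) \<partial>M) = of_real ((1 + \<kappa>) * exp (- t\<^sup>2 / 2))"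
        by (simp add: \<phi>_def algebra_simps)
    qed (use that(4) in auto)
    moreover have "(\<integral>\<omega>. (1 + g (X \<omega>)) * indicat_real B (Z \<omega>) \<partial>M) =
       (\<integral>\<omega>. 1 * indicator B (Z \<omega>) \<partial>M) + (\<integral>\<omega>. g (X \<omega>) * indicator B (Z \<omega>) \<partial>M)"
      unfolding distrib_right using ind [OF B g g1] ind [OF B, of "\<lambda>_. 1"]
      by (intro Bochner_Integration.integral_add) auto
    ultimately show ?thesis using Z [OF B] by (simp add: algebra_simps)
  qed
  have c1: "(\<integral>\<omega>. cos (s * X \<omega>) * indicat_real B (Z \<omega>) \<partial>M) = \<phi> s * measure ?N B"
    if B: "B \<in> sets borel" for s B
  proof (rule weighted [OF B])
    fix t
    have "cos (s * X \<omega>) *\<^sub>R iexp (t * Z \<omega>) =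
      (1 / 2) *\<^sub>R (iexp (s * X \<omega> + t * Z \<omega>) + iexp ((- s) * X \<omega> + t * Z \<omega>))" for \<omega>
      by (simp add: complex_eq_iff Re_exp Im_exp cos_add sin_add cos_diff sin_diff field_simps)
    thus "(\<integral>\<omega>. cos (s * X \<omega>) *\<^sub>R iexp (t * Z \<omega>) \<partial>M) = of_real (\<phi> s * \<phi> t)"
      by (simp only: integral_scaleR_right Bochner_Integration.integral_add int char)
         (simp add: \<phi>_def scaleR_conv_of_real)
  qed (auto simp: \<phi>_def intro: less_trans [of _ 0])
  have s1: "(\<integral>\<omega>. sin (s * X \<omega>) * indicat_real B (Z \<omega>) \<partial>M) = 0 * measure ?N B"
    if B: "B \<in> sets borel" for s B
  proof (rule weighted [OF B])
    fix t
    have "sin (s * X \<omega>) *\<^sub>R iexp (t * Z \<omega>) =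
      (- \<i> / 2) * (iexp (s * X \<omega> + t * Z \<omega>) - iexp ((- s) * X \<omega> + t * Z \<omega>))" for \<omega>
      by (simp add: complex_eq_iff Re_exp Im_exp cos_add sin_add cos_diff sin_diff field_simps)
    thus "(\<integral>\<omega>. sin (s * X \<omega>) *\<^sub>R iexp (t * Z \<omega>) \<partial>M) = of_real (0 * \<phi> t)"
      by (simp only: integral_mult_right_zero Bochner_Integration.integral_diff int char) simp
  qed auto
  have AB: "(\<integral>\<omega>. indicator B (Z \<omega>) * indicator A (X \<omega>) \<partial>M) = measure ?N B * measure ?N A"
    if A [measurable]: "A \<in> sets borel" and B [measurable]: "B \<in> sets borel" for A B
  \<comment> \<open>Weighting by the indicator of \<open>Z \<in> B\<close> needs positive mass for
    the normalization. If the mass is zero, the left-hand side is squeezed to 0.\<close>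
  proof (cases "measure ?N B = 0")
    case True
    have "0 = (\<integral>\<omega>. indicat_real B (Z \<omega>) \<partial>M)" using Z [OF B] True by simp
    moreover have "(\<integral>\<omega>. indicat_real B (Z \<omega>) * indicat_real A (X \<omega>) \<partial>M) \<le> (\<integral>\<omega>. indicat_real B (Z \<omega>) \<partial>M)"
      by (intro integral_mono integrable_const_bound [where B = 1]) (auto simp: indicator_def)
    moreover have "0 \<le> (\<integral>\<omega>. indicat_real B (Z \<omega>) * indicat_real A (X \<omega>) \<partial>M)"
      by (intro integral_nonneg_AE AE_I2) (auto simp: indicator_def)
    ultimately show ?thesis using True by simp
  next
    case False
    hence pos: "measure ?N B > 0" by (simp add: zero_less_measure_iff)
    show ?thesis
    proof (rule weighted_char_std_normal [OF _ _ _ _ pos])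
      show "integrable M (\<lambda>\<omega>. indicat_real B (Z \<omega>))"
        by (rule integrable_const_bound [where B = 1]) (auto simp: indicator_def)
      fix s
      have i: "integrable M (\<lambda>\<omega>. cos (s * X \<omega>) * indicator B (Z \<omega>))" "integrable M (\<lambda>\<omega>. sin (s * X \<omega>) * indicator B (Z \<omega>))"
        by (intro ind; simp)+
      have "indicator B (Z \<omega>) *\<^sub>R iexp (s * X \<omega>) = of_real (cos (s * X \<omega>) * indicator B (Z \<omega>)) + \<i> * of_real (sin (s * X \<omega>) * indicator B (Z \<omega>))" for \<omega>
        by (simp add: complex_eq_iff Re_exp Im_exp algebra_simps)
      hence "(\<integral>\<omega>. indicator B (Z \<omega>) *\<^sub>R iexp (s * X \<omega>) \<partial>M) =
        (\<integral>\<omega>. complex_of_real (cos (s * X \<omega>) * indicator B (Z \<omega>)) + \<i> * complex_of_real (sin (s * X \<omega>) * indicator B (Z \<omega>)) \<partial>M)"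
        by simp
      also have "\<dots> = of_real (\<integral>\<omega>. cos (s * X \<omega>) * indicator B (Z \<omega>) \<partial>M) + \<i> * of_real (\<integral>\<omega>. sin (s * X \<omega>) * indicator B (Z \<omega>) \<partial>M)"
        by (subst Bochner_Integration.integral_add)
           (use i in \<open>auto simp del: of_real_mult simp: integral_complex_of_real complex_of_real_integrable_eq\<close>)
      also have "\<dots> = of_real (measure ?N B * exp (- s\<^sup>2 / 2))"
        by (simp add: c1 s1 \<phi>_def)
      finally show "(\<integral>\<omega>. indicator B (Z \<omega>) *\<^sub>R iexp (s * X \<omega>) \<partial>M) = of_real (measure ?N B * exp (- s\<^sup>2 / 2))" .
    qed auto
  qed
  show ?thesis
  proof (rule pair_measure_eqI [symmetric])
    show "sigma_finite_measure ?N" "sigma_finite_measure ?N" by unfold_locales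
    show "sets (?N \<Otimes>\<^sub>M ?N) = sets (distr M (borel \<Otimes>\<^sub>M borel) (\<lambda>\<omega>. (X \<omega>, Z \<omega>)))"
      by (simp cong: sets_pair_measure_cong)
    fix A B assume "A \<in> sets ?N" "B \<in> sets ?N"
    hence [measurable]: "A \<in> sets borel" "B \<in> sets borel" by auto
    have "emeasure (distr M (borel \<Otimes>\<^sub>M borel) (\<lambda>\<omega>. (X \<omega>, Z \<omega>))) (A \<times> B) =
      emeasure M ((\<lambda>\<omega>. (X \<omega>, Z \<omega>)) -` (A \<times> B) \<inter> space M)"
      by (rule emeasure_distr) auto
    also have "(\<lambda>\<omega>. (X \<omega>, Z \<omega>)) -` (A \<times> B) \<inter> space M = {\<omega> \<in> space M. Z \<omega> \<in> B \<and> X \<omega> \<in> A}"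
      by auto
    also have "emeasure M \<dots> = ennreal (measure M {\<omega> \<in> space M. Z \<omega> \<in> B \<and> X \<omega> \<in> A})"
      by (rule emeasure_eq_measure)
    also have "measure M {\<omega> \<in> space M. Z \<omega> \<in> B \<and> X \<omega> \<in> A} = (\<integral>\<omega>. indicator {\<omega> \<in> space M. Z \<omega> \<in> B \<and> X \<omega> \<in> A} \<omega> \<partial>M)"
      by simp
    also have "\<dots> = (\<integral>\<omega>. indicator B (Z \<omega>) * indicator A (X \<omega>) \<partial>M)"
      by (intro Bochner_Integration.integral_cong refl) (auto simp: indicator_def)
    also have "\<dots> = measure ?N B * measure ?N A" by (rule AB) measurable
    also have "ennreal \<dots> = emeasure ?N A * emeasure ?N B"
      by (simp add: N.emeasure_eq_measure ennreal_mult mult.commute)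
    finally show "emeasure ?N A * emeasure ?N B = emeasure (distr M (borel \<Otimes>\<^sub>M borel) (\<lambda>\<omega>. (X \<omega>, Z \<omega>))) (A \<times> B)" ..
  qed
qed

text \<open>The density at \<open>u\<close> of the quotient of two independent standard normal
  variables, which is the Cauchy density.\<close>

lemma nn_integral_std_normal_ratio:
  "(\<integral>\<^sup>+x. ennreal (\<bar>x\<bar> * std_normal_density x * std_normal_density (x * u)) \<partial>lborel) = ennreal (1 / (pi * (1 + u\<^sup>2)))"
proof -
  define k where "k = 1 + u\<^sup>2"
  have k: "k > 0" by (simp add: k_def add_pos_nonneg)
  define h where "h = (\<lambda>x. \<bar>x\<bar> / (2 * pi) * exp (- k * x\<^sup>2 / 2))"
  have [measurable]: "h \<in> borel_measurable borel" unfolding h_def by measurable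
  have hh: "\<bar>x\<bar> * std_normal_density x * std_normal_density (x * u) = h x" for x
    by (simp add: std_normal_density_def h_def k_def power_mult_distrib algebra_simps add_divide_distrib flip: exp_add)
  define H where "H = (\<lambda>x::real. - 1 / (2 * pi * k) * exp (- k * x\<^sup>2 / 2))"
  have half: "(\<integral>\<^sup>+x. ennreal (h x) * indicator {0..} x \<partial>lborel) = ennreal (1 / (2 * pi * k))"
  proof -
    have "(\<integral>\<^sup>+x. ennreal (h x) * indicator {0..} x \<partial>lborel) = ennreal (0 - H 0)"
    proof (rule nn_integral_FTC_atLeast)
      fix x :: real assume x: "0 \<le> x"
      show "(H has_real_derivative h x) (at x)"
        unfolding H_def h_def using x k by (auto intro!: derivative_eq_intros simp: field_simps)
      show "0 \<le> h x" by (simp add: h_def)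
    next
      show "(H \<longlongrightarrow> 0) at_top" unfolding H_def using k by real_asymp
    qed auto
    thus ?thesis by (simp add: H_def)
  qed
  have "(\<integral>\<^sup>+x. ennreal (h x) * indicator {..0} x \<partial>lborel) = ennreal \<bar>-1\<bar> * (\<integral>\<^sup>+x. ennreal (h (0 + -1 * x)) * indicator {..0} (0 + -1 * x) \<partial>lborel)"
    by (rule nn_integral_real_affine) auto
  also have "\<dots> = (\<integral>\<^sup>+x. ennreal (h x) * indicator {0..} x \<partial>lborel)"
    by (auto intro!: nn_integral_cong simp: h_def indicator_def)
  finally have half': "(\<integral>\<^sup>+x. ennreal (h x) * indicator {..0} x \<partial>lborel) = ennreal (1 / (2 * pi * k))"
    using half by simp
  have "(\<integral>\<^sup>+x. ennreal (h x) \<partial>lborel) = (\<integral>\<^sup>+x. ennreal (h x) * indicator {0..} x + ennreal (h x) * indicator {..0} x \<partial>lborel)"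
    by (intro nn_integral_cong) (auto simp: indicator_def h_def)
  also have "\<dots> = ennreal (1 / (2 * pi * k)) + ennreal (1 / (2 * pi * k))"
    by (subst nn_integral_add) (auto simp: half half')
  also have "\<dots> = ennreal (1 / (pi * k))"
    using k by (subst ennreal_plus [symmetric]) (auto simp: field_simps)
  finally show ?thesis by (simp add: hh k_def)
qed

text \<open>With z = x u the condition becomes x^2 (u + a) > 0, so it concerns the quotient only and
  says u > -a. The probability is a tail of the Cauchy law.\<close>

lemma std_normal_wedge:
  "emeasure (std_normal_distribution \<Otimes>\<^sub>M std_normal_distribution) {p. fst p * (snd p + a * fst p) > 0} =
    ennreal (1 / 2 + arctan a / pi)"
proof -
  let ?N = "std_normal_distribution"
  let ?f = std_normal_density
  interpret N: prob_space ?N by (rule prob_std_normal)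
  have ae0: "AE x in lborel. x \<noteq> (0::real)" by (rule AE_lborel_singleton)
  define S where "S = {p::real\<times>real. fst p * (snd p + a * fst p) > 0}"
  have [measurable]: "S \<in> sets (borel \<Otimes>\<^sub>M borel)"
  proof -
    have "{p \<in> space (borel \<Otimes>\<^sub>M borel). fst p * (snd p + a * fst p) > (0::real)} \<in> sets (borel \<Otimes>\<^sub>M borel)"
      by measurable
    thus ?thesis by (simp add: S_def space_pair_measure)
  qed
  have "emeasure (?N \<Otimes>\<^sub>M ?N) S = (\<integral>\<^sup>+x. \<integral>\<^sup>+z. indicator S (x, z) \<partial>?N \<partial>?N)"
    by (rule N.emeasure_pair_measure) (simp cong: sets_pair_measure_cong)
  also have "\<dots> = (\<integral>\<^sup>+x. ennreal (?f x) * (\<integral>\<^sup>+z. ennreal (?f z) * indicator S (x, z) \<partial>lborel) \<partial>lborel)"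
    by (subst nn_integral_density; (simp | measurable)?)
       (intro nn_integral_cong arg_cong2 [where f = "(*)"] refl nn_integral_density; measurable)
  also have "\<dots> = (\<integral>\<^sup>+x. \<integral>\<^sup>+u. ennreal (\<bar>x\<bar> * ?f x * ?f (x * u)) * indicator {- a<..} u \<partial>lborel \<partial>lborel)"
  proof (rule nn_integral_cong_AE)
    show "AE x in lborel. ennreal (?f x) * (\<integral>\<^sup>+z. ennreal (?f z) * indicator S (x, z) \<partial>lborel) =
      (\<integral>\<^sup>+u. ennreal (\<bar>x\<bar> * ?f x * ?f (x * u)) * indicator {- a<..} u \<partial>lborel)"
      using ae0
    proof eventually_elim
      case x: (elim x)
      have "(\<integral>\<^sup>+z. ennreal (?f z) * indicator S (x, z) \<partial>lborel) =
         ennreal \<bar>x\<bar> * (\<integral>\<^sup>+u. ennreal (?f (0 + x * u)) * indicator S (x, 0 + x * u) \<partial>lborel)"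
        using x by (intro nn_integral_real_affine) measurable
      also have "\<dots> = ennreal \<bar>x\<bar> * (\<integral>\<^sup>+u. ennreal (?f (x * u)) * indicator {- a<..} u \<partial>lborel)"
      proof (rule arg_cong2 [where f = "(*)", OF refl], rule nn_integral_cong)
        fix u
        have "x * (0 + x * u + a * x) = x\<^sup>2 * (u + a)" by (simp add: power2_eq_square algebra_simps)
        hence "(x, 0 + x * u) \<in> S \<longleftrightarrow> 0 < x\<^sup>2 * (u + a)" by (simp add: S_def)
        also have "\<dots> \<longleftrightarrow> u \<in> {- a<..}" using x by (auto simp: zero_less_mult_iff)
        finally have "(x, 0 + x * u) \<in> S \<longleftrightarrow> u \<in> {- a<..}" .
        thus "ennreal (?f (0 + x * u)) * indicator S (x, 0 + x * u) = ennreal (?f (x * u)) * indicator {- a<..} u"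
          by (simp add: indicator_def)
      qed
      finally have "ennreal (?f x) * (\<integral>\<^sup>+z. ennreal (?f z) * indicator S (x, z) \<partial>lborel) =
        ennreal (\<bar>x\<bar> * ?f x) * (\<integral>\<^sup>+u. ennreal (?f (x * u)) * indicator {- a<..} u \<partial>lborel)"
        by (simp add: ennreal_mult mult_ac)
      also have "\<dots> = (\<integral>\<^sup>+u. ennreal (\<bar>x\<bar> * ?f x) * (ennreal (?f (x * u)) * indicator {- a<..} u) \<partial>lborel)"
        by (rule nn_integral_cmult [symmetric]) measurable
      also have "\<dots> = (\<integral>\<^sup>+u. ennreal (\<bar>x\<bar> * ?f x * ?f (x * u)) * indicator {- a<..} u \<partial>lborel)"
        by (intro nn_integral_cong) (simp add: ennreal_mult mult_ac)
      finally show "ennreal (?f x) * (\<integral>\<^sup>+z. ennreal (?f z) * indicator S (x, z) \<partial>lborel) =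
        (\<integral>\<^sup>+u. ennreal (\<bar>x\<bar> * ?f x * ?f (x * u)) * indicator {- a<..} u \<partial>lborel)" .
    qed
  qed
  also have "\<dots> = (\<integral>\<^sup>+u. \<integral>\<^sup>+x. ennreal (\<bar>x\<bar> * ?f x * ?f (x * u)) * indicator {- a<..} u \<partial>lborel \<partial>lborel)"
    by (rule lborel_pair.Fubini' [symmetric]) measurable
  also have "\<dots> = (\<integral>\<^sup>+u. ennreal (1 / (pi * (1 + u\<^sup>2))) * indicator {- a<..} u \<partial>lborel)"
    by (intro nn_integral_cong) (simp add: nn_integral_multc nn_integral_std_normal_ratio)
  also have "\<dots> = (\<integral>\<^sup>+u. ennreal (1 / (pi * (1 + u\<^sup>2))) * indicator {- a..} u \<partial>lborel)"
    by (intro nn_integral_cong_AE, use AE_lborel_singleton [of "- a"] in eventually_elim) (auto simp: indicator_def)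
  also have "\<dots> = ennreal (1 / 2 - arctan (- a) / pi)"
  proof (rule nn_integral_FTC_atLeast [where F = "\<lambda>u. arctan u / pi"])
    fix u :: real
    show "((\<lambda>u. arctan u / pi) has_real_derivative 1 / (pi * (1 + u\<^sup>2))) (at u)"
      using DERIV_cdivide [OF DERIV_arctan [of u], of pi] by (simp add: divide_inverse mult.commute)
    show "0 \<le> 1 / (pi * (1 + u\<^sup>2))" by simp
  next
    have "((\<lambda>u. arctan u / pi) \<longlongrightarrow> (pi / 2) / pi) at_top"
      by (intro tendsto_divide tendsto_arctan_at_top tendsto_const) auto
    thus "((\<lambda>u. arctan u / pi) \<longlongrightarrow> 1 / 2) at_top" by simp
  qed measurable
  finally show ?thesis by (simp add: S_def arctan_minus)
qed

section \<open>Gaussian pairs and the expected product of their signs\<close>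

lemma (in prob_space) gaussian_rv_centered:
  assumes "gaussian_rv M W" "expectation W = 0" "expectation (\<lambda>\<omega>. W \<omega> * W \<omega>) = v" "v > 0"
  shows "distributed M lborel W (\<lambda>x. ennreal (normal_density 0 (sqrt v) x))"
proof -
  have [measurable]: "W \<in> borel_measurable M" using assms(1) by (simp add: gaussian_rv_def)
  \<comment> \<open>A constant with mean zero has second moment zero, so \<open>v > 0\<close> rules
    out the degenerate alternative in \<open>gaussian_rv\<close>.\<close>
  have "\<not> (\<exists>m. AE \<omega> in M. W \<omega> = m)"
  proof
    assume "\<exists>m. AE \<omega> in M. W \<omega> = m"
    then obtain m where m: "AE \<omega> in M. W \<omega> = m" by blast
    have "expectation W = expectation (\<lambda>_. m)" by (rule integral_cong_AE) (use m in auto)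
    hence "m = 0" using assms(2) by (simp add: prob_space)
    have "expectation (\<lambda>\<omega>. W \<omega> * W \<omega>) = expectation (\<lambda>_. m * m)" by (rule integral_cong_AE) (use m in auto)
    with \<open>m = 0\<close> assms(3,4) show False by simp
  qed
  then obtain m \<sigma> where s: "\<sigma> > 0" and D: "distributed M lborel W (\<lambda>x. ennreal (normal_density m \<sigma> x))"
    using assms(1) unfolding gaussian_rv_def by blast
  have "m = 0" using normal_distributed_expectation [OF s D] assms(2) by simp
  moreover have "\<sigma>\<^sup>2 = v" using normal_distributed_variance [OF s D] assms(2,3) by (simp add: power2_eq_square)
  hence "\<sigma> = sqrt v" using s by (metis abs_of_pos real_sqrt_abs)
  ultimately show ?thesis using D by simp
qed

lemma (in prob_space) char_centered_normal:
  assumes "distributed M lborel W (\<lambda>x. ennreal (normal_density 0 \<sigma> x))" "\<sigma> > 0"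
  shows "expectation (\<lambda>\<omega>. iexp (W \<omega>)) = of_real (exp (- \<sigma>\<^sup>2 / 2))"
proof -
  have D: "distributed M lborel (\<lambda>\<omega>. W \<omega> / \<sigma>) std_normal_density"
    using normal_standard_normal_convert [OF assms(2), of W 0] assms(1) by simp
  hence [measurable]: "(\<lambda>\<omega>. W \<omega> / \<sigma>) \<in> borel_measurable M" using distributed_measurable by force
  have "expectation (\<lambda>\<omega>. iexp (W \<omega>)) = expectation (\<lambda>\<omega>. iexp (\<sigma> * (W \<omega> / \<sigma>)))"
    using assms(2) by simp
  also have "\<dots> = (\<integral>x. iexp (\<sigma> * x) \<partial>(distr M lborel (\<lambda>\<omega>. W \<omega> / \<sigma>)))"
    by (subst integral_distr) auto
  also have "distr M lborel (\<lambda>\<omega>. W \<omega> / \<sigma>) = std_normal_distribution"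
    using D by (simp add: distributed_distr_eq_density)
  also have "(\<integral>x. iexp (\<sigma> * x) \<partial>std_normal_distribution) = char std_normal_distribution \<sigma>"
    by (simp add: char_def)
  also have "\<dots> = of_real (exp (- \<sigma>\<^sup>2 / 2))" by (simp add: char_std_normal_distribution)
  finally show ?thesis .
qed

lemma (in prob_space) AE_centered_normal_neq_0:
  assumes "distributed M lborel W (\<lambda>x. ennreal (normal_density 0 \<sigma> x))"
  shows "AE \<omega> in M. W \<omega> \<noteq> 0"
proof -
  have "AE x in distr M lborel W. x \<noteq> 0"
    unfolding distributed_distr_eq_density [OF assms]
  proof (subst AE_density)
    show "AE x in lborel. 0 < ennreal (normal_density 0 \<sigma> x) \<longrightarrow> x \<noteq> 0"
      using AE_lborel_singleton [of "0::real"] by eventually_elim blast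
  qed measurable
  thus ?thesis by (rule AE_distrD [OF distributed_measurable [OF assms]])
qed

text \<open>Sheppard's formula. Writing Y = \<rho> X + c Z with \<open>Z\<close> a standard normal
  variable independent of \<open>X\<close>, equality of the signs is a wedge event for the pair of
  \<open>X\<close> and \<open>Z\<close>, with slope the tangent of
  \<open>arcsin \<rho>\<close>.\<close>

theorem (in prob_space) expectation_sgn_gaussian:
  assumes gauss: "\<And>a b. gaussian_rv M (\<lambda>\<omega>. a * X \<omega> + b * Y \<omega>)"
    and E: "expectation X = 0" "expectation Y = 0"
    and V: "expectation (\<lambda>\<omega>. X \<omega> * X \<omega>) = 1" "expectation (\<lambda>\<omega>. Y \<omega> * Y \<omega>) = 1"
    and C: "expectation (\<lambda>\<omega>. X \<omega> * Y \<omega>) = \<rho>"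
  shows "\<bar>\<rho>\<bar> \<le> 1" "expectation (\<lambda>\<omega>. sgn (X \<omega>) * sgn (Y \<omega>)) = 2 / pi * arcsin \<rho>"
proof -
  have gX: "gaussian_rv M X" and gY: "gaussian_rv M Y"
    using gauss [of 1 0] gauss [of 0 1] by simp_all
  have [measurable]: "X \<in> borel_measurable M" "Y \<in> borel_measurable M"
    using gX gY by (simp_all add: gaussian_rv_def)
  \<comment> \<open>A function that is not integrable has integral 0 by convention, so the value 1
    forces integrability.\<close>
  have iXX: "integrable M (\<lambda>\<omega>. X \<omega> * X \<omega>)" and iYY: "integrable M (\<lambda>\<omega>. Y \<omega> * Y \<omega>)"
    using not_integrable_integral_eq [of M "\<lambda>\<omega>. X \<omega> * X \<omega>"] not_integrable_integral_eq [of M "\<lambda>\<omega>. Y \<omega> * Y \<omega>"] V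
    by auto
  have iX: "integrable M X" and iY: "integrable M Y"
  proof -
    show "integrable M X"
      by (rule square_integrable_imp_integrable) (use iXX in \<open>simp_all add: power2_eq_square\<close>)
    show "integrable M Y"
      by (rule square_integrable_imp_integrable) (use iYY in \<open>simp_all add: power2_eq_square\<close>)
  qed
  have iXY: "integrable M (\<lambda>\<omega>. X \<omega> * Y \<omega>)"
  proof (rule Bochner_Integration.integrable_bound)
    show "integrable M (\<lambda>\<omega>. X \<omega> * X \<omega> + Y \<omega> * Y \<omega>)" using iXX iYY by simp
    show "AE \<omega> in M. norm (X \<omega> * Y \<omega>) \<le> norm (X \<omega> * X \<omega> + Y \<omega> * Y \<omega>)"
    proof (intro AE_I2)
      fix \<omega>
      have "2 * \<bar>X \<omega> * Y \<omega>\<bar> \<le> X \<omega> * X \<omega> + Y \<omega> * Y \<omega>"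
        using sum_squares_ge_zero [of "\<bar>X \<omega>\<bar> - \<bar>Y \<omega>\<bar>" 0] by (simp add: abs_mult algebra_simps)
      moreover have "0 \<le> X \<omega> * X \<omega> + Y \<omega> * Y \<omega>" by simp
      ultimately show "norm (X \<omega> * Y \<omega>) \<le> norm (X \<omega> * X \<omega> + Y \<omega> * Y \<omega>)"
        unfolding real_norm_def by linarith
    qed
  qed measurable
  have EW: "expectation (\<lambda>\<omega>. a * X \<omega> + b * Y \<omega>) = 0" for a b
    using iX iY E by simp
  have EW2: "expectation (\<lambda>\<omega>. (a * X \<omega> + b * Y \<omega>) * (a * X \<omega> + b * Y \<omega>)) = a\<^sup>2 + b\<^sup>2 + 2 * a * b * \<rho>" for a b
  proof -
    have "expectation (\<lambda>\<omega>. (a * X \<omega> + b * Y \<omega>) * (a * X \<omega> + b * Y \<omega>)) =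
      expectation (\<lambda>\<omega>. a\<^sup>2 * (X \<omega> * X \<omega>) + (b\<^sup>2 * (Y \<omega> * Y \<omega>) + 2 * a * b * (X \<omega> * Y \<omega>)))"
      by (intro Bochner_Integration.integral_cong refl) (simp add: power2_eq_square algebra_simps)
    also have "\<dots> = a\<^sup>2 + (b\<^sup>2 + 2 * a * b * \<rho>)"
      using iXX iYY iXY V C by simp
    finally show ?thesis by simp
  qed
  have X0: "AE \<omega> in M. X \<omega> \<noteq> 0"
    using gaussian_rv_centered [OF gX E(1) V(1)] by (intro AE_centered_normal_neq_0) auto
  have Y0: "AE \<omega> in M. Y \<omega> \<noteq> 0"
    using gaussian_rv_centered [OF gY E(2) V(2)] by (intro AE_centered_normal_neq_0) auto
  have diff: "expectation (\<lambda>\<omega>. ((- \<rho>) * X \<omega> + 1 * Y \<omega>) * ((- \<rho>) * X \<omega> + 1 * Y \<omega>)) = 1 - \<rho>\<^sup>2"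
    unfolding EW2 by (simp add: power2_eq_square)
  have "0 \<le> expectation (\<lambda>\<omega>. ((- \<rho>) * X \<omega> + 1 * Y \<omega>) * ((- \<rho>) * X \<omega> + 1 * Y \<omega>))"
    by (intro integral_nonneg_AE AE_I2 zero_le_square)
  hence "\<rho>\<^sup>2 \<le> 1" unfolding diff by simp
  thus le1: "\<bar>\<rho>\<bar> \<le> 1" by (simp add: abs_square_le_1)
  show "expectation (\<lambda>\<omega>. sgn (X \<omega>) * sgn (Y \<omega>)) = 2 / pi * arcsin \<rho>"
  \<comment> \<open>In this case \<open>c\<close> would be 0. The difference Y - \<rho> X then has
    vanishing second moment, so \<open>Y\<close> is almost surely \<open>X\<close> or its
    negative.\<close>
  proof (cases "\<bar>\<rho>\<bar> = 1")
    case True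
    hence "\<rho>\<^sup>2 = 1" by (metis power2_abs power_one)
    have "AE \<omega> in M. ((- \<rho>) * X \<omega> + 1 * Y \<omega>) * ((- \<rho>) * X \<omega> + 1 * Y \<omega>) = 0"
    proof (subst integral_nonneg_eq_0_iff_AE [symmetric])
      have "integrable M (\<lambda>\<omega>. \<rho>\<^sup>2 * (X \<omega> * X \<omega>) + (Y \<omega> * Y \<omega> - 2 * \<rho> * (X \<omega> * Y \<omega>)))"
        using iXX iYY iXY by simp
      thus "integrable M (\<lambda>\<omega>. ((- \<rho>) * X \<omega> + 1 * Y \<omega>) * ((- \<rho>) * X \<omega> + 1 * Y \<omega>))"
        by (simp add: power2_eq_square algebra_simps)
    qed (use diff \<open>\<rho>\<^sup>2 = 1\<close> in \<open>auto intro!: AE_I2\<close>)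
    hence "AE \<omega> in M. sgn (X \<omega>) * sgn (Y \<omega>) = \<rho>"
      using X0
    proof eventually_elim
      case (elim \<omega>)
      hence "Y \<omega> = \<rho> * X \<omega>" by simp
      moreover have "sgn \<rho> = \<rho>" using True by (auto simp: sgn_if abs_if split: if_splits)
      moreover have "sgn (X \<omega>) * sgn (X \<omega>) = 1" using elim by (simp add: sgn_if)
      moreover have "sgn (X \<omega>) * (r * sgn (X \<omega>)) = (sgn (X \<omega>) * sgn (X \<omega>)) * r" for r by simp
      ultimately show ?case by (simp only: sgn_mult mult_1)
    qed
    hence "expectation (\<lambda>\<omega>. sgn (X \<omega>) * sgn (Y \<omega>)) = expectation (\<lambda>_. \<rho>)"
      by (intro integral_cong_AE) auto
    also have "\<dots> = \<rho>" by (simp add: prob_space)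
    also have "\<rho> = 2 / pi * arcsin \<rho>" using True by (auto simp: abs_if split: if_splits)
    finally show ?thesis .
  next
    case False
    hence lt: "\<bar>\<rho>\<bar> < 1" using le1 by simp
    hence "\<rho>\<^sup>2 < 1" by (simp add: abs_square_less_1)
    define c where "c = sqrt (1 - \<rho>\<^sup>2)"
    have c: "c > 0" "c\<^sup>2 = 1 - \<rho>\<^sup>2" using \<open>\<rho>\<^sup>2 < 1\<close> by (auto simp: c_def)
    define a where "a = \<rho> / c"
    define Z where "Z = (\<lambda>\<omega>. (- \<rho> / c) * X \<omega> + (1 / c) * Y \<omega>)"
    have [measurable]: "Z \<in> borel_measurable M" unfolding Z_def by measurable
    have joint: "distr M (borel \<Otimes>\<^sub>M borel) (\<lambda>\<omega>. (X \<omega>, Z \<omega>)) = std_normal_distribution \<Otimes>\<^sub>M std_normal_distribution"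
    proof (rule joint_std_normal)
      fix s t :: real
      \<comment> \<open>The coefficients of s X + t Z in terms of \<open>X\<close> and
        \<open>Y\<close>. This combination is Gaussian with variance s^2 + t^2, which makes the
        joint characteristic function a product.\<close>
      define p q where "p = s - t * \<rho> / c" and "q = t / c"
      have W: "s * X \<omega> + t * Z \<omega> = p * X \<omega> + q * Y \<omega>" for \<omega>
        using c by (simp add: Z_def p_def q_def field_simps)
      have v: "p\<^sup>2 + q\<^sup>2 + 2 * p * q * \<rho> = s\<^sup>2 + t\<^sup>2"
      proof -
        have "p\<^sup>2 + q\<^sup>2 + 2 * p * q * \<rho> = (p + q * \<rho>)\<^sup>2 + q\<^sup>2 * (1 - \<rho>\<^sup>2)"
          by (simp add: power2_eq_square algebra_simps)
        also have "p + q * \<rho> = s" by (simp add: p_def q_def)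
        also have "q\<^sup>2 * (1 - \<rho>\<^sup>2) = t\<^sup>2" using c by (simp add: q_def power_divide flip: c(2))
        finally show ?thesis .
      qed
      show "expectation (\<lambda>\<omega>. iexp (s * X \<omega> + t * Z \<omega>)) = of_real (exp (- s\<^sup>2 / 2) * exp (- t\<^sup>2 / 2))"
      proof (cases "s\<^sup>2 + t\<^sup>2 = 0")
        case True
        hence "s = 0" "t = 0" by (auto simp: sum_power2_eq_zero_iff)
        thus ?thesis by (simp add: prob_space)
      next
        case False
        hence pos: "s\<^sup>2 + t\<^sup>2 > 0" by (metis less_eq_real_def sum_power2_ge_zero)
        have "distributed M lborel (\<lambda>\<omega>. p * X \<omega> + q * Y \<omega>) (\<lambda>x. ennreal (normal_density 0 (sqrt (s\<^sup>2 + t\<^sup>2)) x))"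
          by (rule gaussian_rv_centered) (use gauss EW EW2 v pos in auto)
        from char_centered_normal [OF this] pos
        have "expectation (\<lambda>\<omega>. iexp (p * X \<omega> + q * Y \<omega>)) = of_real (exp (- (s\<^sup>2 + t\<^sup>2) / 2))" by simp
        also have "exp (- (s\<^sup>2 + t\<^sup>2) / 2) = exp (- s\<^sup>2 / 2) * exp (- t\<^sup>2 / 2)"
          by (simp add: add_divide_distrib diff_divide_distrib flip: exp_add)
        finally show ?thesis unfolding W .
      qed
    qed measurable
    define S where "S = {p::real\<times>real. fst p * (snd p + a * fst p) > 0}"
    have [measurable]: "S \<in> sets (borel \<Otimes>\<^sub>M borel)"
    proof -
      have "{p \<in> space (borel \<Otimes>\<^sub>M borel). fst p * (snd p + a * fst p) > (0::real)} \<in> sets (borel \<Otimes>\<^sub>M borel)"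
        by measurable
      thus ?thesis by (simp add: S_def space_pair_measure)
    qed
    have SXY: "(X \<omega>, Z \<omega>) \<in> S \<longleftrightarrow> X \<omega> * Y \<omega> > 0" for \<omega>
    proof -
      have "Z \<omega> + a * X \<omega> = Y \<omega> / c" by (simp add: Z_def a_def)
      thus ?thesis using c by (simp add: S_def zero_less_mult_iff zero_less_divide_iff mult_less_0_iff divide_less_0_iff)
    qed
    have "emeasure M {\<omega> \<in> space M. X \<omega> * Y \<omega> > 0} = emeasure M ((\<lambda>\<omega>. (X \<omega>, Z \<omega>)) -` S \<inter> space M)"
      by (intro arg_cong [where f = "emeasure M"]) (auto simp: SXY)
    also have "\<dots> = emeasure (distr M (borel \<Otimes>\<^sub>M borel) (\<lambda>\<omega>. (X \<omega>, Z \<omega>))) S"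
      by (rule emeasure_distr [symmetric]) measurable
    also have "\<dots> = ennreal (1 / 2 + arctan a / pi)"
      unfolding joint S_def by (rule std_normal_wedge)
    finally have "prob {\<omega> \<in> space M. X \<omega> * Y \<omega> > 0} = 1 / 2 + arctan a / pi"
      using arctan_lbound [of a] by (simp add: emeasure_eq_measure field_simps)
    hence P: "expectation (indicator {\<omega> \<in> space M. X \<omega> * Y \<omega> > 0}) = 1 / 2 + arctan a / pi" by simp
    have "expectation (\<lambda>\<omega>. sgn (X \<omega>) * sgn (Y \<omega>)) = expectation (\<lambda>\<omega>. 2 * indicator {\<omega> \<in> space M. X \<omega> * Y \<omega> > 0} \<omega> - 1)"
    proof (rule integral_cong_AE)
      show "AE \<omega> in M. sgn (X \<omega>) * sgn (Y \<omega>) = 2 * indicator {\<omega> \<in> space M. X \<omega> * Y \<omega> > 0} \<omega> - 1"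
        using X0 Y0 AE_space by eventually_elim (auto simp: sgn_if indicator_def zero_less_mult_iff)
    qed measurable
    also have "\<dots> = 2 * expectation (indicator {\<omega> \<in> space M. X \<omega> * Y \<omega> > 0}) - 1"
      by (subst Bochner_Integration.integral_diff) (auto simp: prob_space emeasure_eq_measure)
    also have "\<dots> = 2 / pi * arctan a" unfolding P by (simp add: field_simps)
    also have "arctan a = arcsin \<rho>" using lt by (simp add: a_def c_def arcsin_arctan)
    finally show ?thesis .
  qed
qed

section \<open>The variance of the defect\<close>

lemma sets_surface_measure [measurable_cong]:
  "sets surface_measure = sets (restrict_space borel (sphere 0 1))"
  by (simp add: surface_measure_def)

lemma finite_measure_surface:
  assumes "DIM('a::euclidean_space) = d + 1"
  shows "finite_measure (surface_measure :: 'a measure)"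
  by (rule finite_measureI) (simp add: emeasure_surface_measure_sphere [OF assms])

lemma continuous_on_measurable_surface:
  fixes f :: "'a::euclidean_space \<Rightarrow> real"
  assumes "continuous_on (sphere 0 1) f"
  shows "f \<in> borel_measurable surface_measure"
  using borel_measurable_continuous_on_restrict [OF assms]
  by (simp add: measurable_cong_sets [OF sets_surface_measure refl])

text \<open>The point \<open>x\<close> is replaced by the first member of a dense sequence within
  distance 1/(m+1). The field at that member is jointly measurable, being glued from countably many
  pieces on which the point is fixed, and continuity of the paths gives the limit in
  \<open>m\<close>.\<close>

lemma caratheodory_measurable:
  fixes T :: "'a::euclidean_space \<Rightarrow> 'w \<Rightarrow> real"
  assumes meas: "\<And>x. x \<in> sphere 0 1 \<Longrightarrow> T x \<in> borel_measurable M"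
    and cont: "\<And>\<omega>. \<omega> \<in> space M \<Longrightarrow> continuous_on (sphere 0 1) (\<lambda>x. T x \<omega>)"
  shows "(\<lambda>p. T (fst p) (snd p)) \<in> borel_measurable (surface_measure \<Otimes>\<^sub>M M)"
proof -
  obtain D :: "'a set" where D: "countable D" "D \<subseteq> sphere 0 1" "sphere 0 1 \<subseteq> closure D"
    using separable [of "sphere 0 1 :: 'a set"] by blast
  have "D \<noteq> {}" using D(3) sphere_eq_empty [of "0::'a" 1] by auto
  define e where "e = from_nat_into D"
  have e: "e k \<in> sphere 0 1" for k unfolding e_def using D(2) from_nat_into [OF \<open>D \<noteq> {}\<close>] by blast
  have dense: "\<exists>k. dist x (e k) < 1 / real (Suc m)" if "x \<in> sphere 0 1" for x m
  proof -
    have "x \<in> closure D" using that D(3) by blast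
    then obtain y where "y \<in> D" "dist y x < 1 / real (Suc m)"
      unfolding closure_approachable by (meson divide_pos_pos of_nat_0_less_iff zero_less_Suc zero_less_one)
    moreover obtain k where "y = e k" using \<open>y \<in> D\<close> D(1) from_nat_into_surj e_def by metis
    ultimately show ?thesis by (auto simp: dist_commute)
  qed
  define q where "q m x = (LEAST k. dist x (e k) < 1 / real (Suc m))" for m x
  have q: "dist x (e (q m x)) < 1 / real (Suc m)" if "x \<in> sphere 0 1" for x m
    unfolding q_def using dense [OF that] by (rule LeastI_ex)
  let ?P = "(surface_measure :: 'a measure) \<Otimes>\<^sub>M M"
  have id [measurable]: "(\<lambda>x. x) \<in> borel_measurable (surface_measure :: 'a measure)"
    by (simp add: measurable_cong_sets [OF sets_surface_measure refl] measurable_restrict_space1)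
  have [measurable]: "q m \<in> measurable (surface_measure :: 'a measure) (count_space UNIV)" for m
    unfolding q_def by measurable
  show ?thesis
  proof (rule borel_measurable_LIMSEQ_metric)
    fix m
    have "(\<lambda>p. T (e k) (snd p)) \<in> borel_measurable ?P" for k
      using meas [OF e] by measurable
    thus "(\<lambda>p. T (e (q m (fst p))) (snd p)) \<in> borel_measurable ?P"
      by (rule measurable_compose_countable) measurable
  next
    fix p assume "p \<in> space ?P"
    then obtain x \<omega> where p: "p = (x, \<omega>)" "x \<in> sphere 0 1" "\<omega> \<in> space M"
      by (auto simp: space_pair_measure)
    have "(\<lambda>m. e (q m x)) \<longlonglongrightarrow> x"
    proof (rule metric_LIMSEQ_I)
      fix r :: real assume "r > 0"
      then obtain N where "1 / real (Suc N) < r" using nat_approx_posE by metis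
      moreover have "dist (e (q m x)) x < 1 / real (Suc N)" if "m \<ge> N" for m
      proof -
        have "1 / real (Suc m) \<le> 1 / real (Suc N)" using that by (intro divide_left_mono) auto
        thus ?thesis using q [OF p(2), of m] by (simp add: dist_commute)
      qed
      ultimately show "\<exists>no. \<forall>m\<ge>no. dist (e (q m x)) x < r" by (meson less_trans)
    qed
    hence "(\<lambda>m. T (e (q m x)) \<omega>) \<longlonglongrightarrow> T x \<omega>"
      by (intro continuous_on_tendsto_compose [OF cont [OF p(3)]]) (use e p in auto)
    thus "(\<lambda>m. T (e (q m (fst p))) (snd p)) \<longlonglongrightarrow> T (fst p) (snd p)" by (simp add: p)
  qed
qed

lemma integral_pair_product:
  fixes f :: "'b \<Rightarrow> real"
  assumes "finite_measure S" and [measurable]: "f \<in> borel_measurable S" and "\<And>x. x \<in> space S \<Longrightarrow> \<bar>f x\<bar> \<le> B"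
  shows "(\<integral>p. f (fst p) * f (snd p) \<partial>(S \<Otimes>\<^sub>M S)) = (\<integral>x. f x \<partial>S)\<^sup>2"
proof -
  interpret S: finite_measure S by fact
  interpret pair_sigma_finite S S ..
  interpret SS: finite_measure "S \<Otimes>\<^sub>M S" by (rule finite_measure_pair_measure) fact+
  have "integrable (S \<Otimes>\<^sub>M S) (\<lambda>p. f (fst p) * f (snd p))"
  proof (rule SS.integrable_const_bound [where B = "B * B"])
    show "AE p in S \<Otimes>\<^sub>M S. norm (f (fst p) * f (snd p)) \<le> B * B"
    proof (rule AE_I2)
      fix p assume "p \<in> space (S \<Otimes>\<^sub>M S)"
      hence "\<bar>f (fst p)\<bar> \<le> B" "\<bar>f (snd p)\<bar> \<le> B" using assms(3) by (auto simp: space_pair_measure)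
      thus "norm (f (fst p) * f (snd p)) \<le> B * B" by (simp add: abs_mult mult_mono')
    qed
  qed measurable
  hence "(\<integral>p. f (fst p) * f (snd p) \<partial>(S \<Otimes>\<^sub>M S)) = (\<integral>x. \<integral>y. f x * f y \<partial>S \<partial>S)"
    using integral_fst' [of "\<lambda>p. f (fst p) * f (snd p)"] by simp
  also have "\<dots> = (\<integral>x. f x * (\<integral>y. f y \<partial>S) \<partial>S)" by simp
  also have "\<dots> = (\<integral>x. f x \<partial>S)\<^sup>2" by (simp add: power2_eq_square)
  finally show ?thesis .
qed

text \<open>
  Positive definiteness in integrated form. Stability under multiplication by a covariance then
  needs no Schur product theorem: such a factor is an expectation over the field.
\<close>

definition pos_def_kernel :: "'b measure \<Rightarrow> ('b \<times> 'b \<Rightarrow> real) \<Rightarrow> bool" where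
  "pos_def_kernel S K \<longleftrightarrow> K \<in> borel_measurable (S \<Otimes>\<^sub>M S) \<and> (\<exists>B. \<forall>p\<in>space (S \<Otimes>\<^sub>M S). \<bar>K p\<bar> \<le> B) \<and>
     (\<forall>f B. f \<in> borel_measurable S \<longrightarrow> (\<forall>x\<in>space S. \<bar>f x\<bar> \<le> B) \<longrightarrow>
       0 \<le> (\<integral>p. K p * (f (fst p) * f (snd p)) \<partial>(S \<Otimes>\<^sub>M S)))"

lemma pos_def_kernel_one:
  assumes "finite_measure S"
  shows "pos_def_kernel S (\<lambda>_. 1)"
  unfolding pos_def_kernel_def
proof (intro conjI allI impI exI [of _ 1])
  fix f :: "'a \<Rightarrow> real" and B
  assume "f \<in> borel_measurable S" "\<forall>x\<in>space S. \<bar>f x\<bar> \<le> B"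
  thus "0 \<le> (\<integral>p. 1 * (f (fst p) * f (snd p)) \<partial>(S \<Otimes>\<^sub>M S))"
    using integral_pair_product [OF assms, of f B] by simp
qed auto

lemma pos_def_kernel_integral_nonneg:
  assumes "pos_def_kernel S K"
  shows "0 \<le> (\<integral>p. K p \<partial>(S \<Otimes>\<^sub>M S))"
proof -
  have "\<forall>f B. f \<in> borel_measurable S \<longrightarrow> (\<forall>x\<in>space S. \<bar>f x\<bar> \<le> B) \<longrightarrow>
       0 \<le> (\<integral>p. K p * (f (fst p) * f (snd p)) \<partial>(S \<Otimes>\<^sub>M S))"
    using assms by (simp add: pos_def_kernel_def)
  from this [rule_format, of "\<lambda>_. 1" 1] show ?thesis by simp
qed

section \<open>The Gaussian eigenfunction at a fixed even degree\<close>

locale eigenfunction =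
  fixes M :: "'w measure" and d l :: nat and T :: "'a::euclidean_space \<Rightarrow> 'w \<Rightarrow> real"
  assumes d_ge_2: "d \<ge> 2" and dim: "DIM('a) = d + 1" and l_ge_1: "l \<ge> 1" and l_even: "even l"
    and T: "gaussian_eigenfunction M d l T"
begin

abbreviation S :: "'a measure" where "S \<equiv> surface_measure"
abbreviation SS :: "('a \<times> 'a) measure" where "SS \<equiv> S \<Otimes>\<^sub>M S"
abbreviation G :: "'a \<times> 'a \<Rightarrow> real" where "G p \<equiv> gegenbauer d l (fst p \<bullet> snd p)"

sublocale prob_space M using T by (simp add: gaussian_eigenfunction_def)
sublocale S: finite_measure S by (rule finite_measure_surface [OF dim])
sublocale SS: finite_measure SS by (rule finite_measure_pair_measure) unfold_locales
sublocale SM: pair_sigma_finite S M ..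
sublocale SSM: pair_sigma_finite SS M ..
sublocale pair_SS: pair_sigma_finite S S ..

lemma inner_sphere: "x \<in> sphere 0 1 \<Longrightarrow> y \<in> sphere 0 1 \<Longrightarrow> \<bar>x \<bullet> y\<bar> \<le> 1"
  using Cauchy_Schwarz_ineq2 [of x y] by simp

text \<open>The energy bound reaches only to \<open>pi / 2\<close>; the other half of the meridian
  follows by the reflection available for even degree.\<close>

lemma abs_gegenbauer_le_1:
  assumes "\<bar>t\<bar> \<le> 1"
  shows "\<bar>gegenbauer d l t\<bar> \<le> 1"
proof -
  interpret zonal_fun d l by unfold_locales (rule d_ge_2, rule l_ge_1)
  have "\<bar>u x\<bar> \<le> 1" if "0 \<le> x" "x \<le> pi" for x
  proof (cases "x \<le> pi / 2")
    case True thus ?thesis using abs_u_le_1 that by simp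
  next
    case False
    have "u x = u (pi - x)" using zonal_reflect [OF l_even, of d x] by simp
    thus ?thesis using abs_u_le_1 [of "pi - x"] that False by simp
  qed
  from this [of "arccos t"] show ?thesis
    using assms arccos_lbound [of t] arccos_ubound [of t] cos_arccos_abs [of t] by (simp add: zonal_def abs_le_iff)
qed

lemma T_meas [measurable]: "x \<in> sphere 0 1 \<Longrightarrow> T x \<in> borel_measurable M"
proof -
  assume x: "x \<in> sphere 0 1"
  have "\<forall>F c. finite F \<and> F \<subseteq> sphere 0 1 \<longrightarrow> gaussian_rv M (\<lambda>\<omega>. \<Sum>z\<in>F. c z * T z \<omega>)"
    using T unfolding gaussian_eigenfunction_def gaussian_field_def by blast
  from this [rule_format, of "{x}" "\<lambda>_. 1"] x show ?thesis by (simp add: gaussian_rv_def)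
qed

lemma T_cont: "\<omega> \<in> space M \<Longrightarrow> continuous_on (sphere 0 1) (\<lambda>x. T x \<omega>)"
  using T by (simp add: gaussian_eigenfunction_def)

lemma T_joint [measurable]: "(\<lambda>p. T (fst p) (snd p)) \<in> borel_measurable (S \<Otimes>\<^sub>M M)"
  by (rule caratheodory_measurable [OF T_meas T_cont])

lemma T_joint1 [measurable]: "(\<lambda>p. T (fst (fst p)) (snd p)) \<in> borel_measurable (SS \<Otimes>\<^sub>M M)"
  using measurable_compose [OF _ T_joint, of "\<lambda>p. (fst (fst p), snd p)" "SS \<Otimes>\<^sub>M M"] by simp

lemma T_joint2 [measurable]: "(\<lambda>p. T (snd (fst p)) (snd p)) \<in> borel_measurable (SS \<Otimes>\<^sub>M M)"
  using measurable_compose [OF _ T_joint, of "\<lambda>p. (snd (fst p), snd p)" "SS \<Otimes>\<^sub>M M"] by simp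

lemma T_surface [measurable]: "\<omega> \<in> space M \<Longrightarrow> (\<lambda>x. T x \<omega>) \<in> borel_measurable S"
  by (rule continuous_on_measurable_surface [OF T_cont])

lemma T_bounded: "\<omega> \<in> space M \<Longrightarrow> \<exists>B. \<forall>x\<in>sphere 0 1. \<bar>T x \<omega>\<bar> \<le> B"
  using compact_imp_bounded [OF compact_continuous_image [OF T_cont compact_sphere]]
  unfolding bounded_iff by (metis imageI real_norm_def)

lemma T_cov: "x \<in> sphere 0 1 \<Longrightarrow> y \<in> sphere 0 1 \<Longrightarrow> expectation (\<lambda>\<omega>. T x \<omega> * T y \<omega>) = gegenbauer d l (x \<bullet> y)"
  using T inner_sphere [of x y] unfolding gaussian_eigenfunction_def geodesic_dist_def
  by (simp add: cos_arccos_abs)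

lemma T_var: "x \<in> sphere 0 1 \<Longrightarrow> expectation (\<lambda>\<omega>. T x \<omega> * T x \<omega>) = 1"
  using T_cov [of x x] d_ge_2 gegenbauer_at_1 [of d l] by (simp add: dot_square_norm)

text \<open>The second moment equals 1, whereas the integral of a non-integrable function is 0 by
  convention.\<close>

lemma T_sq_integrable: "x \<in> sphere 0 1 \<Longrightarrow> integrable M (\<lambda>\<omega>. T x \<omega> * T x \<omega>)"
  using T_var [of x] not_integrable_integral_eq [of M "\<lambda>\<omega>. T x \<omega> * T x \<omega>"] by auto

lemma T_prod_abs:
  assumes "x \<in> sphere 0 1" "y \<in> sphere 0 1"
  shows "integrable M (\<lambda>\<omega>. T x \<omega> * T y \<omega>)" "expectation (\<lambda>\<omega>. \<bar>T x \<omega> * T y \<omega>\<bar>) \<le> 1"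
proof -
  note [measurable] = T_meas [OF assms(1)] T_meas [OF assms(2)]
  have le: "\<bar>T x \<omega> * T y \<omega>\<bar> \<le> (T x \<omega> * T x \<omega> + T y \<omega> * T y \<omega>) / 2" for \<omega>
    using sum_squares_ge_zero [of "\<bar>T x \<omega>\<bar> - \<bar>T y \<omega>\<bar>" 0] by (simp add: abs_mult algebra_simps)
  have int: "integrable M (\<lambda>\<omega>. (T x \<omega> * T x \<omega> + T y \<omega> * T y \<omega>) / 2)"
    using T_sq_integrable assms by simp
  show 1: "integrable M (\<lambda>\<omega>. T x \<omega> * T y \<omega>)"
  proof (rule Bochner_Integration.integrable_bound [OF int])
    show "AE \<omega> in M. norm (T x \<omega> * T y \<omega>) \<le> norm ((T x \<omega> * T x \<omega> + T y \<omega> * T y \<omega>) / 2)"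
      unfolding real_norm_def using le by (intro AE_I2 order_trans [OF le abs_ge_self])
  qed measurable
  have "expectation (\<lambda>\<omega>. \<bar>T x \<omega> * T y \<omega>\<bar>) \<le> expectation (\<lambda>\<omega>. (T x \<omega> * T x \<omega> + T y \<omega> * T y \<omega>) / 2)"
    using 1 int le by (intro integral_mono) auto
  also have "\<dots> = 1" using T_sq_integrable T_var assms by simp
  finally show "expectation (\<lambda>\<omega>. \<bar>T x \<omega> * T y \<omega>\<bar>) \<le> 1" .
qed

lemma T_expectation: "x \<in> sphere 0 1 \<Longrightarrow> expectation (T x) = 0"
  using T by (simp add: gaussian_eigenfunction_def)

lemma T_comb:
  assumes "x \<in> sphere 0 1" "y \<in> sphere 0 1"
  shows "gaussian_rv M (\<lambda>\<omega>. a * T x \<omega> + b * T y \<omega>)"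
proof -
  have gf: "gaussian_rv M (\<lambda>\<omega>. \<Sum>z\<in>F. c z * T z \<omega>)" if "finite F" "F \<subseteq> sphere 0 1" for F c
    using T that unfolding gaussian_eigenfunction_def gaussian_field_def by blast
  show ?thesis
  proof (cases "x = y")
    case True
    have "gaussian_rv M (\<lambda>\<omega>. \<Sum>z\<in>{x}. (a + b) * T z \<omega>)" by (rule gf) (use assms in auto)
    thus ?thesis using True by (simp add: distrib_right)
  next
    case False
    have "gaussian_rv M (\<lambda>\<omega>. \<Sum>z\<in>{x, y}. (if z = x then a else b) * T z \<omega>)" by (rule gf) (use assms in auto)
    thus ?thesis using False by simp
  qed
qed

lemma expectation_sgn_sgn:
  assumes "x \<in> sphere 0 1" "y \<in> sphere 0 1"
  shows "expectation (\<lambda>\<omega>. sgn (T x \<omega>) * sgn (T y \<omega>)) = 2 / pi * arcsin (gegenbauer d l (x \<bullet> y))"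
  using assms by (intro expectation_sgn_gaussian T_comb T_expectation T_var T_cov)

text \<open>The density is even and the sign is odd, so the integral equals its own
  negative.\<close>

lemma expectation_sgn:
  assumes "x \<in> sphere 0 1"
  shows "expectation (\<lambda>\<omega>. sgn (T x \<omega>)) = 0"
proof -
  have "distributed M lborel (T x) (\<lambda>t. ennreal (normal_density 0 (sqrt 1) t))"
    using T_comb [of x x 1 0] assms
    by (intro gaussian_rv_centered T_expectation T_var) auto
  hence D: "distributed M lborel (T x) std_normal_density" by simp
  have "expectation (\<lambda>\<omega>. sgn (T x \<omega>)) = (\<integral>t. std_normal_density t * sgn t \<partial>lborel)"
    by (rule distributed_integral [OF D, symmetric]) auto
  moreover have "(\<integral>t. std_normal_density t * sgn t \<partial>lborel) = - (\<integral>t. std_normal_density t * sgn t \<partial>lborel)"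
    using lborel_integral_real_affine [of "-1" "\<lambda>t. std_normal_density t * sgn t" 0]
    by (simp add: std_normal_density_def)
  ultimately show ?thesis by simp
qed

lemma G_meas [measurable]: "G \<in> borel_measurable SS"
proof -
  have [measurable]: "(\<lambda>x. x) \<in> borel_measurable S"
    by (simp add: measurable_cong_sets [OF sets_surface_measure refl] measurable_restrict_space1)
  have [measurable]: "gegenbauer d l \<in> borel_measurable borel"
  proof -
    have "gegenbauer d l = (\<lambda>x. poly (geg_poly d l) ((x - 1) / 2))"
      using d_ge_2 by (simp add: gegenbauer_eq_poly fun_eq_iff)
    thus ?thesis by (simp add: borel_measurable_continuous_onI continuous_intros)
  qed
  have [measurable]: "(\<lambda>p. fst p) \<in> borel_measurable SS" "(\<lambda>p. snd p) \<in> borel_measurable SS"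
    by (rule measurable_compose [OF measurable_fst \<open>(\<lambda>x. x) \<in> borel_measurable S\<close>],
        rule measurable_compose [OF measurable_snd \<open>(\<lambda>x. x) \<in> borel_measurable S\<close>])
  show ?thesis by measurable
qed

lemma space_SS: "p \<in> space SS \<Longrightarrow> fst p \<in> sphere 0 1 \<and> snd p \<in> sphere 0 1"
  by (auto simp: space_pair_measure)

lemma abs_G_le_1: "p \<in> space SS \<Longrightarrow> \<bar>G p\<bar> \<le> 1"
  using space_SS inner_sphere abs_gegenbauer_le_1 by blast

lemma pos_def_kernel_mult:
  assumes "pos_def_kernel S K"
  shows "pos_def_kernel S (\<lambda>p. K p * G p)"
proof -
  have [measurable]: "K \<in> borel_measurable SS" using assms by (simp add: pos_def_kernel_def)
  obtain B where B: "\<And>p. p \<in> space SS \<Longrightarrow> \<bar>K p\<bar> \<le> B" using assms unfolding pos_def_kernel_def by blast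
  have pd: "0 \<le> (\<integral>p. K p * (f (fst p) * f (snd p)) \<partial>SS)"
    if "f \<in> borel_measurable S" "\<And>x. x \<in> space S \<Longrightarrow> \<bar>f x\<bar> \<le> C" for f C
    using assms that unfolding pos_def_kernel_def by blast
  have nonneg: "0 \<le> (\<integral>p. (K p * G p) * (f (fst p) * f (snd p)) \<partial>SS)"
    if f [measurable]: "f \<in> borel_measurable S" and C: "\<And>x. x \<in> space S \<Longrightarrow> \<bar>f x\<bar> \<le> C" for f C
  proof -
    define Q where "Q p = K p * (f (fst p) * f (snd p))" for p
    have [measurable]: "Q \<in> borel_measurable SS" unfolding Q_def by measurable
    have Qb: "\<bar>Q p\<bar> \<le> B * (C * C)" if "p \<in> space SS" for p
      unfolding Q_def abs_mult using that B [OF that] C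
      by (intro mult_mono' mult_nonneg_nonneg) (auto simp: space_pair_measure)
    define H where "H = (\<lambda>(p, \<omega>). Q p * (T (fst p) \<omega> * T (snd p) \<omega>))"
    have Hm [measurable]: "H \<in> borel_measurable (SS \<Otimes>\<^sub>M M)"
      unfolding H_def split_beta by measurable
    have H: "integrable (SS \<Otimes>\<^sub>M M) H"
    proof (rule SSM.Fubini_integrable [OF Hm])
      show "AE p in SS. integrable M (\<lambda>\<omega>. H (p, \<omega>))"
        using space_SS T_prod_abs(1) by (intro AE_I2) (auto simp: H_def)
      show "integrable SS (\<lambda>p. \<integral>\<omega>. norm (H (p, \<omega>)) \<partial>M)"
      proof (rule SS.integrable_const_bound [where B = "B * (C * C)"])
        show "AE p in SS. norm (\<integral>\<omega>. norm (H (p, \<omega>)) \<partial>M) \<le> B * (C * C)"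
        proof (rule AE_I2)
          fix p assume p: "p \<in> space SS"
          have "(\<integral>\<omega>. norm (H (p, \<omega>)) \<partial>M) = \<bar>Q p\<bar> * (\<integral>\<omega>. \<bar>T (fst p) \<omega> * T (snd p) \<omega>\<bar> \<partial>M)"
            by (simp add: H_def abs_mult)
          also have "\<dots> \<le> (B * (C * C)) * 1"
            using Qb [OF p] T_prod_abs(2) space_SS [OF p] by (intro mult_mono') (auto intro!: integral_nonneg_AE)
          finally show "norm (\<integral>\<omega>. norm (H (p, \<omega>)) \<partial>M) \<le> B * (C * C)"
            by (simp add: integral_nonneg_AE)
        qed
      qed measurable
    qed
    have "(\<integral>p. (K p * G p) * (f (fst p) * f (snd p)) \<partial>SS) = (\<integral>p. \<integral>\<omega>. H (p, \<omega>) \<partial>M \<partial>SS)"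
    proof (intro Bochner_Integration.integral_cong refl)
      fix p assume "p \<in> space SS"
      from space_SS [OF this] have "(\<integral>\<omega>. T (fst p) \<omega> * T (snd p) \<omega> \<partial>M) = G p" by (intro T_cov) auto
      thus "(K p * G p) * (f (fst p) * f (snd p)) = (\<integral>\<omega>. H (p, \<omega>) \<partial>M)"
        by (simp add: H_def Q_def mult_ac)
    qed
    also have "\<dots> = (\<integral>\<omega>. \<integral>p. H (p, \<omega>) \<partial>SS \<partial>M)"
      using SSM.Fubini_integral [of "\<lambda>p \<omega>. H (p, \<omega>)"] H by simp
    finally have eq: "(\<integral>p. (K p * G p) * (f (fst p) * f (snd p)) \<partial>SS) = (\<integral>\<omega>. \<integral>p. H (p, \<omega>) \<partial>SS \<partial>M)" .
    show ?thesis
      unfolding eq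
    proof (rule integral_nonneg_AE, rule AE_I2)
      fix \<omega> assume w: "\<omega> \<in> space M"
      obtain E where E: "\<And>x. x \<in> sphere 0 1 \<Longrightarrow> \<bar>T x \<omega>\<bar> \<le> E" using T_bounded [OF w] by blast
      \<comment> \<open>For fixed \<open>\<omega>\<close> the path is absorbed into the test
        function, which becomes \<open>f x * T x \<omega>\<close>. Its bound varies with
        \<open>\<omega>\<close>, and \<open>pos_def_kernel\<close> admits test functions with any
        bound.\<close>
      have "0 \<le> (\<integral>p. K p * ((f (fst p) * T (fst p) \<omega>) * (f (snd p) * T (snd p) \<omega>)) \<partial>SS)"
      proof (rule pd [of _ "C * E"])
        show "(\<lambda>x. f x * T x \<omega>) \<in> borel_measurable S" using T_surface [OF w] by measurable
        show "\<bar>f x * T x \<omega>\<bar> \<le> C * E" if "x \<in> space S" for x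
          using that C [of x] E [of x] by (simp add: abs_mult mult_mono')
      qed
      thus "0 \<le> (\<integral>p. H (p, \<omega>) \<partial>SS)" by (simp add: H_def Q_def mult_ac)
    qed
  qed
  have bd: "\<bar>K p * G p\<bar> \<le> B * 1" if "p \<in> space SS" for p
    unfolding abs_mult using B [OF that] abs_G_le_1 [OF that] by (intro mult_mono') auto
  show ?thesis
    unfolding pos_def_kernel_def
  proof (intro conjI allI impI)
    show "\<exists>B. \<forall>p\<in>space SS. \<bar>K p * G p\<bar> \<le> B" using bd by blast
    show "0 \<le> (\<integral>p. K p * G p * (f (fst p) * f (snd p)) \<partial>SS)"
      if "f \<in> borel_measurable S" "\<forall>x\<in>space S. \<bar>f x\<bar> \<le> C" for f C
      using that by (intro nonneg [of f C]) auto
  qed measurable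
qed

lemma integral_G_power_nonneg: "0 \<le> (\<integral>p. G p ^ m \<partial>SS)"
proof -
  have "pos_def_kernel S (\<lambda>p. G p ^ m)"
  proof (induction m)
    case 0
    show ?case using pos_def_kernel_one [OF finite_measure_surface [OF dim]] by simp
  next
    case (Suc m)
    thus ?case using pos_def_kernel_mult [of "\<lambda>p. G p ^ m"] by (simp add: mult.commute)
  qed
  thus ?thesis by (rule pos_def_kernel_integral_nonneg)
qed

lemma defect_eq:
  assumes "\<omega> \<in> space M"
  shows "defect T \<omega> = (\<integral>x. sgn (T x \<omega>) \<partial>S)"
proof -
  note [measurable] = T_surface [OF assms]
  have i: "integrable S (\<lambda>x. indicat_real {y. T y \<omega> > 0} x)" "integrable S (\<lambda>x. indicat_real {y. T y \<omega> < 0} x)"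
    by (rule S.integrable_const_bound [where B = 1]; (simp add: indicator_def)?; measurable)+
  have "defect T \<omega> = (\<integral>x. indicat_real {y. T y \<omega> > 0} x - indicat_real {y. T y \<omega> < 0} x \<partial>S)"
    unfolding defect_def using i by (rule Bochner_Integration.integral_diff [symmetric])
  also have "\<dots> = (\<integral>x. sgn (T x \<omega>) \<partial>S)"
    by (intro Bochner_Integration.integral_cong refl) (auto simp: sgn_if indicator_def)
  finally show ?thesis .
qed

lemma variance_defect:
  "variance (defect T) = 2 / pi * (\<integral>p. arcsin (G p) \<partial>SS)"
proof -
  define s where "s = (\<lambda>p. sgn (T (fst p) (snd p)))"
  have sm [measurable]: "s \<in> borel_measurable (S \<Otimes>\<^sub>M M)" unfolding s_def by measurable
  interpret SMf: finite_measure "S \<Otimes>\<^sub>M M" by (rule finite_measure_pair_measure) unfold_locales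
  interpret SSMf: finite_measure "SS \<Otimes>\<^sub>M M" by (rule finite_measure_pair_measure) unfold_locales
  have si: "integrable (S \<Otimes>\<^sub>M M) (\<lambda>(x, \<omega>). sgn (T x \<omega>))"
    by (rule SMf.integrable_const_bound [where B = 1]) (use sm in \<open>auto simp: s_def split_beta sgn_if\<close>)
  have "expectation (defect T) = expectation (\<lambda>\<omega>. \<integral>x. sgn (T x \<omega>) \<partial>S)"
    by (intro Bochner_Integration.integral_cong refl defect_eq)
  also have "\<dots> = (\<integral>x. \<integral>\<omega>. sgn (T x \<omega>) \<partial>M \<partial>S)"
    by (rule SM.Fubini_integral [OF si])
  also have "\<dots> = (\<integral>x. 0 \<partial>S)"
    by (intro Bochner_Integration.integral_cong refl) (simp add: expectation_sgn)
  finally have "expectation (defect T) = 0" by simp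
  hence "variance (defect T) = expectation (\<lambda>\<omega>. (defect T \<omega>)\<^sup>2)" by simp
  also have "\<dots> = expectation (\<lambda>\<omega>. \<integral>p. sgn (T (fst p) \<omega>) * sgn (T (snd p) \<omega>) \<partial>SS)"
  proof (intro Bochner_Integration.integral_cong refl)
    fix \<omega> assume w: "\<omega> \<in> space M"
    note [measurable] = T_surface [OF w]
    have "(\<integral>p. sgn (T (fst p) \<omega>) * sgn (T (snd p) \<omega>) \<partial>SS) = (\<integral>x. sgn (T x \<omega>) \<partial>S)\<^sup>2"
      by (rule integral_pair_product [OF finite_measure_surface [OF dim], where B = 1]) (auto simp: sgn_if)
    thus "(defect T \<omega>)\<^sup>2 = (\<integral>p. sgn (T (fst p) \<omega>) * sgn (T (snd p) \<omega>) \<partial>SS)"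
      by (simp add: defect_eq [OF w])
  qed
  also have "\<dots> = (\<integral>p. \<integral>\<omega>. sgn (T (fst p) \<omega>) * sgn (T (snd p) \<omega>) \<partial>M \<partial>SS)"
  proof (rule SSM.Fubini_integral)
    show "integrable (SS \<Otimes>\<^sub>M M) (\<lambda>(p, \<omega>). sgn (T (fst p) \<omega>) * sgn (T (snd p) \<omega>))"
      by (rule SSMf.integrable_const_bound [where B = 1], intro AE_I2, force simp: sgn_if, unfold split_beta, measurable)
  qed
  also have "\<dots> = (\<integral>p. 2 / pi * arcsin (G p) \<partial>SS)"
    by (intro Bochner_Integration.integral_cong refl expectation_sgn_sgn) (use space_SS in blast)+
  finally show ?thesis by simp
qed

end

section \<open>Positivity and the asymptotics of the variance\<close>

definition arcsin_coeff :: "nat \<Rightarrow> real" where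
  "arcsin_coeff j = pochhammer (1 / 2) j / fact j / (2 * real j + 1)"

lemma arcsin_coeff_pos: "arcsin_coeff j > 0"
  unfolding arcsin_coeff_def by (intro divide_pos_pos pochhammer_pos) auto

text \<open>The binomial series with exponent -1/2. The factor \<open>2 * real j + 1\<close> cancels
  the denominator of \<open>arcsin_coeff\<close>, so at y = x^2 this is the series of the derivative
  of arcsin.\<close>

lemma inverse_sqrt_sums:
  assumes "\<bar>y\<bar> < 1"
  shows "(\<lambda>j. (2 * real j + 1) * arcsin_coeff j * y ^ j) sums inverse (sqrt (1 - y))"
proof -
  have "(\<lambda>j. ((- 1 / 2) gchoose j) * (- y) ^ j) sums (1 + - y) powr (- 1 / 2)"
    by (rule gen_binomial_real) (use assms in simp)
  moreover have "((- 1 / 2) gchoose j) * (- y) ^ j = (2 * real j + 1) * arcsin_coeff j * y ^ j" for j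
  proof -
    have "((- 1 / 2) gchoose j) * (- y) ^ j = ((- 1) ^ j * (- y) ^ j) * (pochhammer (1 / 2) j / fact j)"
      by (simp add: gbinomial_pochhammer)
    also have "(- 1) ^ j * (- y) ^ j = y ^ j" by (simp flip: power_mult_distrib)
    finally show ?thesis by (simp add: arcsin_coeff_def)
  qed
  moreover have "(1 + - y) powr (- 1 / 2) = inverse (sqrt (1 - y))"
    using assms by (simp add: powr_minus powr_half_sqrt)
  ultimately show ?thesis by simp
qed

lemma summable_arcsin_coeff:
  assumes "\<bar>y\<bar> < 1"
  shows "summable (\<lambda>j. arcsin_coeff j * y ^ j)"
proof (rule summable_comparison_test')
  show "summable (\<lambda>j. (2 * real j + 1) * arcsin_coeff j * \<bar>y\<bar> ^ j)"
    using inverse_sqrt_sums [of "\<bar>y\<bar>"] assms by (simp add: sums_iff)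
  fix j :: nat
  have "1 * (arcsin_coeff j * \<bar>y\<bar> ^ j) \<le> (2 * real j + 1) * (arcsin_coeff j * \<bar>y\<bar> ^ j)"
    using arcsin_coeff_pos [of j] by (intro mult_right_mono) auto
  thus "norm (arcsin_coeff j * y ^ j) \<le> (2 * real j + 1) * arcsin_coeff j * \<bar>y\<bar> ^ j"
    using arcsin_coeff_pos [of j] by (simp add: abs_mult power_abs mult.assoc)
qed

text \<open>If A(y) is the series, then x A(x^2) has derivative A(y) + 2 y A'(y) at y = x^2, and the
  coefficients of that are the ones in \<open>inverse_sqrt_sums\<close>. Both sides thus have the
  same derivative and agree at 0.\<close>

lemma arcsin_eq_series:
  assumes "\<bar>x\<bar> < 1"
  shows "arcsin x = x * (\<Sum>j. arcsin_coeff j * (x\<^sup>2) ^ j)"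
proof -
  define A where "A y = (\<Sum>j. arcsin_coeff j * y ^ j)" for y
  have "arcsin x - x * A (x\<^sup>2) = arcsin 0 - 0 * A (0\<^sup>2)"
  proof (rule DERIV_isconst3 [where f = "\<lambda>x. arcsin x - x * A (x\<^sup>2)" and a = "- 1" and b = 1])
    fix x :: real assume "x \<in> {- 1<..<1}"
    hence x: "- 1 < x" "x < 1" by auto
    define y where "y = x\<^sup>2"
    have y: "\<bar>y\<bar> < 1" using x by (simp add: y_def abs_square_less_1)
    have dA: "(A has_real_derivative (\<Sum>j. diffs arcsin_coeff j * y ^ j)) (at y)"
      unfolding A_def [abs_def] using summable_arcsin_coeff y by (intro termdiffs_strong' [where K = 1]) auto
    have "(\<lambda>j. real j * arcsin_coeff j * y ^ (j - Suc 0)) sums (\<Sum>j. diffs arcsin_coeff j * y ^ j)"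
      by (rule diffs_equiv) (use termdiff_converges [of y 1 arcsin_coeff] summable_arcsin_coeff y in auto)
    from sums_mult [OF this, of "2 * y"]
    have "(\<lambda>j. 2 * y * (real j * arcsin_coeff j * y ^ (j - Suc 0))) sums (2 * y * (\<Sum>j. diffs arcsin_coeff j * y ^ j))" .
    \<comment> \<open>For \<open>j = 0\<close> the truncated exponent would be off by one, but the
      factor \<open>real j\<close> makes both sides vanish.\<close>
    moreover have "2 * y * (real j * arcsin_coeff j * y ^ (j - Suc 0)) = 2 * real j * arcsin_coeff j * y ^ j" for j
      by (cases j) auto
    ultimately have "(\<lambda>j. 2 * real j * arcsin_coeff j * y ^ j) sums (2 * y * (\<Sum>j. diffs arcsin_coeff j * y ^ j))" by simp
    moreover have "(\<lambda>j. arcsin_coeff j * y ^ j) sums A y"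
      unfolding A_def by (rule summable_sums [OF summable_arcsin_coeff [OF y]])
    ultimately have "(\<lambda>j. arcsin_coeff j * y ^ j + 2 * real j * arcsin_coeff j * y ^ j) sums
        (A y + 2 * y * (\<Sum>j. diffs arcsin_coeff j * y ^ j))"
      by (intro sums_add)
    moreover have "(\<lambda>j. arcsin_coeff j * y ^ j + 2 * real j * arcsin_coeff j * y ^ j) sums inverse (sqrt (1 - y))"
      using inverse_sqrt_sums [OF y] by (simp add: algebra_simps)
    ultimately have eq: "A y + 2 * y * (\<Sum>j. diffs arcsin_coeff j * y ^ j) = inverse (sqrt (1 - y))"
      by (rule sums_unique2)
    have "((\<lambda>x. A (x\<^sup>2)) has_real_derivative (\<Sum>j. diffs arcsin_coeff j * y ^ j) * (2 * x)) (at x)"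
    proof (rule DERIV_chain2 [where g = "\<lambda>x. x\<^sup>2"])
      show "(A has_real_derivative (\<Sum>j. diffs arcsin_coeff j * y ^ j)) (at (x\<^sup>2))" using dA by (simp add: y_def)
      show "((\<lambda>x. x\<^sup>2) has_real_derivative 2 * x) (at x)" by (auto intro!: derivative_eq_intros)
    qed
    from DERIV_diff [OF DERIV_arcsin [OF x] DERIV_mult [OF DERIV_ident this]]
    have "((\<lambda>x. arcsin x - x * A (x\<^sup>2)) has_real_derivative
       inverse (sqrt (1 - x\<^sup>2)) - (1 * A (x\<^sup>2) + (\<Sum>j. diffs arcsin_coeff j * y ^ j) * (2 * x) * x)) (at x)" .
    also have "inverse (sqrt (1 - x\<^sup>2)) - (1 * A (x\<^sup>2) + (\<Sum>j. diffs arcsin_coeff j * y ^ j) * (2 * x) * x) = 0"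
      using eq by (simp add: y_def [symmetric] power2_eq_square mult_ac) (simp add: y_def power2_eq_square mult_ac)
    finally show "((\<lambda>x. arcsin x - x * A (x\<^sup>2)) has_real_derivative 0) (at x)" .
  qed (use assms in auto)
  thus ?thesis by (simp add: A_def)
qed

lemma arcsin_sums:
  assumes "\<bar>x\<bar> < 1"
  shows "(\<lambda>j. arcsin_coeff j * x ^ (2 * j + 1)) sums arcsin x"
proof -
  have "\<bar>x\<^sup>2\<bar> < 1" using assms by (simp add: abs_square_less_1)
  from sums_mult [OF summable_sums [OF summable_arcsin_coeff [OF this]], of x]
  show ?thesis by (simp add: arcsin_eq_series [OF assms] power_mult [symmetric] mult_ac)
qed

text \<open>Up to 1/2 the remainder is x^5 times a series in x^2 with positive coefficients, largest
  at x^2 = 1/4. Beyond 1/2 the left-hand side is at most 4, and 128 is chosen so that 128 * (1/2)^5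
  = 4.\<close>

lemma arcsin_cubic_bound:
  obtains B where "B \<ge> 0" "\<And>x. \<bar>x\<bar> \<le> 1 \<Longrightarrow> \<bar>(arcsin x - x) - 1 / 6 * x ^ 3\<bar> \<le> B * \<bar>x\<bar> ^ 5"
proof -
  define A where "A y = (\<Sum>j. arcsin_coeff j * y ^ j)" for y
  define R where "R y = (\<Sum>j. arcsin_coeff (Suc (Suc j)) * y ^ j)" for y
  have sR: "summable (\<lambda>j. arcsin_coeff (Suc (Suc j)) * y ^ j)" if "\<bar>y\<bar> < 1" for y
    using summable_arcsin_coeff [OF that] summable_powser_split_head [of arcsin_coeff y]
      summable_powser_split_head [of "\<lambda>j. arcsin_coeff (Suc j)" y] by simp
  have A: "A y = 1 + y / 6 + y\<^sup>2 * R y" if "\<bar>y\<bar> < 1" for y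
  proof -
    have "A y = arcsin_coeff 0 + (\<Sum>j. arcsin_coeff (Suc j) * y ^ j) * y"
      unfolding A_def by (rule powser_split_head(1) [OF summable_arcsin_coeff [OF that]])
    also have "(\<Sum>j. arcsin_coeff (Suc j) * y ^ j) = arcsin_coeff 1 + R y * y"
      using powser_split_head(1) [of "\<lambda>j. arcsin_coeff (Suc j)" y] powser_split_head(3) [OF summable_arcsin_coeff [OF that]]
      by (simp add: R_def)
    finally show ?thesis by (simp add: arcsin_coeff_def power2_eq_square algebra_simps)
  qed
  have R0: "0 \<le> R y" if "0 \<le> y" "y \<le> 1 / 4" for y
    unfolding R_def using that arcsin_coeff_pos
    by (intro suminf_nonneg sR mult_nonneg_nonneg) (auto intro: less_imp_le)
  have R1: "R y \<le> R (1 / 4)" if "0 \<le> y" "y \<le> 1 / 4" for y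
    unfolding R_def using that arcsin_coeff_pos
    by (intro suminf_le sR mult_left_mono power_mono) (auto intro: less_imp_le)
  have "\<bar>(arcsin x - x) - 1 / 6 * x ^ 3\<bar> \<le> (R (1 / 4) + 128) * \<bar>x\<bar> ^ 5" if x: "\<bar>x\<bar> \<le> 1" for x
  proof (cases "\<bar>x\<bar> \<le> 1 / 2")
    case True
    have "x\<^sup>2 \<le> (1 / 2)\<^sup>2" using power_mono [OF True abs_ge_zero, of 2] by simp
    hence y: "0 \<le> x\<^sup>2" "x\<^sup>2 \<le> 1 / 4" by (auto simp: power2_eq_square)
    have "arcsin x = x * A (x\<^sup>2)" using arcsin_eq_series [of x] True by (simp add: A_def)
    also have "A (x\<^sup>2) = 1 + x\<^sup>2 / 6 + (x\<^sup>2)\<^sup>2 * R (x\<^sup>2)" by (rule A) (use y in auto)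
    finally have "(arcsin x - x) - 1 / 6 * x ^ 3 = x ^ 5 * R (x\<^sup>2)"
      by (simp add: eval_nat_numeral algebra_simps)
    hence "\<bar>(arcsin x - x) - 1 / 6 * x ^ 3\<bar> = \<bar>x\<bar> ^ 5 * R (x\<^sup>2)"
      using R0 [OF y] by (simp add: abs_mult power_abs)
    also have "\<dots> \<le> \<bar>x\<bar> ^ 5 * (R (1 / 4) + 128)" using R1 [OF y] by (intro mult_left_mono) auto
    finally show ?thesis by (simp add: mult.commute)
  next
    case False
    have "\<bar>x ^ 3\<bar> \<le> 1" using x by (simp add: power_abs power_le_one)
    moreover have "- 1 \<le> x" "x \<le> 1" using x by auto
    hence "\<bar>arcsin x\<bar> \<le> pi / 2" using arcsin_bounded [of x] by auto
    ultimately have "\<bar>(arcsin x - x) - 1 / 6 * x ^ 3\<bar> \<le> 4" using pi_less_4 x by linarith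
    also have "4 = 128 * (1 / 2 :: real) ^ 5" by (simp add: power_divide)
    also have "\<dots> \<le> (R (1 / 4) + 128) * \<bar>x\<bar> ^ 5"
      using False R0 [of "1 / 4"] by (intro mult_mono power_mono) auto
    finally show ?thesis .
  qed
  moreover have "R (1 / 4) + 128 \<ge> 0" using R0 [of "1 / 4"] by simp
  ultimately show ?thesis using that by blast
qed

text \<open>Every coefficient of the series is positive and every moment nonnegative, so any partial
  sum is a lower bound. Only the linear term and the term of degree 2k+1 are kept.\<close>

lemma integral_arcsin_ge:
  assumes "finite_measure P" and f [measurable]: "f \<in> borel_measurable P" and b: "\<And>p. p \<in> space P \<Longrightarrow> \<bar>f p\<bar> \<le> 1"
    and nn: "\<And>m. 0 \<le> (\<integral>p. f p ^ m \<partial>P)" and k: "k \<ge> 1"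
  shows "(\<integral>p. f p \<partial>P) + arcsin_coeff k * (\<integral>p. f p ^ (2 * k + 1) \<partial>P) \<le> (\<integral>p. arcsin (f p) \<partial>P)"
proof -
  interpret finite_measure P by fact
  define I where "I m = (\<integral>p. f p ^ m \<partial>P)" for m
  have I0: "0 \<le> I m" for m unfolding I_def by (rule nn)
  have fint: "integrable P (\<lambda>p. f p ^ m)" for m
    by (rule integrable_const_bound [where B = 1])
       (use b in \<open>auto intro!: AE_I2 power_le_one simp: power_abs\<close>)
  have cont: "continuous_on {-1..1} arcsin" by (rule continuous_on_arcsin')
  \<comment> \<open>The series is integrated for \<open>arcsin (r f)\<close> with \<open>r < 1\<close>, where it converges uniformly.\<close>
  have step: "r * I 1 + arcsin_coeff k * r ^ (2 * k + 1) * I (2 * k + 1) \<le> (\<integral>p. arcsin (r * f p) \<partial>P)"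
    if r: "0 < r" "r < 1" for r
  proof -
    define g where "g j p = arcsin_coeff j * (r * f p) ^ (2 * j + 1)" for j p
    have rs: "summable (\<lambda>j. arcsin_coeff j * r ^ (2 * j + 1))"
      using arcsin_sums [of r] r by (simp add: sums_iff)
    have gb: "norm (g j p) \<le> arcsin_coeff j * r ^ (2 * j + 1)" if "p \<in> space P" for j p
    proof -
      have "norm (g j p) = arcsin_coeff j * (r ^ (2 * j + 1) * \<bar>f p\<bar> ^ (2 * j + 1))"
        using arcsin_coeff_pos [of j] r by (simp add: g_def abs_mult power_abs power_mult_distrib)
      also have "\<dots> \<le> arcsin_coeff j * (r ^ (2 * j + 1) * 1)"
        using arcsin_coeff_pos [of j] r b [OF that] by (intro mult_left_mono power_le_one) auto
      finally show ?thesis by simp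
    qed
    have gint: "integrable P (g j)" for j
      unfolding g_def power_mult_distrib by (intro integrable_mult_right fint)
    have gI: "(\<integral>p. g j p \<partial>P) = arcsin_coeff j * r ^ (2 * j + 1) * I (2 * j + 1)" for j
      unfolding g_def power_mult_distrib I_def by (simp add: mult.assoc del: power_Suc)
    have gs: "AE p in P. summable (\<lambda>j. norm (g j p))"
      by (intro AE_I2 summable_comparison_test' [OF rs]) (use gb in auto)
    have gn: "summable (\<lambda>j. \<integral>p. norm (g j p) \<partial>P)"
    proof (rule summable_comparison_test' [OF summable_mult2 [OF rs, of "measure P (space P)"]])
      fix j
      have "(\<integral>p. norm (g j p) \<partial>P) \<le> (\<integral>p. arcsin_coeff j * r ^ (2 * j + 1) \<partial>P)"
        using gint gb by (intro integral_mono) auto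
      thus "norm (\<integral>p. norm (g j p) \<partial>P) \<le> arcsin_coeff j * r ^ (2 * j + 1) * measure P (space P)"
        by (simp add: integral_nonneg_AE mult_ac)
    qed
    have "(\<integral>p. arcsin (r * f p) \<partial>P) = (\<integral>p. (\<Sum>j. g j p) \<partial>P)"
    proof (intro Bochner_Integration.integral_cong refl)
      fix p assume p: "p \<in> space P"
      have "\<bar>r * f p\<bar> \<le> r * 1" using b [OF p] r unfolding abs_mult by (intro mult_mono) auto
      hence "\<bar>r * f p\<bar> < 1" using r by simp
      thus "arcsin (r * f p) = (\<Sum>j. g j p)" using arcsin_sums [of "r * f p"] by (simp add: g_def sums_iff)
    qed
    also have "\<dots> = (\<Sum>j. \<integral>p. g j p \<partial>P)" by (rule integral_suminf [OF gint gs gn])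
    also have "\<dots> \<ge> (\<Sum>j\<in>{0, k}. \<integral>p. g j p \<partial>P)"
    proof (rule sum_le_suminf)
      show "summable (\<lambda>j. \<integral>p. g j p \<partial>P)"
        by (rule summable_comparison_test' [OF gn]) (auto intro!: integral_norm_bound [unfolded real_norm_def] simp del: real_norm_def)
      show "0 \<le> (\<integral>p. g j p \<partial>P)" for j
        unfolding gI using arcsin_coeff_pos [of j] r I0 by (intro mult_nonneg_nonneg) (simp_all add: less_imp_le)
    qed auto
    finally show ?thesis using k by (simp add: gI arcsin_coeff_def)
  qed
  define rr where "rr i = 1 - 1 / real (Suc (Suc i))" for i
  have rr: "0 < rr i" "rr i < 1" for i by (auto simp: rr_def)
  have rlim: "rr \<longlonglongrightarrow> 1" unfolding rr_def by real_asymp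
  have "(\<lambda>i. \<integral>p. arcsin (rr i * f p) \<partial>P) \<longlonglongrightarrow> (\<integral>p. arcsin (f p) \<partial>P)"
  proof (rule integral_dominated_convergence [where w = "\<lambda>_. pi / 2"])
    have m: "(\<lambda>p. arcsin (c * f p)) \<in> borel_measurable P" if c: "0 < c" "c \<le> 1" for c
    proof -
      have cb: "c * f p \<in> {-1..1}" if "p \<in> space P" for p
      proof -
        have "\<bar>c * f p\<bar> \<le> 1 * 1" using b [OF that] c unfolding abs_mult by (intro mult_mono) auto
        thus ?thesis by auto
      qed
      \<comment> \<open>Continuity of \<open>arcsin\<close> is available on [-1, 1] only. Clamping
        the argument makes it continuous on the whole line without changing it at the values that
        occur.\<close>
      have "continuous_on UNIV (\<lambda>t. arcsin (max (- 1) (min 1 t)))"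
        by (rule continuous_on_compose2 [OF cont]) (auto intro!: continuous_intros)
      hence [measurable]: "(\<lambda>t. arcsin (max (- 1) (min 1 t))) \<in> borel_measurable borel"
        by (rule borel_measurable_continuous_onI)
      have "(\<lambda>p. arcsin (max (- 1) (min 1 (c * f p)))) \<in> borel_measurable P" by measurable
      thus ?thesis
        by (subst measurable_cong [where g = "\<lambda>p. arcsin (max (- 1) (min 1 (c * f p)))"]) (use cb in auto)
    qed
    show "(\<lambda>p. arcsin (f p)) \<in> borel_measurable P" using m [of 1] by simp
    show "(\<lambda>p. arcsin (rr i * f p)) \<in> borel_measurable P" for i using m [of "rr i"] rr [of i] by simp
    show "integrable P (\<lambda>_. pi / 2)" by simp
    have rb: "\<bar>rr i * f p\<bar> \<le> 1" if "p \<in> space P" for i p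
    proof -
      have "\<bar>rr i * f p\<bar> \<le> 1 * 1" using b [OF that] rr [of i] unfolding abs_mult by (intro mult_mono) auto
      thus ?thesis by simp
    qed
    show "AE p in P. norm (arcsin (rr i * f p)) \<le> pi / 2" for i
    proof (rule AE_I2)
      fix p assume "p \<in> space P"
      from rb [OF this, of i] have "- 1 \<le> rr i * f p" "rr i * f p \<le> 1" by auto
      thus "norm (arcsin (rr i * f p)) \<le> pi / 2"
        using arcsin_bounded [of "rr i * f p"] by auto
    qed
    show "AE p in P. (\<lambda>i. arcsin (rr i * f p)) \<longlonglongrightarrow> arcsin (f p)"
    proof (rule AE_I2)
      fix p assume p: "p \<in> space P"
      show "(\<lambda>i. arcsin (rr i * f p)) \<longlonglongrightarrow> arcsin (f p)"
      proof (rule continuous_on_tendsto_compose [OF cont])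
        show "(\<lambda>i. rr i * f p) \<longlonglongrightarrow> f p" using tendsto_mult [OF rlim tendsto_const, of "f p"] by simp
        show "f p \<in> {-1..1}" using b [OF p] by auto
        show "\<forall>\<^sub>F i in sequentially. rr i * f p \<in> {-1..1}"
          using rb [OF p] by (auto simp: abs_le_iff intro!: always_eventually)
      qed
    qed
  qed
  moreover have "(\<lambda>i. rr i * I 1 + arcsin_coeff k * rr i ^ (2 * k + 1) * I (2 * k + 1)) \<longlonglongrightarrow>
     1 * I 1 + arcsin_coeff k * 1 ^ (2 * k + 1) * I (2 * k + 1)"
    by (intro tendsto_intros rlim)
  ultimately have "1 * I 1 + arcsin_coeff k * 1 ^ (2 * k + 1) * I (2 * k + 1) \<le> (\<integral>p. arcsin (f p) \<partial>P)"
    using step rr by (intro LIMSEQ_le) auto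
  thus ?thesis by (simp add: I_def)
qed

text \<open>For nonnegative functions this is \<open>nn_integral_zonal\<close>. A general
  \<open>h\<close> is shifted by a bound \<open>B\<close> to become nonnegative, and the integral of
  the constant is subtracted again.\<close>

lemma integral_zonal:
  fixes h :: "real \<Rightarrow> real" and y :: "'a::euclidean_space"
  assumes h: "continuous_on {-1..1} h" and y: "norm y = 1" and d: "DIM('a) = d + 1" "d \<ge> 1"
  shows "integrable (surface_measure :: 'a measure) (\<lambda>x. h (x \<bullet> y))"
    and "(\<integral>x. h (x \<bullet> y) \<partial>(surface_measure :: 'a measure)) =
      sphere_mass (d - 1) * integral {0..pi} (\<lambda>t. sin t ^ (d - 1) * h (cos t))"
proof -
  let ?S = "surface_measure :: 'a measure"
  interpret finite_measure ?S by (rule finite_measure_surface [OF d(1)])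
  have rng: "x \<bullet> y \<in> {-1..1}" if "x \<in> sphere 0 1" for x
    using Cauchy_Schwarz_ineq2 [of x y] that y by auto
  have int: "integrable ?S (\<lambda>x. g (x \<bullet> y))" if g: "continuous_on {-1..1} g" for g :: "real \<Rightarrow> real"
  proof -
    obtain B where B: "\<And>t. t \<in> {-1..1} \<Longrightarrow> \<bar>g t\<bar> \<le> B"
      using compact_imp_bounded [OF compact_continuous_image [OF g compact_Icc]] unfolding bounded_iff
      by (metis imageI real_norm_def)
    show ?thesis
    proof (rule integrable_const_bound [where B = B])
      show "AE x in ?S. norm (g (x \<bullet> y)) \<le> B" using B rng by (intro AE_I2) auto
      show "(\<lambda>x. g (x \<bullet> y)) \<in> borel_measurable ?S"
        by (intro continuous_on_measurable_surface continuous_on_compose2 [OF g] continuous_intros) (use rng in auto)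
    qed
  qed
  have hk: "(\<lambda>t. sin t ^ (d - 1) * g (cos t)) integrable_on {0..pi}" if g: "continuous_on {-1..1} g" for g :: "real \<Rightarrow> real"
    by (intro integrable_continuous_real continuous_intros continuous_on_compose2 [OF g]) auto
  have sm: "sphere_mass (d - 1) \<ge> 0"
    unfolding sphere_mass_unit_ball_vol [OF d(2)] using unit_ball_vol_nonneg [of "real d"] by simp
  have pos: "(\<integral>x. g (x \<bullet> y) \<partial>?S) = sphere_mass (d - 1) * integral {0..pi} (\<lambda>t. sin t ^ (d - 1) * g (cos t))"
    if g: "continuous_on {-1..1} g" and g0: "\<And>t. t \<in> {-1..1} \<Longrightarrow> 0 \<le> g t" for g :: "real \<Rightarrow> real"
  proof -
    \<comment> \<open>The formula for nonnegative integrals asks for a Borel function that is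
      nonnegative on the whole line, while \<open>g\<close> is controlled on [-1, 1] only.\<close>
    define f where "f t = g (max (- 1) (min 1 t))" for t
    have "continuous_on UNIV f" unfolding f_def
      by (rule continuous_on_compose2 [OF g]) (auto intro!: continuous_intros)
    hence f: "f \<in> borel_measurable borel" by (rule borel_measurable_continuous_onI)
    have f0: "0 \<le> f t" for t unfolding f_def by (rule g0) auto
    have fg: "f t = g t" if "t \<in> {-1..1}" for t using that by (auto simp: f_def min_def max_def intro!: arg_cong [where f = g])
    let ?I = "integral {0..pi} (\<lambda>t. sin t ^ (d - 1) * g (cos t))"
    have "(\<integral>\<^sup>+x. ennreal (g (x \<bullet> y)) \<partial>?S) = (\<integral>\<^sup>+x. ennreal (f (x \<bullet> y)) \<partial>?S)"
      using rng by (intro nn_integral_cong) (simp add: fg)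
    also have "\<dots> = (\<integral>\<^sup>+t. ennreal (sphere_mass (d - 1) * (sin t ^ (d - 1) * f (cos t))) * indicator {0..pi} t \<partial>lborel)"
      by (rule nn_integral_zonal [OF f f0 y d])
    also have "\<dots> = ennreal (sphere_mass (d - 1) * ?I)"
    proof (rule nn_integral_has_integral_lebesgue')
      show "0 \<le> sphere_mass (d - 1) * (sin t ^ (d - 1) * f (cos t))" if "t \<in> {0..pi}" for t
        using sm f0 that by (intro mult_nonneg_nonneg zero_le_power sin_ge_zero) auto
      have "((\<lambda>t. sphere_mass (d - 1) * (sin t ^ (d - 1) * g (cos t))) has_integral sphere_mass (d - 1) * ?I) {0..pi}"
        by (intro has_integral_mult_right integrable_integral hk g)
      thus "((\<lambda>t. sphere_mass (d - 1) * (sin t ^ (d - 1) * f (cos t))) has_integral sphere_mass (d - 1) * ?I) {0..pi}"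
        by (simp add: fg)
    qed
    finally have nn: "(\<integral>\<^sup>+x. ennreal (g (x \<bullet> y)) \<partial>?S) = ennreal (sphere_mass (d - 1) * ?I)" .
    have "?I \<ge> 0"
      by (intro integral_nonneg hk g mult_nonneg_nonneg zero_le_power sin_ge_zero g0) auto
    moreover have "(\<integral>x. g (x \<bullet> y) \<partial>?S) = enn2real (\<integral>\<^sup>+x. ennreal (g (x \<bullet> y)) \<partial>?S)"
      using int [OF g] rng g0 by (intro integral_eq_nn_integral AE_I2) auto
    ultimately show ?thesis using sm by (simp add: nn)
  qed
  obtain B where B: "\<And>t. t \<in> {-1..1} \<Longrightarrow> \<bar>h t\<bar> \<le> B"
    using compact_imp_bounded [OF compact_continuous_image [OF h compact_Icc]] unfolding bounded_iff
    by (metis imageI real_norm_def)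
  have B0: "B \<ge> 0" using B [of 0] by auto
  have c1: "continuous_on {-1..1} (\<lambda>t. h t + B)" by (intro continuous_intros h)
  have c2: "continuous_on {-1..1} (\<lambda>t::real. B)" by (intro continuous_intros)
  show "integrable ?S (\<lambda>x. h (x \<bullet> y))" by (rule int [OF h])
  have "(\<integral>x. h (x \<bullet> y) \<partial>?S) = (\<integral>x. (h (x \<bullet> y) + B) - B \<partial>?S)" by simp
  also have "\<dots> = (\<integral>x. h (x \<bullet> y) + B \<partial>?S) - (\<integral>x. B \<partial>?S)"
    by (rule Bochner_Integration.integral_diff [OF int [OF c1] int [OF c2]])
  also have "(\<integral>x. h (x \<bullet> y) + B \<partial>?S) = sphere_mass (d - 1) * integral {0..pi} (\<lambda>t. sin t ^ (d - 1) * (h (cos t) + B))"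
    by (rule pos [OF c1]) (use B in \<open>fastforce simp: abs_le_iff\<close>)
  also have "(\<integral>x. B \<partial>?S) = sphere_mass (d - 1) * integral {0..pi} (\<lambda>t. sin t ^ (d - 1) * B)"
    by (rule pos [OF c2]) (use B0 in simp)
  also have "sphere_mass (d - 1) * integral {0..pi} (\<lambda>t. sin t ^ (d - 1) * (h (cos t) + B)) -
      sphere_mass (d - 1) * integral {0..pi} (\<lambda>t. sin t ^ (d - 1) * B) =
    sphere_mass (d - 1) * integral {0..pi} (\<lambda>t. sin t ^ (d - 1) * (h (cos t) + B) - sin t ^ (d - 1) * B)"
    using hk [OF c1] hk [OF c2] by (simp add: Henstock_Kurzweil_Integration.integral_diff right_diff_distrib)
  finally show "(\<integral>x. h (x \<bullet> y) \<partial>?S) = sphere_mass (d - 1) * integral {0..pi} (\<lambda>t. sin t ^ (d - 1) * h (cos t))"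
    by (simp add: algebra_simps)
qed

section \<open>Reduction of the variance to one integral over a quarter circle\<close>

lemma sphere_mass_pos: "sphere_mass d > 0"
  unfolding sphere_mass_def by (intro divide_pos_pos mult_pos_pos Gamma_real_pos) auto

lemma integral_symmetric_pi:
  fixes f :: "real \<Rightarrow> real"
  assumes "continuous_on {0..pi} f" "\<And>t. f (pi - t) = f t"
  shows "integral {0..pi} f = 2 * integral {0..pi / 2} f"
proof -
  have "integral {pi / 2..pi} f = integral {pi / 2 - pi..pi - pi} (\<lambda>x. f (x + pi))"
    by (rule integral_shift_real_ivl [symmetric])
  also have "(\<lambda>x. f (x + pi)) = (\<lambda>x. f (- x))"
  proof
    fix x show "f (x + pi) = f (- x)" using assms(2) [of "- x"] by (simp add: add.commute)
  qed
  also have "integral {pi / 2 - pi..pi - pi} (\<lambda>x. f (- x)) = integral {0..pi / 2} f"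
    using Henstock_Kurzweil_Integration.integral_reflect_real [of "pi / 2" 0 f] by simp
  finally have "integral {pi / 2..pi} f = integral {0..pi / 2} f" .
  moreover have "integral {0..pi / 2} f + integral {pi / 2..pi} f = integral {0..pi} f"
    by (intro Henstock_Kurzweil_Integration.integral_combine integrable_continuous_real assms(1)) auto
  ultimately show ?thesis by simp
qed

context zonal_fun
begin

text \<open>The flux \<open>sin t ^ n * v t\<close> has derivative
  \<open>- lam * (sin t ^ n * u t)\<close> and vanishes at both poles. The equation is singular
  there, so the fundamental theorem is used with derivatives in the interior only.\<close>

lemma integral_zonal_eq_0: "integral {0..pi} (\<lambda>t. sin t ^ n * u t) = 0"
proof -
  have "((\<lambda>t. - lam * (sin t ^ n * u t)) has_integral (sin pi ^ n * v pi - sin 0 ^ n * v 0)) {0..pi}"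
  proof (rule fundamental_theorem_of_calculus_interior)
    show "continuous_on {0..pi} (\<lambda>t. sin t ^ n * v t)" by (intro continuous_intros v_cont)
    fix t assume "t \<in> {0<..<pi}"
    hence s: "sin t \<noteq> 0" using sin_gt_zero [of t] by auto
    have "((\<lambda>t. sin t ^ n * v t) has_real_derivative
       real n * (cos t / sin t) * sin t ^ n * v t + (- lam * u t - real n * (cos t / sin t) * v t) * sin t ^ n) (at t)"
      by (rule DERIV_mult [OF sin_pow_deriv [OF s] v_deriv [OF s]])
    thus "((\<lambda>t. sin t ^ n * v t) has_vector_derivative - lam * (sin t ^ n * u t)) (at t)"
      by (simp add: has_real_derivative_iff_has_vector_derivative [symmetric] algebra_simps)
  qed auto
  hence "((\<lambda>t. - lam * (sin t ^ n * u t)) has_integral 0) {0..pi}"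
    by (simp only: zonal'_pi zonal'_0 mult_zero_right diff_zero)
  from has_integral_mult_right [OF this, of "- 1 / lam"]
  have "((\<lambda>t. sin t ^ n * u t) has_integral 0) {0..pi}" using lam_pos by simp
  thus ?thesis by (rule integral_unique)
qed

end

context eigenfunction
begin

text \<open>The inner integral does not depend on the pole, so the outer one contributes the total
  mass. The factor 2 comes from folding the meridian at \<open>pi / 2\<close>.\<close>

lemma integral_SS_zonal:
  assumes h: "continuous_on {-1..1} h"
  shows "(\<integral>p. h (G p) \<partial>SS) =
    2 * sphere_mass d * sphere_mass (d - 1) * integral {0..pi / 2} (\<lambda>t. sin t ^ (d - 1) * h (zonal d l t))"
proof -
  have gc: "continuous_on {-1..1} (gegenbauer d l)"
  proof -
    have "gegenbauer d l = (\<lambda>x. poly (geg_poly d l) ((x - 1) / 2))"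
      using d_ge_2 by (simp add: gegenbauer_eq_poly fun_eq_iff)
    thus ?thesis by (simp add: continuous_intros)
  qed
  have hg: "continuous_on {-1..1} (\<lambda>t. h (gegenbauer d l t))"
    by (rule continuous_on_compose2 [OF h gc]) (use abs_gegenbauer_le_1 in \<open>force simp: abs_le_iff\<close>)
  let ?I = "integral {0..pi} (\<lambda>t. sin t ^ (d - 1) * h (gegenbauer d l (cos t)))"
  have d1: "d \<ge> 1" using d_ge_2 by simp
  obtain B where B: "\<And>t. t \<in> {-1..1} \<Longrightarrow> \<bar>h t\<bar> \<le> B"
    using compact_imp_bounded [OF compact_continuous_image [OF h compact_Icc]] unfolding bounded_iff
    by (metis imageI real_norm_def)
  have "continuous_on UNIV (\<lambda>t. h (max (- 1) (min 1 t)))"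
    by (rule continuous_on_compose2 [OF h]) (auto intro!: continuous_intros)
  hence [measurable]: "(\<lambda>t. h (max (- 1) (min 1 t))) \<in> borel_measurable borel"
    by (rule borel_measurable_continuous_onI)
  have Gr: "G p \<in> {-1..1}" if "p \<in> space SS" for p
    using abs_G_le_1 [OF that] by (auto simp: abs_le_iff)
  have int: "integrable SS (\<lambda>p. h (G p))"
  proof (rule SS.integrable_const_bound [where B = B])
    show "AE p in SS. norm (h (G p)) \<le> B" using B Gr by (intro AE_I2) auto
    have "(\<lambda>p. h (max (- 1) (min 1 (G p)))) \<in> borel_measurable SS" by measurable
    thus "(\<lambda>p. h (G p)) \<in> borel_measurable SS"
      by (subst measurable_cong [where g = "\<lambda>p. h (max (- 1) (min 1 (G p)))"]) (use Gr in auto)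
  qed
  have "(\<integral>p. h (G p) \<partial>SS) = (\<integral>x. \<integral>y. h (gegenbauer d l (x \<bullet> y)) \<partial>S \<partial>S)"
    using pair_SS.integral_fst' [OF int] by simp
  also have "\<dots> = (\<integral>x. sphere_mass (d - 1) * ?I \<partial>S)"
  proof (intro Bochner_Integration.integral_cong refl)
    fix x assume "x \<in> space S"
    hence "norm x = 1" by simp
    from integral_zonal(2) [OF hg this dim d1]
    show "(\<integral>y. h (gegenbauer d l (x \<bullet> y)) \<partial>S) = sphere_mass (d - 1) * ?I" by (simp add: inner_commute)
  qed
  also have "\<dots> = sphere_mass d * (sphere_mass (d - 1) * ?I)"
  proof -
    have "measure S (space S) = sphere_mass d"
      using emeasure_surface_measure_sphere [OF dim] sphere_mass_pos [of d]
      by (simp add: measure_def)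
    thus ?thesis by simp
  qed
  also have "?I = 2 * integral {0..pi / 2} (\<lambda>t. sin t ^ (d - 1) * h (gegenbauer d l (cos t)))"
  proof (rule integral_symmetric_pi)
    show "continuous_on {0..pi} (\<lambda>t. sin t ^ (d - 1) * h (gegenbauer d l (cos t)))"
      by (intro continuous_intros continuous_on_compose2 [OF hg]) auto
    show "sin (pi - t) ^ (d - 1) * h (gegenbauer d l (cos (pi - t))) = sin t ^ (d - 1) * h (gegenbauer d l (cos t))" for t
      by (simp add: gegenbauer_minus [OF l_even])
  qed
  finally show ?thesis by (simp add: zonal_def)
qed

lemma integral_SS_G: "(\<integral>p. G p \<partial>SS) = 0"
proof -
  interpret zonal_fun d l by unfold_locales (rule d_ge_2, rule l_ge_1)
  have "integral {0..pi} (\<lambda>t. sin t ^ n * u t) = 2 * integral {0..pi / 2} (\<lambda>t. sin t ^ n * u t)"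
    by (rule integral_symmetric_pi) (auto intro!: continuous_intros u_cont simp: zonal_reflect [OF l_even])
  hence "integral {0..pi / 2} (\<lambda>t. sin t ^ n * u t) = 0" using integral_zonal_eq_0 by simp
  thus ?thesis using integral_SS_zonal [of "\<lambda>x. x"] by (simp add: continuous_on_id)
qed

text \<open>The constant 4/pi is the 2/pi of the sign correlation times the 2 of the folding. The
  linear term can be subtracted because its integral over the half meridian vanishes as
  well.\<close>

lemma variance_defect_eq:
  "variance (defect T) = 4 / pi * sphere_mass d * sphere_mass (d - 1) *
     integral {0..pi / 2} (\<lambda>t. sin t ^ (d - 1) * (arcsin (zonal d l t) - zonal d l t))"
proof -
  have c: "continuous_on {-1..1} arcsin" by (rule continuous_on_arcsin')
  interpret zonal_fun d l by unfold_locales (rule d_ge_2, rule l_ge_1)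
  have rng: "u ` {0..pi / 2} \<subseteq> {-1..1}" using abs_u_le_1 by (fastforce simp: abs_le_iff)
  have i1: "(\<lambda>t. sin t ^ n * arcsin (u t)) integrable_on {0..pi / 2}"
    by (intro integrable_continuous_real continuous_intros continuous_on_compose2 [OF c u_cont] rng)
  have i2: "(\<lambda>t. sin t ^ n * u t) integrable_on {0..pi / 2}"
    by (intro integrable_continuous_real continuous_intros u_cont)
  have z: "integral {0..pi / 2} (\<lambda>t. sin t ^ n * u t) = 0"
    using integral_SS_zonal [of "\<lambda>x. x"] integral_SS_G sphere_mass_pos [of d] sphere_mass_pos [of n]
    by (simp add: continuous_on_id)
  have "integral {0..pi / 2} (\<lambda>t. sin t ^ n * (arcsin (u t) - u t)) = integral {0..pi / 2} (\<lambda>t. sin t ^ n * arcsin (u t))"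
    using Henstock_Kurzweil_Integration.integral_diff [OF i1 i2] z by (simp add: right_diff_distrib)
  thus ?thesis using variance_defect integral_SS_zonal [OF c] by simp
qed

lemma integral_arcsin_ge_power:
  assumes "k \<ge> 1"
  shows "arcsin_coeff k * integral {0..pi / 2} (\<lambda>t. sin t ^ (d - 1) * zonal d l t ^ (2 * k + 1)) \<le>
    integral {0..pi / 2} (\<lambda>t. sin t ^ (d - 1) * (arcsin (zonal d l t) - zonal d l t))"
proof -
  let ?m = "2 * sphere_mass d * sphere_mass (d - 1)"
  have m: "?m > 0" using sphere_mass_pos [of d] sphere_mass_pos [of "d - 1"] by simp
  have "(\<integral>p. G p \<partial>SS) + arcsin_coeff k * (\<integral>p. G p ^ (2 * k + 1) \<partial>SS) \<le> (\<integral>p. arcsin (G p) \<partial>SS)"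
    by (rule integral_arcsin_ge) (use abs_G_le_1 integral_G_power_nonneg assms SS.finite_measure_axioms in auto)
  moreover have "(\<integral>p. arcsin (G p) \<partial>SS) = ?m * integral {0..pi / 2} (\<lambda>t. sin t ^ (d - 1) * (arcsin (zonal d l t) - zonal d l t))"
    using variance_defect variance_defect_eq by (simp add: field_simps)
  moreover have "(\<integral>p. G p ^ (2 * k + 1) \<partial>SS) = ?m * integral {0..pi / 2} (\<lambda>t. sin t ^ (d - 1) * zonal d l t ^ (2 * k + 1))"
    by (rule integral_SS_zonal) (intro continuous_intros)
  ultimately have "?m * (arcsin_coeff k * integral {0..pi / 2} (\<lambda>t. sin t ^ (d - 1) * zonal d l t ^ (2 * k + 1))) \<le>
     ?m * integral {0..pi / 2} (\<lambda>t. sin t ^ (d - 1) * (arcsin (zonal d l t) - zonal d l t))"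
    using integral_SS_G by (simp add: mult_ac)
  thus ?thesis using m by (simp only: mult_le_cancel_left_pos)
qed

end

theorem theorem6p2p2:
  fixes d :: nat
    and M :: "nat \<Rightarrow> 'w measure"
    and T :: "nat \<Rightarrow> 'a::euclidean_space \<Rightarrow> 'w \<Rightarrow> real"
  assumes "d \<ge> 2"
    and "DIM('a) = d + 1"
    and "\<And>l. gaussian_eigenfunction (M l) d l (T l)"
  shows "improper_integrable (defect_integrand d) \<and>
    defect_const d > 0 \<and>
    (\<lambda>l. prob_space.variance (M l) (defect (T l)))
      \<sim>[inf sequentially (principal {l. even l})] (\<lambda>l. defect_const d / real l ^ d)"
proof -
  define F where "F = inf sequentially (principal {l::nat. even l})"
  have F: "F \<le> sequentially" by (simp add: F_def)
  \<comment> \<open>Comparing two limits requires a proper filter, that is, arbitrarily large even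
    degrees.\<close>
  have F_bot: "F \<noteq> bot"
  proof -
    have "\<exists>\<^sub>F l in sequentially. even (l::nat)"
      unfolding frequently_sequentially by (metis even_mult_iff even_numeral le_add2 mult_2)
    thus ?thesis by (auto simp: F_def trivial_limit_def eventually_inf_principal frequently_def elim: eventually_mono)
  qed
  have ev: "eventually (\<lambda>l. eigenfunction (M l) d l (T l)) F"
    unfolding F_def eventually_inf_principal using eventually_ge_at_top [of 1]
    by eventually_elim (use assms in \<open>auto simp: eigenfunction_def\<close>)
  define H where "H x = arcsin x - x" for x :: real
  have Hc: "continuous_on {-1..1} H"
    unfolding H_def by (intro continuous_intros continuous_on_arcsin')
  obtain B where B: "B \<ge> 0" "\<And>x. \<bar>x\<bar> \<le> 1 \<Longrightarrow> \<bar>H x - 1 / 6 * x ^ 3\<bar> \<le> B * \<bar>x\<bar> ^ 5"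
    unfolding H_def using arcsin_cubic_bound by blast
  define V where "V l = integral {0..pi / 2} (\<lambda>t. sin t ^ (d - 1) * H (zonal d l t))" for l
  obtain J where J: "((\<lambda>A. integral {0..A} (\<lambda>x. x ^ (d - 1) * H (bessel_lim d x))) \<longlongrightarrow> J) at_top"
    "(\<lambda>l. real l ^ d * V l) \<longlonglongrightarrow> J"
    unfolding V_def by (rule scaling_limit [OF assms(1) Hc B(2,1)])
  have JF: "((\<lambda>l. real l ^ d * V l) \<longlongrightarrow> J) F" by (rule tendsto_mono [OF F J(2)])
  \<comment> \<open>At 0 the two functions inside differ, because \<open>scaled_bessel\<close> is 0
    there and \<open>bessel_lim\<close> is 1. The factor \<open>x ^ (d - 1)\<close> hides this,
    since \<open>d \<ge> 2\<close>.\<close>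
  have eq: "defect_integrand d x = x ^ (d - 1) * H (bessel_lim d x)" if "x \<ge> 0" for x
  proof (cases "x = 0")
    case True
    thus ?thesis using assms(1) by (simp add: defect_integrand_def)
  next
    case False
    thus ?thesis using that assms(1)
      by (simp add: defect_integrand_def scaled_bessel_eq_series bessel_lim_def H_def)
  qed
  have int_eq: "integral {0..A} (defect_integrand d) = integral {0..A} (\<lambda>x. x ^ (d - 1) * H (bessel_lim d x))" for A
    by (intro integral_cong) (simp add: eq)
  have "improper_integrable (defect_integrand d)"
    unfolding improper_integrable_def
  proof (intro conjI allI impI)
    fix A :: real assume "0 \<le> A"
    from scaled_integral_tendsto(1) [OF assms(1) Hc this]
    show "defect_integrand d integrable_on {0..A}" by (rule integrable_eq) (simp add: eq)
  next
    show "\<exists>I. ((\<lambda>A. integral {0..A} (defect_integrand d)) \<longlongrightarrow> I) at_top" unfolding int_eq using J(1) by blast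
  qed
  moreover have "improper_integral (defect_integrand d) = J"
    unfolding improper_integral_def int_eq by (rule tendsto_Lim [OF _ J(1)]) simp
  hence C: "defect_const d = 4 / pi * sphere_mass d * sphere_mass (d - 1) * J" by (simp add: defect_const_def)
  obtain k K where k: "k \<ge> 2" "K > 0"
    "(\<lambda>l. real l ^ d * integral {0..pi / 2} (\<lambda>x. sin x ^ (d - 1) * zonal d l x ^ (2 * k + 1))) \<longlonglongrightarrow> K"
    using bessel_lim_power_pos [OF assms(1)] by blast
  \<comment> \<open>The inequality is available at even degrees only, so the two limits, which exist
    along all degrees, are compared along \<open>F\<close>.\<close>
  have "arcsin_coeff k * K \<le> J"
  proof (rule tendsto_le [OF F_bot JF])
    show "((\<lambda>l. arcsin_coeff k * (real l ^ d * integral {0..pi / 2} (\<lambda>x. sin x ^ (d - 1) * zonal d l x ^ (2 * k + 1)))) \<longlongrightarrow> arcsin_coeff k * K) F"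
      by (intro tendsto_mult tendsto_const tendsto_mono [OF F k(3)])
    show "\<forall>\<^sub>F l in F. arcsin_coeff k * (real l ^ d * integral {0..pi / 2} (\<lambda>x. sin x ^ (d - 1) * zonal d l x ^ (2 * k + 1))) \<le> real l ^ d * V l"
      using ev
    proof eventually_elim
      case (elim l)
      interpret eigenfunction "M l" d l "T l" by (rule elim)
      have "real l ^ d * (arcsin_coeff k * integral {0..pi / 2} (\<lambda>x. sin x ^ (d - 1) * zonal d l x ^ (2 * k + 1))) \<le> real l ^ d * V l"
        unfolding V_def H_def using k(1) by (intro mult_left_mono integral_arcsin_ge_power) auto
      thus ?case by (simp add: mult.left_commute)
    qed
  qed
  hence "J > 0" using k(2) arcsin_coeff_pos [of k] mult_pos_pos less_le_trans by blast
  hence Cpos: "defect_const d > 0"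
    unfolding C using sphere_mass_pos [of d] sphere_mass_pos [of "d - 1"] by simp
  moreover have "(\<lambda>l. prob_space.variance (M l) (defect (T l))) \<sim>[F] (\<lambda>l. defect_const d / real l ^ d)"
  proof (rule asymp_equivI')
    have "((\<lambda>l. real l ^ d * V l / J) \<longlongrightarrow> J / J) F"
      by (intro tendsto_divide JF tendsto_const) (use \<open>J > 0\<close> in simp)
    hence "((\<lambda>l. real l ^ d * V l / J) \<longlongrightarrow> 1) F" using \<open>J > 0\<close> by simp
    thus "((\<lambda>l. prob_space.variance (M l) (defect (T l)) / (defect_const d / real l ^ d)) \<longlongrightarrow> 1) F"
    proof (rule Lim_transform_eventually)
      show "\<forall>\<^sub>F l in F. real l ^ d * V l / J = prob_space.variance (M l) (defect (T l)) / (defect_const d / real l ^ d)"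
        using ev
      proof eventually_elim
        case (elim l)
        interpret eigenfunction "M l" d l "T l" by (rule elim)
        have "variance (defect (T l)) = 4 / pi * sphere_mass d * sphere_mass (d - 1) * V l"
          unfolding V_def H_def by (rule variance_defect_eq)
        thus ?case unfolding C using sphere_mass_pos [of d] sphere_mass_pos [of "d - 1"] by simp
      qed
    qed
  qed
  ultimately show ?thesis unfolding F_def by blast
qed

end
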